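(* Let $(X_t)_{t\in\mathbb{Z}}$ be a strictly stationary time series with marginal cdf $F$, and let $q>2$ be such that $\mathbb{E}(|X_0|^q)<\infty$. Assume: (i) $(X_t)$ is $S$-mixing, there are constants $\theta>0$ and $c>0$ such that $|F(x)-F(y)|\le c|x-y|^{\theta}$ for all $x,y\in\mathbb{R}$, and condition (A) of $S$-mixing is satisfied with $\gamma_m=m^{-A_1/\theta}$ and $\delta_m=O(m^{-A_1})$ for some $A_1>4$; (ii) $(X_t)$ is $M_q$-mixing with $\varrho_m=O(m^{-A_2})$, where $$A_2> \max\bigg\{ 1, \frac{q-2}{2\eta } \bigg( 1-\frac{1+\eta}{q} \bigg) \bigg\}\quad\text{and}\quad \frac{1+\eta}{q}<\frac12$$ for some $\eta>0$. Let $F_n$ be the empirical cdf based on $X_1,\dots,X_n$. Then the following statements hold as $n\to\infty$. (1) Let $p\in(0,1)$ and $h(x)=(x-F^{-1}(p))^{+}$. If $F^{-1}$ is continuous at the point $p$, then, with $\nu^2=\sum_{k=-\infty}^{\infty}\mathrm{Cov}(h(X_0),h(X_k))$, $$\sqrt{n}\,\bigg(\frac1n\sum_{i=1}^n h(X_i)-\mathbb{E}(h(X_0))\bigg)\stackrel{d}{\to}\mathcal{N}(0,\nu^2)\quad\text{and}\quad \sqrt{n}\,\left( \int_p^1 F_n^{-1}(u)\, du -\int_p^1 F^{-1}(u)\, du \right)\stackrel{d}{\to}\mathcal{N}(0,\nu^2).$$ (2) Let $p\in(0,1)$ and $h(x)=(F^{-1}(p)-x)^{+}$. If $F^{-1}$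 is continuous at the point $p$, then, with $\nu^2=\sum_{k=-\infty}^{\infty}\mathrm{Cov}(h(X_0),h(X_k))$, $$\sqrt{n}\,\bigg(\frac1n\sum_{i=1}^n h(X_i)-\mathbb{E}(h(X_0))\bigg)\stackrel{d}{\to}\mathcal{N}(0,\nu^2)\quad\text{and}\quad \sqrt{n}\,\left( \int_0^p F_n^{-1}(u)\, du -\int_0^p F^{-1}(u)\, du \right)\stackrel{d}{\to}\mathcal{N}(0,\nu^2).$$ (3) Let $0<p_1<p_2<1$ and $h(x)=(F^{-1}(p_2)-x)^{+}-(F^{-1}(p_1)-x)^{+}$. If $F^{-1}$ is continuous at the points $p_1$ and $p_2$, then, with $\nu^2=\sum_{k=-\infty}^{\infty}\mathrm{Cov}(h(X_0),h(X_k))$, $$\sqrt{n}\,\bigg(\frac1n\sum_{i=1}^n h(X_i)-\mathbb{E}(h(X_0))\bigg)\stackrel{d}{\to}\mathcal{N}(0,\nu^2)\quad\text{and}\quad \sqrt{n}\,\left( \int_{p_1}^{p_2} F_n^{-1}(u)\, du -\int_{p_1}^{p_2} F^{-1}(u)\, du \right)\stackrel{d}{\to}\mathcal{N}(0,\nu^2).$$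
   Context: The quantile function of a cdf $F$ is $F^{-1}(u)=\inf\{x\in\mathbb{R}: F(x)\ge u\}$ for $u\in(0,1]$ and $F^{-1}(0)=\lim_{u\downarrow 0}F^{-1}(u)$. The empirical cdf is $F_n(x)=\frac1n\sum_{i=1}^n\mathbf{1}\{X_i\le x\}$. $z^{+}=z\vee 0$. For sets of integers, $\mathrm{dist}(I,J)=\inf\{|a-b|: a\in I, b\in J\}$. $S$-mixing: a time series $(X_t)_{t\in\mathbb{Z}}$ is $S$-mixing if: (A) for any $t\in\mathbb{Z}$ and $m\in\mathbb{N}$ there is a random variable $\Upsilon_t^{(m)}$ such that $\mathbb{P}(|X_t-\Upsilon_t^{(m)}|\ge\gamma_m)\le\delta_m$ for some deterministic sequences $\gamma_m\to0$ and $\delta_m\to0$; (B) for any disjoint intervals $I_1,\dots,I_r\subset\mathbb{Z}$ of integers and any positive integers $m_1,\dots,m_r$, the vectors $(\Upsilon_t^{(m_1)},t\in I_1),\dots,(\Upsilon_t^{(m_r)},t\in I_r)$ are independent provided that $\mathrm{dist}(I_i,I_j)>m_i+m_j$ for all $1\le i<j\le r$. $M_q$-mixing ($q\ge1$): a time series $(X_t)_{t\in\mathbb{Z}}$ is $M_q$-mixing if: (C) for any $t\in\mathbb{Z}$ and $m\in\mathbb{N}$ there is a random variable $\Psi_t^{(m)}$ such that $(\mathbb{E}(|X_t-\Psi_t^{(m)}|^q))^{1/q}\le\varrho_m$ for some deterministic sequence $\varrho_m\to0$; (D) for any disjoint intervals $I_1,\dots,I_r\subset\mathbb{Z}$ of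 integers and any positive integers $m_1,\dots,m_r$, the vectors $(\Psi_t^{(m_1)},t\in I_1),\dots,(\Psi_t^{(m_r)},t\in I_r)$ are independent provided that $\mathrm{dist}(I_i,I_j)>\max\{m_i,m_j\}$ for all $1\le i<j\le r$. $\stackrel{d}{\to}$ denotes convergence in distribution; $\mathcal{N}(0,\nu^2)$ is the normal distribution (degenerate at $0$ if $\nu^2=0$). *)

theory Defs
  imports "HOL-Probability.Probability"
begin

section \<open>Distribution and quantile functions\<close>

text \<open>
  Extended-real valued, because the infimum at \<open>u = 1\<close> and the limit at \<open>u = 0\<close> may be infinite.
  Only arguments in \<open>[0, 1]\<close> are meaningful.
\<close>

definition quantile :: "(real \<Rightarrow> real) \<Rightarrow> real \<Rightarrow> ereal" where
  "quantile F u =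
     (if u = 0 then Lim (at_right 0) (\<lambda>v. INF x\<in>{x. F x \<ge> v}. ereal x)
      else INF x\<in>{x. F x \<ge> u}. ereal x)"

text \<open>For a cdf, this agrees with \<^const>\<open>quantile\<close> on the open unit interval, where the latter is finite.\<close>

definition rquantile :: "(real \<Rightarrow> real) \<Rightarrow> real \<Rightarrow> real" where
  "rquantile F u = real_of_ereal (quantile F u)"

definition ecdf :: "(int \<Rightarrow> 'a \<Rightarrow> real) \<Rightarrow> nat \<Rightarrow> 'a \<Rightarrow> real \<Rightarrow> real" where
  "ecdf X n \<omega> x = (\<Sum>i=1..n. indicator {..x} (X (int i) \<omega>)) / real n"

definition pos_part :: "real \<Rightarrow> real" where
  "pos_part z = max z 0"

definition covar :: "'a measure \<Rightarrow> ('a \<Rightarrow> real) \<Rightarrow> ('a \<Rightarrow> real) \<Rightarrow> real" where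
  "covar M Y Z =
     (LINT \<omega>|M. (Y \<omega> - (LINT \<omega>'|M. Y \<omega>')) * (Z \<omega> - (LINT \<omega>'|M. Z \<omega>')))"

text \<open>The argument is the standard deviation, as in \<^const>\<open>normal_density\<close>.\<close>

definition centered_normal :: "real \<Rightarrow> real measure" where
  "centered_normal \<sigma> =
     (if \<sigma> = 0 then return borel 0 else density lborel (normal_density 0 \<sigma>))"

section \<open>Time series\<close>

definition strictly_stationary :: "'a measure \<Rightarrow> (int \<Rightarrow> 'a \<Rightarrow> real) \<Rightarrow> bool" where
  "strictly_stationary M X \<longleftrightarrow>
     (\<forall>J k. finite J \<longrightarrow>
        distr M (\<Pi>\<^sub>M t\<in>J. borel) (\<lambda>\<omega>. \<lambda>t\<in>J. X (t + k) \<omega>) =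
        distr M (\<Pi>\<^sub>M t\<in>J. borel) (\<lambda>\<omega>. \<lambda>t\<in>J. X t \<omega>))"

text \<open>Intervals of integers may be unbounded.\<close>

definition int_interval :: "int set \<Rightarrow> bool" where
  "int_interval I \<longleftrightarrow> (\<forall>a\<in>I. \<forall>b\<in>I. {a..b} \<subseteq> I)"

definition int_set_dist :: "int set \<Rightarrow> int set \<Rightarrow> enat" where
  "int_set_dist I J = (INF a\<in>I. INF b\<in>J. enat (nat \<bar>a - b\<bar>))"

text \<open>
  The independence requirement common to both notions of mixing: \<open>gap m\<^sub>i m\<^sub>j\<close> is the
  distance that the index intervals have to exceed.
\<close>

definition separated_blocks_indep ::
    "'a measure \<Rightarrow> (int \<Rightarrow> nat \<Rightarrow> 'a \<Rightarrow> real) \<Rightarrow> (nat \<Rightarrow> nat \<Rightarrow> nat) \<Rightarrow> bool" where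
  "separated_blocks_indep M Y gap \<longleftrightarrow>
     (\<forall>(r::nat) (I :: nat \<Rightarrow> int set) (m :: nat \<Rightarrow> nat).
        disjoint_family_on I {1..r} \<and> (\<forall>i\<in>{1..r}. int_interval (I i) \<and> m i > 0) \<and>
        (\<forall>i\<in>{1..r}. \<forall>j\<in>{1..r}. i < j \<longrightarrow> int_set_dist (I i) (I j) > enat (gap (m i) (m j))) \<longrightarrow>
        prob_space.indep_vars M (\<lambda>i. \<Pi>\<^sub>M t\<in>I i. borel) (\<lambda>i \<omega>. \<lambda>t\<in>I i. Y t (m i) \<omega>) {1..r})"

text \<open>
  In both mixing notions the approximation index \<open>m\<close> is a positive integer, and the rate
  sequences are parameters.
\<close>

definition S_mixing ::
    "'a measure \<Rightarrow> (int \<Rightarrow> 'a \<Rightarrow> real) \<Rightarrow> (nat \<Rightarrow> real) \<Rightarrow> (nat \<Rightarrow> real) \<Rightarrow> bool" where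
  "S_mixing M X \<gamma> \<delta> \<longleftrightarrow>
     \<gamma> \<longlonglongrightarrow> 0 \<and> \<delta> \<longlonglongrightarrow> 0 \<and>
     (\<exists>\<Upsilon> :: int \<Rightarrow> nat \<Rightarrow> 'a \<Rightarrow> real.
        (\<forall>t. \<forall>m>0. \<Upsilon> t m \<in> borel_measurable M \<and>
           measure M {\<omega> \<in> space M. \<bar>X t \<omega> - \<Upsilon> t m \<omega>\<bar> \<ge> \<gamma> m} \<le> \<delta> m) \<and>
        separated_blocks_indep M \<Upsilon> (\<lambda>m m'. m + m'))"

text \<open>Integrability is explicit, as the Bochner integral of a nonintegrable function is \<open>0\<close>.\<close>

definition M_mixing ::
    "'a measure \<Rightarrow> real \<Rightarrow> (int \<Rightarrow> 'a \<Rightarrow> real) \<Rightarrow> (nat \<Rightarrow> real) \<Rightarrow> bool" where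
  "M_mixing M q X \<rho> \<longleftrightarrow>
     q \<ge> 1 \<and> \<rho> \<longlonglongrightarrow> 0 \<and>
     (\<exists>\<Psi> :: int \<Rightarrow> nat \<Rightarrow> 'a \<Rightarrow> real.
        (\<forall>t. \<forall>m>0. \<Psi> t m \<in> borel_measurable M \<and>
           integrable M (\<lambda>\<omega>. \<bar>X t \<omega> - \<Psi> t m \<omega>\<bar> powr q) \<and>
           (LINT \<omega>|M. \<bar>X t \<omega> - \<Psi> t m \<omega>\<bar> powr q) powr (1 / q) \<le> \<rho> m) \<and>
        separated_blocks_indep M \<Psi> max)"

end

theory Submission
  imports Defs "HOL-Real_Asymp.Real_Asymp"
begin

text \<open>
  The central limit theorem holds for every Lipschitz function \<open>g\<close>. The \<open>M\<^sub>q\<close>-approximations satisfy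
  the same rate in \<open>L\<^sup>2\<close>, since \<open>q > 2\<close>, and give \<open>\<bar>Cov (g (X 0)) (g (X k))\<bar> = O(k powr -A2)\<close>, which is
  summable because \<open>A2 > 1\<close>. Replacing \<open>X t\<close> by its approximation of order \<open>m = n powr a\<close> with
  \<open>1/(2 A2) < a < 1/2\<close> costs \<open>n O(m powr -A2) = o(sqrt n)\<close> in the sum, after which blocks of slightly
  longer length, separated by gaps of length \<open>m\<close>, are independent. Clipping \<open>g\<close> at a slowly growing
  level makes the block sums \<open>o(sqrt n)\<close> uniformly, so a Taylor expansion of their characteristic
  functions suffices.

  For the integrated quantiles, \<open>\<integral>\<^sub>0\<^sup>p F\<^sup>-\<^sup>1 = max\<^sub>b (b p - E (b - X)\<^sup>+)\<close>, attained at \<open>b = F\<^sup>-\<^sup>1(p)\<close>, and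
  likewise for the sample. Evaluating the sample functional at the population quantile gives the sum
  treated above. The error is at most the integral of \<open>\<bar>F\<^sub>n - F\<bar>\<close> between the two quantiles: as the
  sample quantile is consistent by continuity of \<open>F\<^sup>-\<^sup>1\<close> at \<open>p\<close>, and \<open>E \<bar>F\<^sub>n(x) - F(x)\<bar> = O(1/sqrt n)\<close>
  uniformly in \<open>x\<close> by \<open>S\<close>-mixing and Hoelder continuity, the error is \<open>o(1/sqrt n)\<close> in probability.
\<close>

section \<open>Square-integrable random variables\<close>

text \<open>The two mixing conditions meet summands of different regularity. A Lipschitz function
  passes an \<open>L2\<close> error on up to its constant, so M_q-mixing suffices for the central
  limit theorem. The indicators in the empirical cdf jump: \<open>X t\<close> and its approximation
  may be close and yet lie on two sides of \<open>x\<close>. Hoelder continuity makes this unlikely,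
  but the probability bounds a squared norm, which halves the rate exponent. Covariances are only
  ever estimated from pairs; joint independence of many blocks serves to factor a characteristic
  function. No block variance is computed either: the normalised block sum is
  \<open>L2\<close>-close to the full sum, whose variance is a Cesaro mean of covariance sums. The
  remainder of the quantile functional is squeezed from two sides. Optimality of the sample quantile
  for the sample makes it nonnegative, optimality of the population quantile for the population
  bounds it above. Continuity at \<open>p\<close> excludes a flat piece of \<open>F\<close> at level
  \<open>p\<close>, on which the sample quantile could wander. Upper and middle integrals reduce to
  lower ones, since the integral over the unit interval is the mean.\<close>

definition L2 :: "'a measure \<Rightarrow> ('a \<Rightarrow> real) \<Rightarrow> bool" where
  "L2 M Y \<longleftrightarrow> Y \<in> borel_measurable M \<and> integrable M (\<lambda>\<omega>. (Y \<omega>)\<^sup>2)"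

definition l2norm :: "'a measure \<Rightarrow> ('a \<Rightarrow> real) \<Rightarrow> real" where
  "l2norm M Y = sqrt (LINT \<omega>|M. (Y \<omega>)\<^sup>2)"

lemma L2_measurable[measurable_dest]: "L2 M Y \<Longrightarrow> Y \<in> borel_measurable M"
  by (simp add: L2_def)

lemma L2_square_integrable: "L2 M Y \<Longrightarrow> integrable M (\<lambda>\<omega>. (Y \<omega>)\<^sup>2)"
  by (simp add: L2_def)

lemma L2_mult_integrable:
  assumes "L2 M Y" "L2 M Z"
  shows "integrable M (\<lambda>\<omega>. Y \<omega> * Z \<omega>)"
proof (rule Bochner_Integration.integrable_bound)
  show "integrable M (\<lambda>\<omega>. (Y \<omega>)\<^sup>2 + (Z \<omega>)\<^sup>2)"
    using assms by (auto simp: L2_def)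
  show "AE \<omega> in M. norm (Y \<omega> * Z \<omega>) \<le> norm ((Y \<omega>)\<^sup>2 + (Z \<omega>)\<^sup>2)"
  proof (intro AE_I2)
    fix \<omega>
    have "2 * (\<bar>Y \<omega>\<bar> * \<bar>Z \<omega>\<bar>) \<le> (Y \<omega>)\<^sup>2 + (Z \<omega>)\<^sup>2"
      using sum_squares_bound[of "\<bar>Y \<omega>\<bar>" "\<bar>Z \<omega>\<bar>"] by simp
    moreover have "0 \<le> \<bar>Y \<omega>\<bar> * \<bar>Z \<omega>\<bar>" by simp
    ultimately show "norm (Y \<omega> * Z \<omega>) \<le> norm ((Y \<omega>)\<^sup>2 + (Z \<omega>)\<^sup>2)"
      unfolding real_norm_def abs_mult by linarith
  qed
qed (use assms in \<open>auto simp: L2_def\<close>)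

lemma L2_cmult: "L2 M Y \<Longrightarrow> L2 M (\<lambda>\<omega>. a * Y \<omega>)"
  by (auto simp: L2_def power_mult_distrib)

lemma L2_add:
  assumes "L2 M Y" "L2 M Z"
  shows "L2 M (\<lambda>\<omega>. Y \<omega> + Z \<omega>)"
  using assms L2_mult_integrable[OF assms]
  by (auto simp: L2_def power2_sum mult.assoc intro!: Bochner_Integration.integrable_add)

lemma L2_diff:
  assumes "L2 M Y" "L2 M Z"
  shows "L2 M (\<lambda>\<omega>. Y \<omega> - Z \<omega>)"
  using L2_add[OF assms(1) L2_cmult[OF assms(2), of "-1"]] by simp

lemma L2_zero: "L2 M (\<lambda>\<omega>. 0)"
  by (simp add: L2_def)

lemma L2_sum: "(\<And>i. i \<in> I \<Longrightarrow> L2 M (Y i)) \<Longrightarrow> L2 M (\<lambda>\<omega>. \<Sum>i\<in>I. Y i \<omega>)"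
  by (induction I rule: infinite_finite_induct) (auto intro: L2_add L2_zero)

lemma l2norm_nonneg[simp]: "0 \<le> l2norm M Y"
  by (simp add: l2norm_def)

lemma l2norm_power2: "(l2norm M Y)\<^sup>2 = (LINT \<omega>|M. (Y \<omega>)\<^sup>2)"
  by (simp add: l2norm_def)

lemma l2norm_cmult: "l2norm M (\<lambda>\<omega>. a * Y \<omega>) = \<bar>a\<bar> * l2norm M Y"
  by (simp add: l2norm_def power_mult_distrib real_sqrt_mult)

lemma l2norm_mono:
  assumes "L2 M Z" "Y \<in> borel_measurable M" "\<And>\<omega>. \<bar>Y \<omega>\<bar> \<le> \<bar>Z \<omega>\<bar>"
  shows "L2 M Y" "l2norm M Y \<le> l2norm M Z"
proof -
  have sq: "(Y \<omega>)\<^sup>2 \<le> (Z \<omega>)\<^sup>2" for \<omega>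
    using assms(3)[of \<omega>] by (simp add: abs_le_square_iff)
  have i: "integrable M (\<lambda>\<omega>. (Y \<omega>)\<^sup>2)"
    by (rule Bochner_Integration.integrable_bound[of M "\<lambda>\<omega>. (Z \<omega>)\<^sup>2"]) (use assms sq in \<open>auto simp: L2_def\<close>)
  then show "L2 M Y" using assms by (auto simp: L2_def)
  show "l2norm M Y \<le> l2norm M Z"
    unfolding l2norm_def using i assms sq by (auto simp: L2_def intro!: integral_mono)
qed

text \<open>The discriminant argument: the second moment of \<open>Y - t * Z\<close> is a
  nonnegative quadratic in \<open>t\<close>, evaluated at its minimiser
  \<open>b / c\<close>.\<close>

lemma Cauchy_Schwarz_expectation:
  assumes "L2 M Y" "L2 M Z"
  shows "\<bar>LINT \<omega>|M. Y \<omega> * Z \<omega>\<bar> \<le> l2norm M Y * l2norm M Z"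
proof -
  define a b c where "a = (LINT \<omega>|M. (Y \<omega>)\<^sup>2)" and "b = (LINT \<omega>|M. Y \<omega> * Z \<omega>)"
    and "c = (LINT \<omega>|M. (Z \<omega>)\<^sup>2)"
  have quad: "0 \<le> a - 2 * t * b + t\<^sup>2 * c" for t
  proof -
    have "0 \<le> (LINT \<omega>|M. (Y \<omega> - t * Z \<omega>)\<^sup>2)" by simp
    also have "\<dots> = (LINT \<omega>|M. (Y \<omega>)\<^sup>2 - (2 * t) * (Y \<omega> * Z \<omega>) + t\<^sup>2 * (Z \<omega>)\<^sup>2)"
      by (rule Bochner_Integration.integral_cong) (auto simp: power2_diff power_mult_distrib)
    also have "\<dots> = a - 2 * t * b + t\<^sup>2 * c"
      unfolding a_def b_def c_def
      using L2_mult_integrable[OF assms] assms[THEN L2_square_integrable] by simp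
    finally show ?thesis .
  qed
  have "b\<^sup>2 \<le> a * c"
  proof (cases "c = 0")
    case True
    have "b = 0"
    proof (rule ccontr)
      assume "b \<noteq> 0"
      \<comment> \<open>With \<open>c = 0\<close> the quadratic is affine in \<open>t\<close>, and
        this \<open>t\<close> gives it the value \<open>-1\<close>.\<close>
      then show False using quad[of "(a + 1) / (2 * b)"] True by (simp add: field_simps)
    qed
    then show ?thesis using True by simp
  next
    case False
    then have "c > 0" by (simp add: c_def order_less_le)
    then show ?thesis using quad[of "b / c"] by (simp add: field_simps power2_eq_square)
  qed
  then have "sqrt (b\<^sup>2) \<le> sqrt (a * c)" by (rule real_sqrt_le_mono)
  then show ?thesis by (simp add: a_def b_def c_def l2norm_def flip: real_sqrt_mult)
qed

lemma l2norm_triangle: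
  assumes "L2 M Y" "L2 M Z"
  shows "l2norm M (\<lambda>\<omega>. Y \<omega> + Z \<omega>) \<le> l2norm M Y + l2norm M Z"
proof (rule power2_le_imp_le)
  have "(l2norm M (\<lambda>\<omega>. Y \<omega> + Z \<omega>))\<^sup>2 = (LINT \<omega>|M. (Y \<omega>)\<^sup>2 + (Z \<omega>)\<^sup>2 + 2 * (Y \<omega> * Z \<omega>))"
    unfolding l2norm_power2
    by (rule Bochner_Integration.integral_cong) (auto simp: power2_sum)
  also have "\<dots> = (l2norm M Y)\<^sup>2 + (l2norm M Z)\<^sup>2 + 2 * (LINT \<omega>|M. Y \<omega> * Z \<omega>)"
    unfolding l2norm_power2
    using L2_mult_integrable[OF assms] assms[THEN L2_square_integrable] by simp
  also have "\<dots> \<le> (l2norm M Y + l2norm M Z)\<^sup>2"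
    using Cauchy_Schwarz_expectation[OF assms] by (simp add: power2_sum)
  finally show "(l2norm M (\<lambda>\<omega>. Y \<omega> + Z \<omega>))\<^sup>2 \<le> (l2norm M Y + l2norm M Z)\<^sup>2" .
qed simp

lemma l2norm_minus_commute: "l2norm M (\<lambda>\<omega>. Y \<omega> - Z \<omega>) = l2norm M (\<lambda>\<omega>. Z \<omega> - Y \<omega>)"
  by (simp add: l2norm_def power2_commute)

lemma l2norm_triangle_diff:
  assumes "L2 M Y" "L2 M Z"
  shows "l2norm M Y \<le> l2norm M Z + l2norm M (\<lambda>\<omega>. Y \<omega> - Z \<omega>)"
  using l2norm_triangle[OF assms(2) L2_diff[OF assms]] by simp

lemma l2norm_sum_le:
  assumes "\<And>i. i \<in> I \<Longrightarrow> L2 M (Y i)"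
  shows "l2norm M (\<lambda>\<omega>. \<Sum>i\<in>I. Y i \<omega>) \<le> (\<Sum>i\<in>I. l2norm M (Y i))"
  using assms
proof (induction I rule: infinite_finite_induct)
  case (insert x F)
  then show ?case
    using l2norm_triangle[of M "Y x" "\<lambda>\<omega>. \<Sum>i\<in>F. Y i \<omega>"] by (fastforce intro: L2_sum)
qed (auto simp: l2norm_def)

context prob_space
begin

lemma L2_const: "L2 M (\<lambda>\<omega>. a)"
  by (simp add: L2_def)

lemma L2_bounded:
  assumes "Y \<in> borel_measurable M" "\<And>\<omega>. \<bar>Y \<omega>\<bar> \<le> B"
  shows "L2 M Y" "l2norm M Y \<le> B"
proof -
  have "0 \<le> B" using assms(2)[of undefined] by linarith
  have "l2norm M (\<lambda>\<omega>. B) = B" using \<open>0 \<le> B\<close> by (simp add: l2norm_def prob_space)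
  then show "L2 M Y" "l2norm M Y \<le> B"
    using l2norm_mono[OF L2_const[of B] assms(1)] assms(2) \<open>0 \<le> B\<close> by auto
qed

lemma L2_integrable:
  assumes "L2 M Y"
  shows "integrable M Y"
  using L2_mult_integrable[OF assms L2_const[of 1]] by simp

lemma abs_expectation_le_l2norm:
  assumes "L2 M Y"
  shows "expectation (\<lambda>\<omega>. \<bar>Y \<omega>\<bar>) \<le> l2norm M Y"
proof -
  have "L2 M (\<lambda>\<omega>. \<bar>Y \<omega>\<bar>)" using assms by (auto simp: L2_def)
  from Cauchy_Schwarz_expectation[OF this L2_const[of 1]]
  show ?thesis by (simp add: l2norm_def prob_space)
qed

lemma L2_centered: "L2 M Y \<Longrightarrow> L2 M (\<lambda>\<omega>. Y \<omega> - expectation Y)"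
  by (intro L2_diff L2_const)

lemma covar_eq:
  assumes "L2 M Y" "L2 M Z"
  shows "covar M Y Z = expectation (\<lambda>\<omega>. Y \<omega> * Z \<omega>) - expectation Y * expectation Z"
proof -
  note [simp] = L2_mult_integrable[OF assms] L2_integrable[OF assms(1)] L2_integrable[OF assms(2)]
  have "covar M Y Z = expectation (\<lambda>\<omega>. Y \<omega> * Z \<omega> - expectation Z * Y \<omega> - expectation Y * Z \<omega>
      + expectation Y * expectation Z)"
    unfolding covar_def by (rule Bochner_Integration.integral_cong) (auto simp: algebra_simps)
  also have "\<dots> = expectation (\<lambda>\<omega>. Y \<omega> * Z \<omega>) - expectation Y * expectation Z"
    by (simp add: prob_space)
  finally show ?thesis .
qed

lemma l2norm_centered_le:
  assumes "L2 M Y"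
  shows "l2norm M (\<lambda>\<omega>. Y \<omega> - expectation Y) \<le> l2norm M Y"
proof -
  have "(LINT \<omega>|M. (Y \<omega> - expectation Y)\<^sup>2) = covar M Y Y"
    by (simp add: covar_def power2_eq_square)
  also have "\<dots> \<le> (LINT \<omega>|M. (Y \<omega>)\<^sup>2)"
    unfolding covar_eq[OF assms assms] by (simp add: power2_eq_square)
  finally show ?thesis by (simp add: l2norm_def)
qed

lemma abs_covar_le:
  assumes "L2 M Y" "L2 M Z"
  shows "\<bar>covar M Y Z\<bar> \<le> l2norm M Y * l2norm M Z"
proof -
  have "\<bar>covar M Y Z\<bar> \<le> l2norm M (\<lambda>\<omega>. Y \<omega> - expectation Y) * l2norm M (\<lambda>\<omega>. Z \<omega> - expectation Z)"
    unfolding covar_def by (intro Cauchy_Schwarz_expectation L2_centered assms)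
  also have "\<dots> \<le> l2norm M Y * l2norm M Z"
    by (intro mult_mono l2norm_centered_le assms) auto
  finally show ?thesis .
qed

lemma covar_sym: "covar M Y Z = covar M Z Y"
  by (simp add: covar_def mult.commute)

text \<open>Bilinearity, replacing one argument at a time. For independent \<open>Z\<close> and
  \<open>Z'\<close> the last term vanishes and the other two are small.\<close>

lemma covar_split:
  assumes "L2 M Y" "L2 M Z" "L2 M Y'" "L2 M Z'"
  shows "covar M Y Y' = covar M (\<lambda>\<omega>. Y \<omega> - Z \<omega>) Y' + covar M Z (\<lambda>\<omega>. Y' \<omega> - Z' \<omega>) + covar M Z Z'"
proof -
  note [simp] = assms[THEN L2_integrable]
  note [simp] = assms(1,2)[THEN L2_mult_integrable, OF assms(3)]
    assms(1,2)[THEN L2_mult_integrable, OF assms(4)]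
  show ?thesis
    using assms by (simp add: covar_eq L2_diff left_diff_distrib right_diff_distrib)
qed

lemma covar_indep_eq_0:
  assumes "L2 M Y" "L2 M Z" "indep_var borel Y borel Z"
  shows "covar M Y Z = 0"
  using indep_var_lebesgue_integral[OF assms(3) L2_integrable[OF assms(1)] L2_integrable[OF assms(2)]]
    assms by (simp add: covar_eq)

text \<open>Cauchy-Schwarz gives \<open>e * B\<close> for the first error term of
  \<open>covar_split\<close> and \<open>(B + e) * e\<close> for the second, as the norm of
  \<open>Z\<close> may exceed \<open>B\<close> by \<open>e\<close>.\<close>

lemma covar_le_approx:
  assumes "L2 M Y" "L2 M Z" "L2 M Y'" "L2 M Z'"
    and "indep_var borel Z borel Z'"
    and "l2norm M Y \<le> B" "l2norm M Y' \<le> B"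
    and "l2norm M (\<lambda>\<omega>. Y \<omega> - Z \<omega>) \<le> e" "l2norm M (\<lambda>\<omega>. Y' \<omega> - Z' \<omega>) \<le> e"
  shows "\<bar>covar M Y Y'\<bar> \<le> e * (2 * B + e)"
proof -
  have e: "0 \<le> e" using assms(8) l2norm_nonneg order_trans by blast
  have "l2norm M Z \<le> l2norm M Y + l2norm M (\<lambda>\<omega>. Y \<omega> - Z \<omega>)"
    using l2norm_triangle_diff[OF assms(2,1)] by (simp add: l2norm_minus_commute[of M Z Y])
  then have Z: "l2norm M Z \<le> B + e" using assms by linarith
  have "\<bar>covar M Y Y'\<bar> \<le> \<bar>covar M (\<lambda>\<omega>. Y \<omega> - Z \<omega>) Y'\<bar> + \<bar>covar M Z (\<lambda>\<omega>. Y' \<omega> - Z' \<omega>)\<bar>"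
    unfolding covar_split[OF assms(1-4)] covar_indep_eq_0[OF assms(2,4,5)] by simp
  also have "\<bar>covar M (\<lambda>\<omega>. Y \<omega> - Z \<omega>) Y'\<bar> \<le> e * B"
    by (intro order_trans[OF abs_covar_le] mult_mono assms L2_diff e) auto
  also have "\<bar>covar M Z (\<lambda>\<omega>. Y' \<omega> - Z' \<omega>)\<bar> \<le> (B + e) * e"
    by (intro order_trans[OF abs_covar_le] mult_mono assms L2_diff Z) (use e Z l2norm_nonneg[of M Z] in \<open>linarith | simp\<close>)+
  finally show ?thesis by (simp add: algebra_simps)
qed

lemma covar_sum:
  assumes "\<And>i. i \<in> I \<Longrightarrow> L2 M (Y i)"
  shows "(l2norm M (\<lambda>\<omega>. \<Sum>i\<in>I. (Y i \<omega> - expectation (Y i))))\<^sup>2 = (\<Sum>s\<in>I. \<Sum>t\<in>I. covar M (Y s) (Y t))"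
proof -
  let ?C = "\<lambda>i \<omega>. Y i \<omega> - expectation (Y i)"
  have i: "integrable M (\<lambda>\<omega>. ?C s \<omega> * ?C t \<omega>)" if "s \<in> I" "t \<in> I" for s t
    using that assms by (intro L2_mult_integrable L2_centered) auto
  have "(l2norm M (\<lambda>\<omega>. \<Sum>i\<in>I. ?C i \<omega>))\<^sup>2 = expectation (\<lambda>\<omega>. \<Sum>s\<in>I. \<Sum>t\<in>I. ?C s \<omega> * ?C t \<omega>)"
    unfolding l2norm_power2
    by (rule Bochner_Integration.integral_cong) (auto simp: power2_eq_square sum_product)
  also have "\<dots> = (\<Sum>s\<in>I. \<Sum>t\<in>I. expectation (\<lambda>\<omega>. ?C s \<omega> * ?C t \<omega>))"
    using i by (subst Bochner_Integration.integral_sum; (intro Bochner_Integration.integrable_sum)?)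
      (auto intro!: sum.cong Bochner_Integration.integral_sum)
  finally show ?thesis by (simp add: covar_def)
qed

end

text \<open>Each distance from \<open>s\<close> is attained at most twice: the distance is injective
  on the times up to \<open>s\<close> and on those after \<open>s\<close>.\<close>

lemma sum_nat_abs_diff_le:
  fixes b :: "nat \<Rightarrow> real" and G :: "int set"
  assumes "summable b" "\<And>k. 0 \<le> b k" "finite G"
  shows "(\<Sum>t\<in>G. b (nat \<bar>s - t\<bar>)) \<le> 2 * suminf b"
proof -
  let ?f = "\<lambda>t. nat \<bar>s - t\<bar>"
  have half: "(\<Sum>t\<in>H. b (?f t)) \<le> suminf b" if "finite H" "inj_on ?f H" for H
  proof -
    have "(\<Sum>t\<in>H. b (?f t)) = sum b (?f ` H)" using sum.reindex[OF that(2), of b] by simp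
    also have "\<dots> \<le> suminf b" using that assms by (intro sum_le_suminf) auto
    finally show ?thesis .
  qed
  have "G = {t\<in>G. t \<le> s} \<union> {t\<in>G. s < t}" by auto
  then have "(\<Sum>t\<in>G. b (?f t)) = (\<Sum>t\<in>{t\<in>G. t \<le> s} \<union> {t\<in>G. s < t}. b (?f t))" by simp
  also have "\<dots> = (\<Sum>t\<in>{t\<in>G. t \<le> s}. b (?f t)) + (\<Sum>t\<in>{t\<in>G. s < t}. b (?f t))"
    using assms by (intro sum.union_disjoint) auto
  also have "\<dots> \<le> suminf b + suminf b"
    using assms(3) by (intro add_mono half) (auto simp: inj_on_def)
  finally show ?thesis by simp
qed

text \<open>Summable covariances make the variance at most linear in the number of summands,
  wherever these are placed. This one estimate serves the clipped-off parts, the sum over the gaps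
  and the empirical cdf.\<close>

lemma (in prob_space) l2norm_sum_le_covar_bound:
  fixes b :: "nat \<Rightarrow> real" and G :: "int set"
  assumes "summable b" "\<And>s t. \<bar>covar M (Y s) (Y t)\<bar> \<le> b (nat \<bar>s - t\<bar>)" "\<And>t. L2 M (Y t)" "finite G"
  shows "(l2norm M (\<lambda>\<omega>. \<Sum>t\<in>G. (Y t \<omega> - expectation (Y t))))\<^sup>2 \<le> real (card G) * (2 * suminf b)"
proof -
  have b0: "0 \<le> b k" for k
    using order_trans[OF abs_ge_zero assms(2)[of "int k" 0]] by simp
  have "(\<Sum>s\<in>G. \<Sum>t\<in>G. covar M (Y s) (Y t)) \<le> (\<Sum>s\<in>G. \<Sum>t\<in>G. b (nat \<bar>s - t\<bar>))"
    by (intro sum_mono order_trans[OF abs_ge_self assms(2)])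
  also have "\<dots> \<le> (\<Sum>s\<in>G. 2 * suminf b)"
    by (intro sum_mono sum_nat_abs_diff_le assms b0)
  finally show ?thesis using assms(3) by (simp add: covar_sum)
qed

section \<open>Covariances of approximable sequences\<close>

text \<open>Both variables are approximated at a level of about half their distance, where the
  approximants are independent. Asking for independence beyond \<open>2 * m\<close> lets both mixing
  notions use the lemma, their gaps being \<open>m\<close> and \<open>2 * m\<close>. The shift
  \<open>1 +\<close> matters at distance \<open>0\<close>, because
  \<open>0 powr x = 0\<close>.\<close>

lemma (in prob_space) covar_decay:
  fixes Y :: "int \<Rightarrow> 'a \<Rightarrow> real" and Z :: "int \<Rightarrow> nat \<Rightarrow> 'a \<Rightarrow> real"
  assumes Y: "\<And>t. L2 M (Y t)" "\<And>t. l2norm M (Y t) \<le> B"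
    and Z: "\<And>t m. 0 < m \<Longrightarrow> L2 M (Z t m)"
    and approx: "\<And>t m. 0 < m \<Longrightarrow> l2norm M (\<lambda>\<omega>. Y t \<omega> - Z t m \<omega>) \<le> C * real m powr (- A)"
    and indep: "\<And>s t m. 0 < m \<Longrightarrow> 2 * int m < \<bar>s - t\<bar> \<Longrightarrow> indep_var borel (Z s m) borel (Z t m)"
    and A: "0 \<le> A"
  shows "\<bar>covar M (Y s) (Y t)\<bar> \<le> 8 powr A * (B\<^sup>2 + C * (2 * B + C)) * (1 + real (nat \<bar>s - t\<bar>)) powr (- A)"
proof -
  define k where "k = nat \<bar>s - t\<bar>"
  have B: "0 \<le> B" using order_trans[OF l2norm_nonneg Y(2)[of 0]] .
  have C: "0 \<le> C" using order_trans[OF l2norm_nonneg approx[of 1 0]] by simp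
  have scale: "8 powr A * (1 + real k) powr (- A) = ((1 + real k) / 8) powr (- A)"
    by (simp add: powr_divide powr_minus field_simps)
  have "\<bar>covar M (Y s) (Y t)\<bar> \<le> (B\<^sup>2 + C * (2 * B + C)) * ((1 + real k) / 8) powr (- A)"
  proof (cases "k \<ge> 3")
    case True
    \<comment> \<open>The largest \<open>m\<close> with \<open>2 * m < k\<close>. For
      \<open>k \<ge> 3\<close> it is positive and satisfies \<open>1 + k \<le> 8 * m\<close>, the
      origin of the factor \<open>8 powr A\<close>.\<close>
    define m where "m = (k - 1) div 2"
    define e where "e = C * real m powr (- A)"
    have m: "0 < m" "2 * m < k" "1 + k \<le> 8 * m" using True by (auto simp: m_def)
    have m': "(1 + real k) / 8 \<le> real m" using of_nat_mono[OF m(3), where 'a = real] by simp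
    have "real m powr (- A) \<le> 1 powr (- A)" by (rule powr_mono2') (use m A in auto)
    then have e1: "e \<le> C" using C by (simp add: e_def mult_left_le)
    have e0: "0 \<le> e" using C by (simp add: e_def)
    have "\<bar>covar M (Y s) (Y t)\<bar> \<le> e * (2 * B + e)"
      using m unfolding e_def k_def
      by (intro covar_le_approx[where Z = "Z s m" and Z' = "Z t m"] Y Z approx indep) linarith+
    also have "\<dots> \<le> e * (2 * B + C)" using e0 e1 by (intro mult_left_mono) auto
    also have "e \<le> C * ((1 + real k) / 8) powr (- A)"
      unfolding e_def by (intro mult_left_mono powr_mono2') (use m' A C in auto)
    then have "e * (2 * B + C) \<le> C * ((1 + real k) / 8) powr (- A) * (2 * B + C)"
      using B C by (intro mult_right_mono) auto
    also have "\<dots> \<le> (B\<^sup>2 + C * (2 * B + C)) * ((1 + real k) / 8) powr (- A)"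
      by (simp add: algebra_simps)
    finally show ?thesis .
  next
    case False
    \<comment> \<open>At distance at most \<open>2\<close> no admissible \<open>m\<close> exists,
      but \<open>(1 + k) / 8 < 1\<close> makes the right-hand side at least
      \<open>B\<^sup>2\<close>, and Cauchy-Schwarz is enough.\<close>
    have "1 powr (- A) \<le> ((1 + real k) / 8) powr (- A)"
      by (rule powr_mono2') (use False A in auto)
    then have "B\<^sup>2 * 1 \<le> (B\<^sup>2 + C * (2 * B + C)) * ((1 + real k) / 8) powr (- A)"
      using B C by (intro mult_mono) auto
    moreover have "\<bar>covar M (Y s) (Y t)\<bar> \<le> B * B"
      using abs_covar_le[OF Y(1) Y(1), of s t] mult_mono[OF Y(2) Y(2) B l2norm_nonneg, of s t] by linarith
    ultimately show ?thesis by (simp add: power2_eq_square)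
  qed
  also have "\<dots> = 8 powr A * (B\<^sup>2 + C * (2 * B + C)) * (1 + real k) powr (- A)"
    unfolding scale[symmetric] by (simp only: ac_simps)
  finally show ?thesis unfolding k_def .
qed

lemma summable_one_plus_powr:
  assumes "1 < A"
  shows "summable (\<lambda>k. (1 + real k) powr (- A))"
proof -
  have "summable (\<lambda>k. real (Suc k) powr (- A))"
    using assms by (subst summable_Suc_iff) (simp add: summable_real_powr_iff)
  then show ?thesis by (simp add: add.commute)
qed

lemma tendsto_Cesaro_mean:
  fixes d :: "nat \<Rightarrow> real"
  assumes "d \<longlonglongrightarrow> L"
  shows "(\<lambda>n. (\<Sum>i<n. d i) / real n) \<longlonglongrightarrow> L"
proof (rule LIMSEQ_I)
  fix \<epsilon> :: real assume \<epsilon>: "0 < \<epsilon>"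
  obtain N where N: "\<And>i. i \<ge> N \<Longrightarrow> \<bar>d i - L\<bar> < \<epsilon> / 2"
    using LIMSEQ_D[OF assms, of "\<epsilon> / 2"] \<epsilon> by auto
  define K where "K = (\<Sum>i<N. \<bar>d i - L\<bar>)"
  obtain N' where N': "2 * K / \<epsilon> < real N'" using reals_Archimedean2 by blast
  show "\<exists>N. \<forall>n\<ge>N. norm ((\<Sum>i<n. d i) / real n - L) < \<epsilon>"
  proof (intro exI allI impI)
    fix n assume n: "n \<ge> max (Suc N) (Suc N')"
    have "(\<Sum>i<n. d i) / real n - L = (\<Sum>i<n. d i - L) / real n"
      using n by (simp add: sum_subtractf field_simps)
    also have "norm \<dots> \<le> (\<Sum>i<n. \<bar>d i - L\<bar>) / real n"
      by (auto simp: divide_right_mono sum_abs)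
    also have "(\<Sum>i<n. \<bar>d i - L\<bar>) = K + (\<Sum>i=N..<n. \<bar>d i - L\<bar>)"
      unfolding K_def lessThan_atLeast0 using n by (simp add: sum.atLeastLessThan_concat)
    also have "(\<Sum>i=N..<n. \<bar>d i - L\<bar>) \<le> real (card {N..<n}) * (\<epsilon> / 2)"
      using N by (intro sum_bounded_above) (auto simp: less_imp_le)
    also have "\<dots> \<le> real n * (\<epsilon> / 2)" using \<epsilon> by (intro mult_right_mono) auto
    also have "(K + real n * (\<epsilon> / 2)) / real n < \<epsilon>"
    proof -
      have "2 * K / \<epsilon> < real n" using N' n by linarith
      then show ?thesis using \<epsilon> n by (simp add: field_simps)
    qed
    finally show "norm ((\<Sum>i<n. d i) / real n - L) < \<epsilon>"
      by (simp add: divide_right_mono)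
  qed
qed

text \<open>Passing from \<open>n\<close> to \<open>n + 1\<close> adds a row, a column and a corner,
  together \<open>d n\<close>. The quotient is therefore a Cesaro mean of \<open>d\<close>, which
  converges to the two-sided series.\<close>

lemma tendsto_double_sum_stationary:
  fixes r :: "nat \<Rightarrow> real"
  assumes "summable r"
  shows "(\<lambda>n. (\<Sum>s\<in>{1..int n}. \<Sum>t\<in>{1..int n}. r (nat \<bar>s - t\<bar>)) / real n) \<longlonglongrightarrow> r 0 + 2 * (\<Sum>k. r (Suc k))"
proof -
  define V where "V n = (\<Sum>s\<in>{1..int n}. \<Sum>t\<in>{1..int n}. r (nat \<bar>s - t\<bar>))" for n
  define d where "d n = r 0 + 2 * (\<Sum>k<n. r (Suc k))" for n
  have Vd: "V n = (\<Sum>i<n. d i)" for n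
  proof (induction n)
    case (Suc n)
    have iv: "{1..int (Suc n)} = insert (int (Suc n)) {1..int n}" by auto
    have col: "(\<Sum>t\<in>{1..int n}. r (nat \<bar>int (Suc n) - t\<bar>)) = (\<Sum>k<n. r (Suc k))"
      by (rule sum.reindex_bij_witness[of _ "\<lambda>k. int n - int k" "\<lambda>t. nat (int n - t)"])
        (auto intro!: arg_cong[of _ _ r])
    have row: "(\<Sum>t\<in>{1..int n}. r (nat \<bar>t - int (Suc n)\<bar>)) = (\<Sum>k<n. r (Suc k))"
      using col by (simp add: abs_minus_commute)
    have "V (Suc n) = V n + (\<Sum>t\<in>{1..int n}. r (nat \<bar>t - int (Suc n)\<bar>))
        + (\<Sum>t\<in>{1..int n}. r (nat \<bar>int (Suc n) - t\<bar>)) + r 0"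
      unfolding V_def iv by (simp add: sum.distrib)
    then show ?case using Suc col row by (simp add: d_def)
  qed (simp add: V_def)
  have "summable (\<lambda>k. r (Suc k))" using assms by (subst summable_Suc_iff)
  then have "d \<longlonglongrightarrow> r 0 + 2 * (\<Sum>k. r (Suc k))"
    unfolding d_def by (intro tendsto_intros summable_LIMSEQ)
  from tendsto_Cesaro_mean[OF this] show ?thesis unfolding Vd[symmetric] V_def .
qed

lemma has_sum_int_nat_abs:
  fixes r :: "nat \<Rightarrow> real"
  assumes "summable (\<lambda>k. \<bar>r k\<bar>)"
  shows "((\<lambda>k::int. r (nat \<bar>k\<bar>)) has_sum (r 0 + 2 * (\<Sum>k. r (Suc k)))) UNIV"
proof -
  have "summable (\<lambda>k. norm (r (Suc k)))" using assms by (subst summable_Suc_iff) simp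
  then have s: "((\<lambda>k. r (Suc k)) has_sum (\<Sum>k. r (Suc k))) UNIV"
    by (intro norm_summable_imp_has_sum summable_sums summable_norm_cancel[of "\<lambda>k. r (Suc k)"])
  have pos: "((\<lambda>k::int. r (nat \<bar>k\<bar>)) has_sum (\<Sum>k. r (Suc k))) {0<..}"
    using s by (rule has_sum_reindex_bij_witness[of _ "\<lambda>k. nat (k - 1)" "\<lambda>k. int (Suc k)", THEN iffD1, rotated -1])
      (auto intro!: arg_cong[of _ _ r])
  have neg: "((\<lambda>k::int. r (nat \<bar>k\<bar>)) has_sum (\<Sum>k. r (Suc k))) {..<0}"
    using s by (rule has_sum_reindex_bij_witness[of _ "\<lambda>k. nat (- k - 1)" "\<lambda>k. - int (Suc k)", THEN iffD1, rotated -1])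
      (auto intro!: arg_cong[of _ _ r])
  have "((\<lambda>k::int. r (nat \<bar>k\<bar>)) has_sum (r 0 + ((\<Sum>k. r (Suc k)) + (\<Sum>k. r (Suc k))))) ({0} \<union> ({0<..} \<union> {..<0}))"
    using has_sum_finite[of "{0::int}" "\<lambda>k. r (nat \<bar>k\<bar>)"]
    by (intro has_sum_Un_disjoint pos neg) auto
  also have "{0} \<union> ({0<..} \<union> {..<0}) = (UNIV :: int set)" by auto
  finally show ?thesis by simp
qed

section \<open>Characteristic functions\<close>

text \<open>From \<open>exp y \<ge> 1 + y\<close>, used at \<open>y\<close> and at
  \<open>- y\<close>, and \<open>1 / (1 + y) \<le> 1 - y + y\<^sup>2\<close>, which holds because
  \<open>(1 + y) * (1 - y + y\<^sup>2) = 1 + y ^ 3\<close>.\<close>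

lemma exp_minus_linear_bound:
  fixes y :: real
  assumes "0 \<le> y"
  shows "\<bar>(1 - y) - exp (- y)\<bar> \<le> y\<^sup>2"
proof -
  have "1 + y \<le> exp y" by (rule exp_ge_add_one_self)
  then have "exp (- y) \<le> 1 / (1 + y)"
    using assms by (simp add: exp_minus field_simps)
  also have "\<dots> \<le> 1 - y + y\<^sup>2"
    using assms by (simp add: field_simps power2_eq_square)
  finally show ?thesis using exp_ge_add_one_self[of "- y"] by simp
qed

text \<open>Lindeberg's theorem in the easy case of a uniform bound tending to \<open>0\<close>.
  Each factor is compared with the exponential belonging to its own variance, so the comparison
  product is exactly \<open>exp (- (s\<^sup>2 * V n / 2))\<close>, and errors proportional to
  \<open>\<sigma> n i\<close> add up to \<open>V n * K n\<close>.\<close>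

lemma (in prob_space) char_bounded_indep_array:
  fixes \<xi> :: "nat \<Rightarrow> 'i \<Rightarrow> 'a \<Rightarrow> real"
  assumes indep: "\<And>n. indep_vars (\<lambda>_. borel) (\<xi> n) (I n)" and fin: "\<And>n. finite (I n)"
    and bound: "\<And>n i \<omega>. i \<in> I n \<Longrightarrow> \<bar>\<xi> n i \<omega>\<bar> \<le> e n" and e: "e \<longlonglongrightarrow> 0"
    and mean: "\<And>n i. i \<in> I n \<Longrightarrow> expectation (\<xi> n i) = 0"
    and var: "(\<lambda>n. \<Sum>i\<in>I n. expectation (\<lambda>\<omega>. (\<xi> n i \<omega>)\<^sup>2)) \<longlonglongrightarrow> v"
  shows "(\<lambda>n. char (distr M borel (\<lambda>\<omega>. \<Sum>i\<in>I n. \<xi> n i \<omega>)) s) \<longlonglongrightarrow> exp (- (s\<^sup>2 * v / 2))"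
proof -
  define \<sigma> where "\<sigma> n i = expectation (\<lambda>\<omega>. (\<xi> n i \<omega>)\<^sup>2)" for n i
  define V where "V n = (\<Sum>i\<in>I n. \<sigma> n i)" for n
  \<comment> \<open>The first summand is the Taylor remainder, with \<open>\<bar>\<xi> n i
    \<omega>\<bar> ^ 3 \<le> e n * (\<xi> n i \<omega>)\<^sup>2\<close>. The second comes from
    replacing \<open>1 - y\<close> by \<open>exp (- y)\<close> at
    \<open>y = s\<^sup>2 * \<sigma> n i / 2\<close>, with
    \<open>\<sigma> n i \<le> (e n)\<^sup>2\<close>.\<close>
  define K where "K n = \<bar>s\<bar> ^ 3 * e n / 6 + s ^ 4 * (e n)\<^sup>2 / 4" for n
  have V: "V \<longlonglongrightarrow> v" using var unfolding V_def[abs_def] \<sigma>_def .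
  have \<sigma>0: "0 \<le> \<sigma> n i" for n i by (simp add: \<sigma>_def)
  have single: "cmod (char (distr M borel (\<xi> n i)) s - of_real (exp (- (s\<^sup>2 * \<sigma> n i / 2)))) \<le> \<sigma> n i * K n"
    if i: "i \<in> I n" for n i
  proof -
    have [measurable]: "\<xi> n i \<in> borel_measurable M"
      using indep[of n] i by (auto simp: indep_vars_def)
    have e0: "0 \<le> e n" using bound[OF i, of undefined] by linarith
    have L: "L2 M (\<xi> n i)" "l2norm M (\<xi> n i) \<le> e n"
      using L2_bounded[of "\<xi> n i" "e n"] bound[OF i] by auto
    have \<sigma>e: "\<sigma> n i \<le> (e n)\<^sup>2"
      unfolding \<sigma>_def l2norm_power2[symmetric] using L(2) by (intro power_mono) auto
    note sq = L2_square_integrable[OF L(1)]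
    have abs3: "\<bar>s\<bar> ^ 3 = s\<^sup>2 * \<bar>s\<bar>"
      by (simp add: power3_eq_cube power2_eq_square)
    have taylor: "cmod (char (distr M borel (\<xi> n i)) s - (1 - s\<^sup>2 * \<sigma> n i / 2))
        \<le> (s\<^sup>2 / 6) * expectation (\<lambda>\<omega>. min (6 * (\<xi> n i \<omega>)\<^sup>2) (\<bar>s\<bar> * \<bar>\<xi> n i \<omega>\<bar> ^ 3))"
      using L2_integrable[OF L(1)] sq mean[OF i]
      by (intro char_approx3') (auto simp: \<sigma>_def)
    have "expectation (\<lambda>\<omega>. min (6 * (\<xi> n i \<omega>)\<^sup>2) (\<bar>s\<bar> * \<bar>\<xi> n i \<omega>\<bar> ^ 3))
        \<le> expectation (\<lambda>\<omega>. \<bar>s\<bar> * e n * (\<xi> n i \<omega>)\<^sup>2)"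
    proof (rule integral_mono)
      show "integrable M (\<lambda>\<omega>. min (6 * (\<xi> n i \<omega>)\<^sup>2) (\<bar>s\<bar> * \<bar>\<xi> n i \<omega>\<bar> ^ 3))"
        by (rule Bochner_Integration.integrable_bound[of M "\<lambda>\<omega>. 6 * (\<xi> n i \<omega>)\<^sup>2"]) (use sq in auto)
      show "integrable M (\<lambda>\<omega>. \<bar>s\<bar> * e n * (\<xi> n i \<omega>)\<^sup>2)" using sq by simp
      fix \<omega>
      have "\<bar>s\<bar> * \<bar>\<xi> n i \<omega>\<bar> ^ 3 = \<bar>s\<bar> * \<bar>\<xi> n i \<omega>\<bar> * (\<xi> n i \<omega>)\<^sup>2"
        by (simp add: power3_eq_cube power2_eq_square)
      also have "\<dots> \<le> \<bar>s\<bar> * e n * (\<xi> n i \<omega>)\<^sup>2"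
        using bound[OF i] by (intro mult_right_mono mult_left_mono) auto
      finally show "min (6 * (\<xi> n i \<omega>)\<^sup>2) (\<bar>s\<bar> * \<bar>\<xi> n i \<omega>\<bar> ^ 3) \<le> \<bar>s\<bar> * e n * (\<xi> n i \<omega>)\<^sup>2"
        by linarith
    qed
    also have "\<dots> = \<bar>s\<bar> * e n * \<sigma> n i" by (simp add: \<sigma>_def)
    finally have "s\<^sup>2 / 6 * expectation (\<lambda>\<omega>. min (6 * (\<xi> n i \<omega>)\<^sup>2) (\<bar>s\<bar> * \<bar>\<xi> n i \<omega>\<bar> ^ 3))
        \<le> s\<^sup>2 / 6 * (\<bar>s\<bar> * e n * \<sigma> n i)"
      by (rule mult_left_mono) simp
    also have "\<dots> = \<bar>s\<bar> ^ 3 * e n / 6 * \<sigma> n i"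
      unfolding abs3 by (simp add: algebra_simps)
    finally have 1: "cmod (char (distr M borel (\<xi> n i)) s - (1 - s\<^sup>2 * \<sigma> n i / 2))
        \<le> \<bar>s\<bar> ^ 3 * e n / 6 * \<sigma> n i"
      using taylor by linarith
    have "\<bar>(1 - s\<^sup>2 * \<sigma> n i / 2) - exp (- (s\<^sup>2 * \<sigma> n i / 2))\<bar> \<le> (s\<^sup>2 * \<sigma> n i / 2)\<^sup>2"
      by (intro exp_minus_linear_bound) (simp add: \<sigma>0)
    also have "\<dots> = s ^ 4 / 4 * \<sigma> n i * \<sigma> n i" by (simp add: power2_eq_square power4_eq_xxxx)
    also have "\<dots> \<le> s ^ 4 / 4 * (e n)\<^sup>2 * \<sigma> n i"
      using \<sigma>e \<sigma>0 by (intro mult_right_mono mult_left_mono) auto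
    finally have 2: "cmod (of_real (1 - s\<^sup>2 * \<sigma> n i / 2) - of_real (exp (- (s\<^sup>2 * \<sigma> n i / 2))))
        \<le> s ^ 4 / 4 * (e n)\<^sup>2 * \<sigma> n i"
      unfolding of_real_diff[symmetric] norm_of_real .
    have "cmod (char (distr M borel (\<xi> n i)) s - of_real (exp (- (s\<^sup>2 * \<sigma> n i / 2))))
      \<le> \<bar>s\<bar> ^ 3 * e n / 6 * \<sigma> n i + s ^ 4 / 4 * (e n)\<^sup>2 * \<sigma> n i"
      using norm_triangle_le[OF add_mono[OF 1 2]] by simp
    then show ?thesis by (simp add: K_def algebra_simps)
  qed
  have limexp: "(\<lambda>n. exp (- (s\<^sup>2 * V n / 2))) \<longlonglongrightarrow> exp (- (s\<^sup>2 * v / 2))"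
    by (intro tendsto_intros V) auto
  have "cmod (char (distr M borel (\<lambda>\<omega>. \<Sum>i\<in>I n. \<xi> n i \<omega>)) s - of_real (exp (- (s\<^sup>2 * V n / 2))))
      \<le> V n * K n" for n
  proof -
    have "exp (- (s\<^sup>2 * V n / 2)) = (\<Prod>i\<in>I n. exp (- (s\<^sup>2 * \<sigma> n i / 2)))"
      using fin[of n] by (simp add: V_def exp_sum[symmetric] sum_negf sum_distrib_left sum_divide_distrib)
    then have "cmod (char (distr M borel (\<lambda>\<omega>. \<Sum>i\<in>I n. \<xi> n i \<omega>)) s - of_real (exp (- (s\<^sup>2 * V n / 2))))
      = cmod ((\<Prod>i\<in>I n. char (distr M borel (\<xi> n i)) s) - (\<Prod>i\<in>I n. of_real (exp (- (s\<^sup>2 * \<sigma> n i / 2)))))"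
      by (simp add: char_distr_sum[OF indep])
    also have "\<dots> \<le> (\<Sum>i\<in>I n. cmod (char (distr M borel (\<xi> n i)) s - of_real (exp (- (s\<^sup>2 * \<sigma> n i / 2)))))"
    \<comment> \<open>Factors of modulus at most \<open>1\<close> let the difference of the products
      telescope into the sum of the differences.\<close>
    proof (rule norm_prod_diff)
      fix i assume i: "i \<in> I n"
      then have "random_variable borel (\<xi> n i)" using indep[of n] by (auto simp: indep_vars_def)
      then interpret \<mu>: real_distribution "distr M borel (\<xi> n i)" by (rule real_distribution_distr)
      show "cmod (char (distr M borel (\<xi> n i)) s) \<le> 1" by (rule \<mu>.cmod_char_le_1)
      show "cmod (of_real (exp (- (s\<^sup>2 * \<sigma> n i / 2)))) \<le> 1" using \<sigma>0[of n i] by simp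
    qed
    also have "\<dots> \<le> (\<Sum>i\<in>I n. \<sigma> n i * K n)" by (intro sum_mono single)
    finally show ?thesis by (simp add: V_def sum_distrib_right)
  qed
  then have "\<forall>\<^sub>F n in sequentially. cmod (char (distr M borel (\<lambda>\<omega>. \<Sum>i\<in>I n. \<xi> n i \<omega>)) s - of_real (exp (- (s\<^sup>2 * V n / 2))))
      \<le> V n * K n"
    by (rule always_eventually[OF allI])
  moreover have "(\<lambda>n. V n * K n) \<longlonglongrightarrow> v * (\<bar>s\<bar> ^ 3 * 0 / 6 + s ^ 4 * 0\<^sup>2 / 4)"
    unfolding K_def by (intro tendsto_intros V e) auto
  then have "(\<lambda>n. V n * K n) \<longlonglongrightarrow> 0" by simp
  ultimately have "(\<lambda>n. char (distr M borel (\<lambda>\<omega>. \<Sum>i\<in>I n. \<xi> n i \<omega>)) s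
      - of_real (exp (- (s\<^sup>2 * V n / 2)))) \<longlonglongrightarrow> 0"
    by (rule Lim_null_comparison)
  from tendsto_add[OF this tendsto_of_real[OF limexp]] show ?thesis by simp
qed

lemma cmod_iexp_diff_le: "cmod (iexp x - iexp y) \<le> \<bar>x - y\<bar>"
proof -
  have "iexp y * iexp (x - y) = iexp x"
    unfolding exp_add[symmetric] by (simp add: algebra_simps)
  then have "iexp x - iexp y = iexp y * (iexp (x - y) - 1)"
    by (simp only: right_diff_distrib mult_1_right)
  then have "cmod (iexp x - iexp y) = cmod (iexp (x - y) - 1)"
    by (simp add: norm_mult)
  also have "\<dots> \<le> \<bar>x - y\<bar>" using iexp_approx1[of "x - y" 0] by simp
  finally show ?thesis .
qed

text \<open>Slutsky's theorem for characteristic functions: the integrand changes by at most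
  \<open>\<bar>s\<bar> * \<epsilon>\<close> where the variables are \<open>\<epsilon>\<close>-close,
  and by at most \<open>2\<close> elsewhere.\<close>

lemma (in prob_space) char_tendsto_approx:
  fixes A B :: "nat \<Rightarrow> 'a \<Rightarrow> real"
  assumes [measurable]: "\<And>n. A n \<in> borel_measurable M" "\<And>n. B n \<in> borel_measurable M"
    and A: "(\<lambda>n. char (distr M borel (A n)) s) \<longlonglongrightarrow> c"
    and AB: "\<And>\<epsilon>. 0 < \<epsilon> \<Longrightarrow> (\<lambda>n. prob {\<omega>\<in>space M. \<epsilon> < \<bar>A n \<omega> - B n \<omega>\<bar>}) \<longlonglongrightarrow> 0"
  shows "(\<lambda>n. char (distr M borel (B n)) s) \<longlonglongrightarrow> c"
proof -
  have diff: "cmod (char (distr M borel (A n)) s - char (distr M borel (B n)) s)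
      \<le> \<bar>s\<bar> * \<epsilon> + 2 * prob {\<omega>\<in>space M. \<epsilon> < \<bar>A n \<omega> - B n \<omega>\<bar>}" if \<epsilon>: "0 < \<epsilon>" for n \<epsilon>
  proof -
    let ?E = "{\<omega>\<in>space M. \<epsilon> < \<bar>A n \<omega> - B n \<omega>\<bar>}"
    have E: "?E \<in> events" by measurable
    have int: "integrable M (\<lambda>\<omega>. iexp (s * A n \<omega>))" "integrable M (\<lambda>\<omega>. iexp (s * B n \<omega>))"
      by (intro integrable_iexp; simp)+
    have "char (distr M borel (A n)) s - char (distr M borel (B n)) s
        = (CLINT \<omega>|M. iexp (s * A n \<omega>) - iexp (s * B n \<omega>))"
      unfolding char_def by (simp add: integral_distr int del: of_real_mult)
    also have "cmod \<dots> \<le> expectation (\<lambda>\<omega>. cmod (iexp (s * A n \<omega>) - iexp (s * B n \<omega>)))"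
      by (rule integral_norm_bound)
    also have "\<dots> \<le> expectation (\<lambda>\<omega>. \<bar>s\<bar> * \<epsilon> + 2 * indicator ?E \<omega>)"
    proof (rule integral_mono)
      show "integrable M (\<lambda>\<omega>. cmod (iexp (s * A n \<omega>) - iexp (s * B n \<omega>)))"
        by (intro integrable_norm Bochner_Integration.integrable_diff int)
      show "integrable M (\<lambda>\<omega>. \<bar>s\<bar> * \<epsilon> + 2 * indicator ?E \<omega> :: real)" using E by (simp add: emeasure_eq_measure)
      fix \<omega> assume \<omega>: "\<omega> \<in> space M"
      show "cmod (iexp (s * A n \<omega>) - iexp (s * B n \<omega>)) \<le> \<bar>s\<bar> * \<epsilon> + 2 * indicator ?E \<omega>"
      proof (cases "\<omega> \<in> ?E")
        case True
        have "cmod (iexp (s * A n \<omega>) - iexp (s * B n \<omega>)) \<le> 1 + 1"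
          by (intro order_trans[OF norm_triangle_ineq4] add_mono) (simp_all add: norm_exp_i_times)
        moreover have "0 \<le> \<bar>s\<bar> * \<epsilon>" using \<epsilon> by simp
        ultimately show ?thesis using True by simp
      next
        case False
        have "cmod (iexp (s * A n \<omega>) - iexp (s * B n \<omega>)) \<le> \<bar>s * A n \<omega> - s * B n \<omega>\<bar>"
          by (rule cmod_iexp_diff_le)
        also have "\<dots> = \<bar>s\<bar> * \<bar>A n \<omega> - B n \<omega>\<bar>" by (simp add: right_diff_distrib[symmetric] abs_mult)
        also have "\<dots> \<le> \<bar>s\<bar> * \<epsilon>" using False \<omega> by (intro mult_left_mono) auto
        finally show ?thesis using False by simp
      qed
    qed
    also have "\<dots> = \<bar>s\<bar> * \<epsilon> + 2 * prob ?E" using E by (simp add: prob_space emeasure_eq_measure)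
    finally show ?thesis .
  qed
  have "(\<lambda>n. char (distr M borel (A n)) s - char (distr M borel (B n)) s) \<longlonglongrightarrow> 0"
  proof (rule LIMSEQ_I)
    fix \<delta> :: real assume \<delta>: "0 < \<delta>"
    \<comment> \<open>The \<open>+ 1\<close> covers \<open>s = 0\<close>. Each of the two errors is
      then at most \<open>\<delta> / 2\<close>.\<close>
    define \<epsilon> where "\<epsilon> = \<delta> / (2 * (\<bar>s\<bar> + 1))"
    have \<epsilon>: "0 < \<epsilon>" using \<delta> by (simp add: \<epsilon>_def)
    have "\<bar>s\<bar> * \<delta> \<le> \<delta> * (\<bar>s\<bar> + 1)" using \<delta> by (simp add: algebra_simps)
    then have s\<epsilon>: "\<bar>s\<bar> * \<epsilon> \<le> \<delta> / 2" unfolding \<epsilon>_def by (simp add: field_simps)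
    obtain N where N: "\<And>n. n \<ge> N \<Longrightarrow> prob {\<omega>\<in>space M. \<epsilon> < \<bar>A n \<omega> - B n \<omega>\<bar>} < \<delta> / 4"
      using LIMSEQ_D[OF AB[OF \<epsilon>], of "\<delta> / 4"] \<delta> by auto
    show "\<exists>N. \<forall>n\<ge>N. norm (char (distr M borel (A n)) s - char (distr M borel (B n)) s - 0) < \<delta>"
    proof (intro exI[of _ N] allI impI)
      fix n assume "n \<ge> N"
      from N[OF this] diff[OF \<epsilon>, of n] s\<epsilon>
      show "norm (char (distr M borel (A n)) s - char (distr M borel (B n)) s - 0) < \<delta>" by simp
    qed
  qed
  from tendsto_diff[OF A this] show ?thesis by simp
qed

text \<open>Chebyshev's inequality without centring: \<open>\<epsilon>\<^sup>2\<close> times the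
  indicator of the event is at most the square of \<open>Y\<close>.\<close>

lemma (in prob_space) prob_gt_le_l2norm:
  assumes "L2 M Y" "0 < \<epsilon>"
  shows "prob {\<omega>\<in>space M. \<epsilon> < \<bar>Y \<omega>\<bar>} \<le> (l2norm M Y / \<epsilon>)\<^sup>2"
proof -
  have [measurable]: "Y \<in> borel_measurable M" using assms by (rule_tac L2_measurable)
  let ?E = "{\<omega>\<in>space M. \<epsilon> < \<bar>Y \<omega>\<bar>}"
  have E: "?E \<in> events" by measurable
  have "\<epsilon>\<^sup>2 * prob ?E = expectation (\<lambda>\<omega>. \<epsilon>\<^sup>2 * indicator ?E \<omega>)" by simp
  also have "\<dots> \<le> expectation (\<lambda>\<omega>. (Y \<omega>)\<^sup>2)"
  proof (rule integral_mono)
    fix \<omega>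
    have "\<epsilon>\<^sup>2 \<le> \<bar>Y \<omega>\<bar>\<^sup>2" if "\<epsilon> < \<bar>Y \<omega>\<bar>" using that assms by (intro power_mono) auto
    then show "\<epsilon>\<^sup>2 * indicator ?E \<omega> \<le> (Y \<omega>)\<^sup>2" by (auto split: split_indicator)
  qed (use assms E in \<open>auto simp: L2_def emeasure_eq_measure\<close>)
  finally show ?thesis using assms by (simp add: l2norm_power2 power_divide field_simps)
qed

lemma (in prob_space) char_tendsto_approx_L2:
  fixes A B :: "nat \<Rightarrow> 'a \<Rightarrow> real"
  assumes [measurable]: "\<And>n. A n \<in> borel_measurable M" "\<And>n. B n \<in> borel_measurable M"
    and A: "(\<lambda>n. char (distr M borel (A n)) s) \<longlonglongrightarrow> c"
    and AB: "\<And>n. L2 M (\<lambda>\<omega>. A n \<omega> - B n \<omega>)" "(\<lambda>n. l2norm M (\<lambda>\<omega>. A n \<omega> - B n \<omega>)) \<longlonglongrightarrow> 0"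
  shows "(\<lambda>n. char (distr M borel (B n)) s) \<longlonglongrightarrow> c"
proof (rule char_tendsto_approx[OF assms(1,2) A])
  fix \<epsilon> :: real assume \<epsilon>: "0 < \<epsilon>"
  have "(\<lambda>n. (l2norm M (\<lambda>\<omega>. A n \<omega> - B n \<omega>) / \<epsilon>)\<^sup>2) \<longlonglongrightarrow> (0 / \<epsilon>)\<^sup>2"
    using \<epsilon> by (intro tendsto_intros AB) auto
  then have "(\<lambda>n. (l2norm M (\<lambda>\<omega>. A n \<omega> - B n \<omega>) / \<epsilon>)\<^sup>2) \<longlonglongrightarrow> 0" by simp
  then show "(\<lambda>n. prob {\<omega>\<in>space M. \<epsilon> < \<bar>A n \<omega> - B n \<omega>\<bar>}) \<longlonglongrightarrow> 0"
    by (rule tendsto_sandwich[OF _ _ tendsto_const, rotated 2])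
      (auto intro!: always_eventually prob_gt_le_l2norm AB \<epsilon>)
qed

lemma real_distribution_centered_normal: "0 \<le> \<nu> \<Longrightarrow> real_distribution (centered_normal \<nu>)"
  using prob_space_normal_density[of \<nu> 0]
  by (auto simp: centered_normal_def real_distribution_def real_distribution_axioms_def
      intro!: prob_space_return)

text \<open>Dividing by \<open>\<nu>\<close> reduces the claim to the standard normal law. For
  \<open>\<nu> = 0\<close> the measure is the point mass at \<open>0\<close> and both sides are
  \<open>1\<close>.\<close>

lemma char_centered_normal:
  assumes "0 \<le> \<nu>"
  shows "char (centered_normal \<nu>) s = exp (- (s\<^sup>2 * \<nu>\<^sup>2 / 2))"
proof (cases "\<nu> = 0")
  case True
  then show ?thesis by (simp add: centered_normal_def char_def integral_return)
next
  case False
  then have \<nu>: "0 < \<nu>" using assms by simp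
  interpret N: prob_space "density lborel (normal_density 0 \<nu>)"
    using \<nu> by (rule prob_space_normal_density)
  have "distributed (density lborel (normal_density 0 \<nu>)) lborel (\<lambda>x. x) (\<lambda>x. ennreal (normal_density 0 \<nu> x))"
    by (auto simp: distributed_def distr_id2)
  then have "distributed (density lborel (normal_density 0 \<nu>)) lborel (\<lambda>x. (x - 0) / \<nu>) (\<lambda>x. ennreal (std_normal_density x))"
    by (rule N.normal_standard_normal_convert[OF \<nu>, THEN iffD1])
  then have d: "distr (density lborel (normal_density 0 \<nu>)) lborel (\<lambda>x. x / \<nu>) = std_normal_distribution"
    by (simp add: distributed_def)
  have "char std_normal_distribution (s * \<nu>) = char (density lborel (normal_density 0 \<nu>)) s"
    unfolding d[symmetric] char_def using \<nu> by (subst integral_distr) auto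
  then show ?thesis
    using False by (simp add: centered_normal_def char_std_normal_distribution power_mult_distrib)
qed

section \<open>Stationary series and block independence\<close>

locale stationary_series = prob_space M for M :: "'a measure" +
  fixes X :: "int \<Rightarrow> 'a \<Rightarrow> real"
  assumes X_measurable[measurable]: "\<And>t. X t \<in> borel_measurable M"
    and stationary: "strictly_stationary M X"
begin

text \<open>Covariances and marginal expectations involve at most two times, so stationarity is
  extracted once in this form.\<close>

lemma distr_pair:
  "distr M (borel \<Otimes>\<^sub>M borel) (\<lambda>\<omega>. (X s \<omega>, X t \<omega>)) =
   distr M (borel \<Otimes>\<^sub>M borel) (\<lambda>\<omega>. (X 0 \<omega>, X (t - s) \<omega>))"
proof -
  \<comment> \<open>The shift by \<open>s\<close> moves this set to the times \<open>s\<close> and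
    \<open>t\<close>. For \<open>s = t\<close> it has one element, and \<open>?p\<close> then reads
    the same coordinate twice.\<close>
  let ?J = "{0, t - s}"
  let ?p = "\<lambda>f::int \<Rightarrow> real. (f 0, f (t - s))"
  have p: "?p \<in> measurable (\<Pi>\<^sub>M u\<in>?J. borel) (borel \<Otimes>\<^sub>M borel)" by measurable
  have r: "(\<lambda>\<omega>. \<lambda>u\<in>?J. X (u + k) \<omega>) \<in> measurable M (\<Pi>\<^sub>M u\<in>?J. borel)" for k
    by (intro measurable_restrict) simp
  have eq: "distr M (\<Pi>\<^sub>M u\<in>?J. borel) (\<lambda>\<omega>. \<lambda>u\<in>?J. X (u + s) \<omega>) =
      distr M (\<Pi>\<^sub>M u\<in>?J. borel) (\<lambda>\<omega>. \<lambda>u\<in>?J. X u \<omega>)"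
    by (rule stationary[unfolded strictly_stationary_def, rule_format]) simp
  have "distr M (borel \<Otimes>\<^sub>M borel) (?p \<circ> (\<lambda>\<omega>. \<lambda>u\<in>?J. X (u + s) \<omega>)) =
      distr M (borel \<Otimes>\<^sub>M borel) (?p \<circ> (\<lambda>\<omega>. \<lambda>u\<in>?J. X (u + 0) \<omega>))"
    using eq unfolding distr_distr[OF p r, symmetric] by simp
  then show ?thesis by (simp add: comp_def)
qed

lemma distr_X: "distr M borel (X t) = distr M borel (X 0)"
proof -
  from arg_cong[OF distr_pair[of t t], of "\<lambda>N. distr N borel fst"]
  show ?thesis by (simp add: distr_distr comp_def)
qed

lemma expectation_pair:
  fixes \<phi> :: "real \<times> real \<Rightarrow> real"
  assumes [measurable]: "\<phi> \<in> borel_measurable (borel \<Otimes>\<^sub>M borel)"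
  shows "expectation (\<lambda>\<omega>. \<phi> (X s \<omega>, X t \<omega>)) = expectation (\<lambda>\<omega>. \<phi> (X 0 \<omega>, X (t - s) \<omega>))"
proof -
  have "expectation (\<lambda>\<omega>. \<phi> (X s \<omega>, X t \<omega>)) = integral\<^sup>L (distr M (borel \<Otimes>\<^sub>M borel) (\<lambda>\<omega>. (X s \<omega>, X t \<omega>))) \<phi>" for s t
    by (rule integral_distr[symmetric]) measurable
  then show ?thesis using distr_pair[of s t] by metis
qed

lemma expectation_X:
  fixes \<phi> :: "real \<Rightarrow> real"
  assumes [measurable]: "\<phi> \<in> borel_measurable borel"
  shows "expectation (\<lambda>\<omega>. \<phi> (X t \<omega>)) = expectation (\<lambda>\<omega>. \<phi> (X 0 \<omega>))"
  using integral_distr[OF X_measurable[of t] assms] integral_distr[OF X_measurable[of 0] assms] distr_X[of t]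
  by simp

lemma integrable_X:
  fixes \<phi> :: "real \<Rightarrow> real"
  assumes [measurable]: "\<phi> \<in> borel_measurable borel"
  shows "integrable M (\<lambda>\<omega>. \<phi> (X t \<omega>)) \<longleftrightarrow> integrable M (\<lambda>\<omega>. \<phi> (X 0 \<omega>))"
  using integrable_distr_eq[OF X_measurable[of t] assms] integrable_distr_eq[OF X_measurable[of 0] assms] distr_X[of t]
  by simp

lemma L2_X:
  fixes \<phi> :: "real \<Rightarrow> real"
  assumes [measurable]: "\<phi> \<in> borel_measurable borel" and "L2 M (\<lambda>\<omega>. \<phi> (X 0 \<omega>))"
  shows "L2 M (\<lambda>\<omega>. \<phi> (X t \<omega>))"
  using assms integrable_X[of "\<lambda>x. (\<phi> x)\<^sup>2" t] by (simp add: L2_def)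

lemma l2norm_X:
  fixes \<phi> :: "real \<Rightarrow> real"
  assumes [measurable]: "\<phi> \<in> borel_measurable borel"
  shows "l2norm M (\<lambda>\<omega>. \<phi> (X t \<omega>)) = l2norm M (\<lambda>\<omega>. \<phi> (X 0 \<omega>))"
  using expectation_X[of "\<lambda>x. (\<phi> x)\<^sup>2" t] by (simp add: l2norm_def)

text \<open>The shift moves the first time to \<open>0\<close>; if that is the later one, symmetry
  of the covariance exchanges the two beforehand.\<close>

lemma covar_X:
  fixes g :: "real \<Rightarrow> real"
  assumes [measurable]: "g \<in> borel_measurable borel"
  shows "covar M (\<lambda>\<omega>. g (X s \<omega>)) (\<lambda>\<omega>. g (X t \<omega>)) =
    covar M (\<lambda>\<omega>. g (X 0 \<omega>)) (\<lambda>\<omega>. g (X (int (nat \<bar>s - t\<bar>)) \<omega>))"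
proof -
  let ?e = "expectation (\<lambda>\<omega>. g (X 0 \<omega>))"
  have shift: "covar M (\<lambda>\<omega>. g (X s \<omega>)) (\<lambda>\<omega>. g (X t \<omega>)) =
      covar M (\<lambda>\<omega>. g (X 0 \<omega>)) (\<lambda>\<omega>. g (X (t - s) \<omega>))" for s t
    using expectation_pair[of "\<lambda>(x, y). (g x - ?e) * (g y - ?e)" s t]
    by (simp add: covar_def expectation_X[of g s] expectation_X[of g t] expectation_X[of g "t - s"])
  show ?thesis
  proof (cases "s \<le> t")
    case True
    then show ?thesis using shift[of s t] by simp
  next
    case False
    then show ?thesis using shift[of t s] covar_sym by simp
  qed
qed

end

lemma (in prob_space) indep_vars_imp_indep_var:
  assumes "indep_vars (\<lambda>_. borel) Y I" "i \<in> I" "j \<in> I" "i \<noteq> j"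
  shows "indep_var borel (Y i) borel (Y j)"
proof -
  have "indep_var (PiM {i} (\<lambda>_. borel)) (\<lambda>\<omega>. restrict (\<lambda>i. Y i \<omega>) {i})
      (PiM {j} (\<lambda>_. borel)) (\<lambda>\<omega>. restrict (\<lambda>i. Y i \<omega>) {j})"
    using assms by (intro indep_var_restrict) auto
  then have "indep_var borel ((\<lambda>f. f i) \<circ> (\<lambda>\<omega>. restrict (\<lambda>i. Y i \<omega>) {i}))
      borel ((\<lambda>f. f j) \<circ> (\<lambda>\<omega>. restrict (\<lambda>i. Y i \<omega>) {j}))"
    by (rule indep_var_compose) auto
  then show ?thesis by (simp add: comp_def)
qed

text \<open>An infimum turns strict bounds into weak ones. Since distances are integers,
  \<open>Suc g\<close> is a lower bound, and strictness survives.\<close>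

lemma int_set_dist_gt:
  assumes "\<And>a b. a \<in> I \<Longrightarrow> b \<in> J \<Longrightarrow> int g < \<bar>a - b\<bar>"
  shows "enat g < int_set_dist I J"
proof -
  have "enat (Suc g) \<le> int_set_dist I J"
    unfolding int_set_dist_def by (intro INF_greatest) (use assms in force)
  then show ?thesis by (rule less_le_trans[rotated]) simp
qed

lemma separated_blocks_indepD:
  fixes I :: "nat \<Rightarrow> int set"
  assumes "separated_blocks_indep M Y gap" "disjoint_family_on I {1..r}"
    and "\<And>i. i \<in> {1..r} \<Longrightarrow> int_interval (I i)" "\<And>i. i \<in> {1..r} \<Longrightarrow> 0 < m i"
    and "\<And>i j. i \<in> {1..r} \<Longrightarrow> j \<in> {1..r} \<Longrightarrow> i < j \<Longrightarrow> enat (gap (m i) (m j)) < int_set_dist (I i) (I j)"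
  shows "prob_space.indep_vars M (\<lambda>i. \<Pi>\<^sub>M t\<in>I i. borel) (\<lambda>i \<omega>. \<lambda>t\<in>I i. Y t (m i) \<omega>) {1..r}"
  using assms(1)[unfolded separated_blocks_indep_def, THEN spec[of _ r], THEN spec[of _ I], THEN spec[of _ m]]
    assms(2-) by simp

text \<open>The block condition for two one-point intervals; the required distance is
  \<open>m\<close> if \<open>gap\<close> is \<open>max\<close> and \<open>2 * m\<close> if it is the
  sum.\<close>

lemma (in prob_space) separated_blocks_indep_pair:
  assumes sep: "separated_blocks_indep M Y gap"
    and m: "0 < m" "int (gap m m) < \<bar>s - t\<bar>"
  shows "indep_var borel (Y s m) borel (Y t m)"
proof -
  let ?u = "\<lambda>i::nat. if i = 1 then s else t"
  have "s \<noteq> t" using m by auto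
  have "indep_vars (\<lambda>i. \<Pi>\<^sub>M u\<in>{?u i}. borel) (\<lambda>i \<omega>. \<lambda>u\<in>{?u i}. Y u m \<omega>) {1..2}"
    using m \<open>s \<noteq> t\<close>
    by (intro separated_blocks_indepD[OF sep])
      (auto simp: disjoint_family_on_def int_interval_def intro!: int_set_dist_gt)
  then have "indep_vars (\<lambda>_. borel) (\<lambda>i \<omega>. (\<lambda>u\<in>{?u i}. Y u m \<omega>) (?u i)) {1..2::nat}"
    by (rule indep_vars_compose2) (auto intro!: measurable_component_singleton)
  from indep_vars_imp_indep_var[OF this, of 1 2] show ?thesis by simp
qed

text \<open>The integers are cut into blocks of length \<open>l\<close>, and the positions with
  residue at most \<open>m\<close> are discarded. What is kept of one block ends before the next
  block starts, whose first \<open>m + 1\<close> positions are missing, so kept points of different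
  blocks are more than \<open>m\<close> apart.\<close>

lemma (in prob_space) separated_blocks_indep_sums:
  fixes f :: "(int \<Rightarrow> real \<Rightarrow> real)" and l :: int
  assumes sep: "separated_blocks_indep M Y max" and m: "0 < m" and l: "0 < l"
    and [measurable]: "\<And>t. f t \<in> borel_measurable borel"
    and G: "finite G" "\<And>t. t \<in> G \<Longrightarrow> int m < t mod l"
  shows "indep_vars (\<lambda>_. borel) (\<lambda>i \<omega>. \<Sum>t\<in>{t\<in>G. t div l = int i - 1}. f t (Y t m \<omega>)) {1..r::nat}"
proof -
  \<comment> \<open>The whole kept part of a block, since the condition speaks of intervals;
    \<open>G\<close> only selects from it. Blocks are numbered from \<open>1\<close> and quotients
    of positive times start at \<open>0\<close>, hence \<open>int i - 1\<close>.\<close>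
  define I where "I i = {t. t div l = int i - 1 \<and> int m < t mod l}" for i :: nat
  have t_eq: "t = (int i - 1) * l + t mod l" if "t \<in> I i" for t i
    using that div_mult_mod_eq[of t l] by (simp add: I_def)
  have "indep_vars (\<lambda>i. \<Pi>\<^sub>M t\<in>I i. borel) (\<lambda>i \<omega>. \<lambda>t\<in>I i. Y t m \<omega>) {1..r}"
  proof (rule separated_blocks_indepD[OF sep])
    have dist: "int m < \<bar>a - b\<bar>" if "i < j" "a \<in> I i" "b \<in> I j" for i j a b
    proof -
      have "a < int i * l"
        using t_eq[OF that(2)] pos_mod_bound[OF l, of a] by (simp add: algebra_simps)
      also have "int i * l \<le> (int j - 1) * l" using that l by (intro mult_right_mono) auto
      finally have "a < (int j - 1) * l" .
      moreover have "(int j - 1) * l + int m < b" using t_eq[OF that(3)] that(3) by (simp add: I_def)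
      ultimately show ?thesis by linarith
    qed
    show "int_interval (I i)" for i
      unfolding int_interval_def
    proof (intro ballI subsetI)
      fix a b t assume ab: "a \<in> I i" "b \<in> I i" and t: "t \<in> {a..b}"
      have "a div l \<le> t div l" "t div l \<le> b div l" using t l by (auto intro: zdiv_mono1)
      then have d: "t div l = int i - 1" using ab by (simp add: I_def)
      have "a mod l \<le> t mod l"
        using t d ab div_mult_mod_eq[of t l] div_mult_mod_eq[of a l] by (simp add: I_def)
      then show "t \<in> I i" using d ab by (simp add: I_def)
    qed
    show "enat (max m m) < int_set_dist (I i) (I j)" if "i < j" for i j
      using dist[OF that] by (intro int_set_dist_gt) auto
    show "disjoint_family_on I {1..r}" by (auto simp: disjoint_family_on_def I_def)
  qed (use m in simp)
  then have "indep_vars (\<lambda>_. borel)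
      (\<lambda>i \<omega>. \<Sum>t\<in>{t\<in>G. t div l = int i - 1}. f t ((\<lambda>t\<in>I i. Y t m \<omega>) t)) {1..r}"
  proof (rule indep_vars_compose2[where Y = "\<lambda>i y. \<Sum>t\<in>{t\<in>G. t div l = int i - 1}. f t (y t)"])
    fix i
    show "(\<lambda>y. \<Sum>t\<in>{t\<in>G. t div l = int i - 1}. f t (y t)) \<in> borel_measurable (\<Pi>\<^sub>M t\<in>I i. borel)"
    proof (intro borel_measurable_sum)
      fix t assume "t \<in> {t\<in>G. t div l = int i - 1}"
      then have "t \<in> I i" using G by (auto simp: I_def)
      then have [measurable]: "(\<lambda>y. y t) \<in> borel_measurable (\<Pi>\<^sub>M t\<in>I i. borel :: real measure)"
        by (rule measurable_component_singleton)
      show "(\<lambda>y. f t (y t)) \<in> borel_measurable (\<Pi>\<^sub>M t\<in>I i. borel)" by measurable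
    qed
  qed
  moreover have "(\<Sum>t\<in>{t\<in>G. t div l = int i - 1}. f t ((\<lambda>t\<in>I i. Y t m \<omega>) t))
      = (\<Sum>t\<in>{t\<in>G. t div l = int i - 1}. f t (Y t m \<omega>))" for i \<omega>
    using G by (intro sum.cong) (auto simp: I_def)
  ultimately show ?thesis by simp
qed

text \<open>A discarded time is determined by its quotient, between \<open>0\<close> and
  \<open>n div l\<close>, and its residue, between \<open>0\<close> and \<open>m\<close>.\<close>

lemma card_gap_le:
  fixes l :: int
  assumes l: "0 < l"
  shows "real (card {t\<in>{1..int n}. t mod l \<le> int m}) \<le> (real n / real_of_int l + 1) * (real m + 1)"
proof -
  have "{t\<in>{1..int n}. t mod l \<le> int m} \<subseteq> (\<lambda>(j, i). j * l + i) ` ({0..int n div l} \<times> {0..int m})"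
  proof
    fix t assume t: "t \<in> {t\<in>{1..int n}. t mod l \<le> int m}"
    then have "t = t div l * l + t mod l" "0 \<le> t div l" "t div l \<le> int n div l" "0 \<le> t mod l" "t mod l \<le> int m"
      using l by (auto intro: zdiv_mono1 simp: pos_imp_zdiv_nonneg_iff)
    then show "t \<in> (\<lambda>(j, i). j * l + i) ` ({0..int n div l} \<times> {0..int m})"
      by (intro image_eqI[of _ _ "(t div l, t mod l)"]) auto
  qed
  then have "card {t\<in>{1..int n}. t mod l \<le> int m} \<le> card ({0..int n div l} \<times> {0..int m})"
    by (rule surj_card_le[rotated]) auto
  also have "\<dots> = nat (int n div l + 1) * (m + 1)"
    by (simp add: card_cartesian_product nat_add_distrib algebra_simps)
  finally have "real (card {t\<in>{1..int n}. t mod l \<le> int m}) \<le> real (nat (int n div l + 1) * (m + 1))"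
    by (simp only: of_nat_le_iff)
  also have "\<dots> = real (nat (int n div l + 1)) * (real m + 1)" by (simp add: algebra_simps)
  also have "real (nat (int n div l + 1)) = real_of_int (int n div l) + 1"
    using l by (simp add: pos_imp_zdiv_nonneg_iff)
  also have "real_of_int (int n div l) \<le> real n / real_of_int l"
    using real_of_int_div4[of "int n" l] by simp
  finally show ?thesis by (simp add: mult_right_mono)
qed

lemma card_block_le:
  fixes l :: int
  assumes "0 < l"
  shows "finite {t. t div l = j}" "real (card {t. t div l = j}) \<le> real_of_int l"
proof -
  have sub: "{t. t div l = j} \<subseteq> {j * l..<j * l + l}"
  proof
    fix t assume "t \<in> {t. t div l = j}"
    then show "t \<in> {j * l..<j * l + l}"
      using div_mult_mod_eq[of t l] pos_mod_bound[OF assms, of t] pos_mod_sign[OF assms, of t] by auto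
  qed
  then show "finite {t. t div l = j}" by (rule finite_subset) simp
  have "card {t. t div l = j} \<le> card {j * l..<j * l + l}" by (rule card_mono) (use sub in auto)
  then show "real (card {t. t div l = j}) \<le> real_of_int l" using assms by simp
qed

text \<open>Gaps are of order \<open>n powr a\<close>, blocks of order \<open>n powr b\<close>, the
  clipping level is \<open>n powr \<delta>\<close>. The approximation error asks for
  \<open>a * A > 1 / 2\<close>, negligible gaps for \<open>a < b\<close>, small block sums for
  \<open>\<delta> + b < 1 / 2\<close>. All three are compatible because
  \<open>A > 1\<close>.\<close>

lemma block_lengths:
  fixes A :: real
  assumes "1 < A"
  obtains m l :: "nat \<Rightarrow> nat" and K :: "nat \<Rightarrow> real"
  where "\<And>n. 0 < m n" "\<And>n. 0 < l n" "\<And>n. 0 \<le> K n" "filterlim K at_top sequentially"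
    "(\<lambda>n. sqrt (real n) * real (m n) powr (- A)) \<longlonglongrightarrow> 0"
    "(\<lambda>n. (real (m n) + 1) / real (l n)) \<longlonglongrightarrow> 0"
    "(\<lambda>n. (real (m n) + 1) / real n) \<longlonglongrightarrow> 0"
    "(\<lambda>n. K n * real (l n) / sqrt (real n)) \<longlonglongrightarrow> 0"
proof -
  \<comment> \<open>With \<open>1 / A = 1 - 8 * \<delta>\<close>, the choices below are
    \<open>a = 1 / 2 - 3 * \<delta>\<close> and \<open>b = 1 / 2 - 2 * \<delta>\<close>, and every
    exponent that has to be negative is at most \<open>- \<delta>\<close>.\<close>
  define \<delta> where "\<delta> = (1 - 1 / A) / 8"
  have \<delta>: "0 < \<delta>" "\<delta> < 1 / 8" using assms by (auto simp: \<delta>_def field_simps)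
  have iA: "1 / A = 1 - 8 * \<delta>" using assms by (simp add: \<delta>_def field_simps)
  define a where "a = 1 / (2 * A) + \<delta>"
  define b where "b = a + \<delta>"
  have a: "a = 1 / 2 - 3 * \<delta>" "1 / 2 < a * A"
    using iA assms \<delta> by (auto simp: a_def algebra_simps)
  \<comment> \<open>\<open>Suc\<close> of the floor is positive also at \<open>n = 0\<close> and
    exceeds the power by at most \<open>1\<close>.\<close>
  define m where "m n = Suc (nat \<lfloor>real n powr a\<rfloor>)" for n
  define l where "l n = Suc (nat \<lfloor>real n powr b\<rfloor>)" for n
  define K where "K n = real n powr \<delta>" for n
  have mb: "real n powr a \<le> real (m n)" "real (m n) \<le> real n powr a + 1" for n
    unfolding m_def by (auto; linarith)+
  have lb: "real n powr b \<le> real (l n)" "real (l n) \<le> real n powr b + 1" for n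
    unfolding l_def by (auto; linarith)+
  have np: "(\<lambda>n. real n powr e) \<longlonglongrightarrow> 0" if "e < 0" for e
    using that by (intro tendsto_neg_powr filterlim_real_sequentially)
  have null: "f \<longlonglongrightarrow> 0" if "\<And>n. 0 < n \<Longrightarrow> 0 \<le> f n" "\<And>n. 0 < n \<Longrightarrow> f n \<le> g n" "g \<longlonglongrightarrow> 0" for f g :: "nat \<Rightarrow> real"
    by (rule tendsto_sandwich[OF _ _ tendsto_const that(3)])
      (auto intro!: eventually_sequentiallyI[of 1] that(1,2))
  show thesis
  proof
    show "0 < m n" "0 < l n" "0 \<le> K n" for n by (simp_all add: m_def l_def K_def)
    show "filterlim K at_top sequentially"
      unfolding K_def using \<delta>(1) by real_asymp
    show "(\<lambda>n. sqrt (real n) * real (m n) powr (- A)) \<longlonglongrightarrow> 0"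
    proof (rule null)
      fix n :: nat assume n: "0 < n"
      have "real (m n) powr (- A) \<le> (real n powr a) powr (- A)"
        by (rule powr_mono2') (use mb n assms in auto)
      then have "sqrt (real n) * real (m n) powr (- A) \<le> real n powr (1 / 2) * (real n powr a) powr (- A)"
        by (simp add: powr_half_sqrt mult_left_mono)
      then show "sqrt (real n) * real (m n) powr (- A) \<le> real n powr (1 / 2 - a * A)"
        by (simp add: powr_powr powr_add[symmetric])
    qed (use a in \<open>auto intro: np\<close>)
    show "(\<lambda>n. (real (m n) + 1) / real (l n)) \<longlonglongrightarrow> 0"
    proof (rule null)
      fix n :: nat assume n: "0 < n"
      have "(real (m n) + 1) / real (l n) \<le> (real n powr a + 2) / real n powr b"
        using mb[of n] lb[of n] n by (intro frac_le) auto
      also have "\<dots> = real n powr (a - b) + 2 * real n powr (- b)"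
        by (simp only: distrib_right powr_diff powr_minus divide_inverse)
      finally show "(real (m n) + 1) / real (l n) \<le> real n powr (a - b) + 2 * real n powr (- b)" .
    next
      have "(\<lambda>n. real n powr (a - b) + 2 * real n powr (- b)) \<longlonglongrightarrow> 0 + 2 * 0"
        using a \<delta> by (intro tendsto_intros np) (auto simp: b_def)
      then show "(\<lambda>n. real n powr (a - b) + 2 * real n powr (- b)) \<longlonglongrightarrow> 0" by simp
    qed auto
    show "(\<lambda>n. (real (m n) + 1) / real n) \<longlonglongrightarrow> 0"
    proof (rule null)
      fix n :: nat assume n: "0 < n"
      have "(real (m n) + 1) / real n \<le> (real n powr a + 2) / real n"
        using mb[of n] n by (intro divide_right_mono) auto
      also have "\<dots> = (real n powr a + 2) / real n powr 1" by simp
      also have "\<dots> = real n powr (a - 1) + 2 * real n powr (- 1)"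
        by (simp only: distrib_right powr_diff powr_minus divide_inverse)
      finally show "(real (m n) + 1) / real n \<le> real n powr (a - 1) + 2 * real n powr (- 1)" .
    next
      have "(\<lambda>n. real n powr (a - 1) + 2 * real n powr (- 1)) \<longlonglongrightarrow> 0 + 2 * 0"
        using a \<delta> by (intro tendsto_intros np) auto
      then show "(\<lambda>n. real n powr (a - 1) + 2 * real n powr (- 1)) \<longlonglongrightarrow> 0" by simp
    qed auto
    show "(\<lambda>n. K n * real (l n) / sqrt (real n)) \<longlonglongrightarrow> 0"
    proof (rule null)
      fix n :: nat assume n: "0 < n"
      have "K n * real (l n) / sqrt (real n) \<le> real n powr \<delta> * (real n powr b + 1) / real n powr (1 / 2)"
        unfolding K_def powr_half_sqrt[OF of_nat_0_le_iff] using lb[of n]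
        by (intro divide_right_mono mult_left_mono) auto
      also have "\<dots> = real n powr (\<delta> + b - 1 / 2) + real n powr (\<delta> - 1 / 2)"
        by (simp only: powr_diff powr_add distrib_left add_divide_distrib mult_1_right)
      finally show "K n * real (l n) / sqrt (real n) \<le> real n powr (\<delta> + b - 1 / 2) + real n powr (\<delta> - 1 / 2)" .
    next
      have "(\<lambda>n. real n powr (\<delta> + b - 1 / 2) + real n powr (\<delta> - 1 / 2)) \<longlonglongrightarrow> 0 + 0"
        using a \<delta> by (intro tendsto_intros np) (auto simp: b_def)
      then show "(\<lambda>n. real n powr (\<delta> + b - 1 / 2) + real n powr (\<delta> - 1 / 2)) \<longlonglongrightarrow> 0" by simp
    qed (auto simp: K_def)
  qed
qed

section \<open>The central limit theorem for Lipschitz functions of a mixing series\<close>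

text \<open>Clipping, unlike cutting off with an indicator, does not increase Lipschitz constants,
  so clipped functions obey the same covariance bounds as the original one.\<close>

definition clip :: "real \<Rightarrow> real \<Rightarrow> real" where
  "clip K y = max (- K) (min K y)"

lemma abs_clip_le: "0 \<le> K \<Longrightarrow> \<bar>clip K y\<bar> \<le> K"
  by (auto simp: clip_def)

lemma clip_eq: "\<bar>y\<bar> \<le> K \<Longrightarrow> clip K y = y"
  by (auto simp: clip_def)

lemma abs_clip_le_abs: "0 \<le> K \<Longrightarrow> \<bar>clip K y\<bar> \<le> \<bar>y\<bar>"
  by (auto simp: clip_def)

lemma abs_minus_clip_le_abs: "0 \<le> K \<Longrightarrow> \<bar>y - clip K y\<bar> \<le> \<bar>y\<bar>"
  by (auto simp: clip_def)

lemma lipschitz_clip: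
  fixes g :: "real \<Rightarrow> real"
  shows "L-lipschitz_on UNIV g \<Longrightarrow> L-lipschitz_on UNIV (\<lambda>x. clip K (g x))"
  unfolding lipschitz_on_def dist_real_def clip_def by (smt (verit))

text \<open>The excess over the clipped value is soft thresholding at \<open>K\<close>, which has
  slope \<open>0\<close> or \<open>1\<close>.\<close>

lemma lipschitz_minus_clip:
  fixes g :: "real \<Rightarrow> real"
  assumes "0 \<le> K" "L-lipschitz_on UNIV g"
  shows "L-lipschitz_on UNIV (\<lambda>x. g x - clip K (g x))"
  unfolding lipschitz_on_def
proof (intro conjI ballI)
  fix x y :: real
  have "\<bar>(g x - clip K (g x)) - (g y - clip K (g y))\<bar> \<le> \<bar>g x - g y\<bar>"
    using assms(1) unfolding clip_def by linarith
  also have "\<dots> \<le> L * \<bar>x - y\<bar>"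
    using lipschitz_onD[OF assms(2), of x y] by (simp add: dist_real_def)
  finally show "dist (g x - clip K (g x)) (g y - clip K (g y)) \<le> L * dist x y"
    by (simp add: dist_real_def)
qed (use assms(2) lipschitz_on_nonneg in blast)

lemma borel_measurable_lipschitz:
  fixes g :: "real \<Rightarrow> real"
  assumes "L-lipschitz_on UNIV g"
  shows "g \<in> borel_measurable borel"
  using lipschitz_on_continuous_on[OF assms] by (rule borel_measurable_continuous_onI)

lemma (in prob_space) L2_lipschitz:
  assumes g: "L-lipschitz_on UNIV g" and Y: "L2 M Y"
  shows "L2 M (\<lambda>\<omega>. g (Y \<omega>))"
proof (rule l2norm_mono(1))
  have [measurable]: "g \<in> borel_measurable borel" using g by (rule borel_measurable_lipschitz)
  have [measurable]: "Y \<in> borel_measurable M" using Y by (rule L2_measurable)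
  have L: "0 \<le> L" using g by (rule lipschitz_on_nonneg)
  have "L2 M (\<lambda>\<omega>. \<bar>Y \<omega>\<bar>)" using Y by (auto simp: L2_def)
  then show "L2 M (\<lambda>\<omega>. \<bar>g 0\<bar> + L * \<bar>Y \<omega>\<bar>)" by (intro L2_add L2_cmult L2_const)
  show "(\<lambda>\<omega>. g (Y \<omega>)) \<in> borel_measurable M" by measurable
  fix \<omega>
  have "\<bar>g (Y \<omega>) - g 0\<bar> \<le> L * \<bar>Y \<omega>\<bar>"
    using lipschitz_onD[OF g, of "Y \<omega>" 0] by (simp add: dist_real_def)
  moreover have "0 \<le> L * \<bar>Y \<omega>\<bar>" using L by simp
  ultimately show "\<bar>g (Y \<omega>)\<bar> \<le> \<bar>\<bar>g 0\<bar> + L * \<bar>Y \<omega>\<bar>\<bar>" by linarith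
qed

text \<open>M_q-mixing translated to \<open>L2\<close>: one constant \<open>C\<close> is valid for
  all \<open>m > 0\<close>, and the exponent \<open>q\<close> has disappeared.\<close>

locale approximable_series = stationary_series M X for M :: "'a measure" and X +
  fixes \<Psi> :: "int \<Rightarrow> nat \<Rightarrow> 'a \<Rightarrow> real" and C A :: real
  assumes X_L2: "\<And>t. L2 M (X t)"
    and \<Psi>_measurable: "\<And>t m. 0 < m \<Longrightarrow> \<Psi> t m \<in> borel_measurable M"
    and approx_L2: "\<And>t m. 0 < m \<Longrightarrow> L2 M (\<lambda>\<omega>. X t \<omega> - \<Psi> t m \<omega>)"
    and approx_le: "\<And>t m. 0 < m \<Longrightarrow> l2norm M (\<lambda>\<omega>. X t \<omega> - \<Psi> t m \<omega>) \<le> C * real m powr (- A)"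
    and A_gt_1: "1 < A"
    and \<Psi>_indep: "separated_blocks_indep M \<Psi> max"
begin

lemma \<Psi>_L2: "0 < m \<Longrightarrow> L2 M (\<Psi> t m)"
  using L2_diff[OF X_L2[of t] approx_L2[of m t]] by simp

lemma C_nonneg: "0 \<le> C"
  using order_trans[OF l2norm_nonneg approx_le[of 1 0]] by simp

lemma lipschitz_approx_le:
  assumes g: "L-lipschitz_on UNIV g" and m: "0 < m"
  shows "l2norm M (\<lambda>\<omega>. g (X t \<omega>) - g (\<Psi> t m \<omega>)) \<le> L * C * real m powr (- A)"
proof -
  have L: "0 \<le> L" using g by (rule lipschitz_on_nonneg)
  have [measurable]: "g \<in> borel_measurable borel" "\<Psi> t m \<in> borel_measurable M"
    using g \<Psi>_measurable[OF m] by (auto intro: borel_measurable_lipschitz)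
  have "l2norm M (\<lambda>\<omega>. g (X t \<omega>) - g (\<Psi> t m \<omega>)) \<le> l2norm M (\<lambda>\<omega>. L * (X t \<omega> - \<Psi> t m \<omega>))"
  proof (rule l2norm_mono(2))
    show "L2 M (\<lambda>\<omega>. L * (X t \<omega> - \<Psi> t m \<omega>))" by (intro L2_cmult approx_L2 m)
    show "\<bar>g (X t \<omega>) - g (\<Psi> t m \<omega>)\<bar> \<le> \<bar>L * (X t \<omega> - \<Psi> t m \<omega>)\<bar>" for \<omega>
      using lipschitz_onD[OF g, of "X t \<omega>" "\<Psi> t m \<omega>"] L by (simp add: dist_real_def abs_mult)
  qed measurable
  also have "\<dots> \<le> L * (C * real m powr (- A))"
    unfolding l2norm_cmult using L approx_le[OF m, of t] by (auto intro!: mult_left_mono)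
  finally show ?thesis by (simp add: mult.assoc)
qed

text \<open>The bound sees \<open>g\<close> only through its Lipschitz constant and
  \<open>B\<close>, so it holds with one value for a whole family of clipped functions.\<close>

lemma lipschitz_covar_le:
  assumes g: "L-lipschitz_on UNIV g" and B: "l2norm M (\<lambda>\<omega>. g (X 0 \<omega>)) \<le> B"
  shows "\<bar>covar M (\<lambda>\<omega>. g (X s \<omega>)) (\<lambda>\<omega>. g (X t \<omega>))\<bar>
    \<le> 8 powr A * (B\<^sup>2 + L * C * (2 * B + L * C)) * (1 + real (nat \<bar>s - t\<bar>)) powr (- A)"
proof -
  have [measurable]: "g \<in> borel_measurable borel" using g by (rule borel_measurable_lipschitz)
  show ?thesis
  proof (rule covar_decay[where Y = "\<lambda>t \<omega>. g (X t \<omega>)" and Z = "\<lambda>t m \<omega>. g (\<Psi> t m \<omega>)"])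
    show "L2 M (\<lambda>\<omega>. g (X t \<omega>))" for t by (intro L2_lipschitz[OF g] X_L2)
    show "l2norm M (\<lambda>\<omega>. g (X t \<omega>)) \<le> B" for t using B by (simp add: l2norm_X[of g t])
    show "L2 M (\<lambda>\<omega>. g (\<Psi> t m \<omega>))" if "0 < m" for t m by (intro L2_lipschitz[OF g] \<Psi>_L2 that)
    show "l2norm M (\<lambda>\<omega>. g (X t \<omega>) - g (\<Psi> t m \<omega>)) \<le> L * C * real m powr (- A)" if "0 < m" for t m
      by (rule lipschitz_approx_le[OF g that])
    show "indep_var borel (\<lambda>\<omega>. g (\<Psi> s m \<omega>)) borel (\<lambda>\<omega>. g (\<Psi> t m \<omega>))"
      if "0 < m" "2 * int m < \<bar>s - t\<bar>" for s t m
      using indep_var_compose[OF separated_blocks_indep_pair[OF \<Psi>_indep that(1), of s t], of g borel g borel] that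
      by (simp add: comp_def)
  qed (use A_gt_1 in simp)
qed

text \<open>\<open>\<nu>\<^sup>2\<close> arises as the limit of the variances of the normalised
  sums, hence is nonnegative and may be \<open>0\<close>. The conclusion stays with characteristic
  functions so that a remainder can still be added before Levy's continuity theorem is
  applied.\<close>

theorem lipschitz_CLT:
  assumes g: "L-lipschitz_on UNIV g"
  obtains \<nu> where "0 \<le> \<nu>"
    "((\<lambda>k::int. covar M (\<lambda>\<omega>. g (X 0 \<omega>)) (\<lambda>\<omega>. g (X k \<omega>))) has_sum \<nu>\<^sup>2) UNIV"
    "\<And>s. (\<lambda>n. char (distr M borel (\<lambda>\<omega>. sqrt (real n) *
        ((\<Sum>i=1..n. g (X (int i) \<omega>)) / real n - expectation (\<lambda>\<omega>. g (X 0 \<omega>))))) s)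
      \<longlonglongrightarrow> exp (- (s\<^sup>2 * \<nu>\<^sup>2 / 2))"
proof -
  have [measurable]: "g \<in> borel_measurable borel" using g by (rule borel_measurable_lipschitz)
  have L: "0 \<le> L" using g by (rule lipschitz_on_nonneg)
  have gL2: "L2 M (\<lambda>\<omega>. g (X t \<omega>))" for t by (intro L2_lipschitz[OF g] X_L2)
  define B where "B = l2norm M (\<lambda>\<omega>. g (X 0 \<omega>))"
  \<comment> \<open>A common covariance bound for \<open>g\<close>, \<open>T n\<close> and
    \<open>Q n\<close>, which all have Lipschitz constant \<open>L\<close> and norm at most
    \<open>B\<close>.\<close>
  define b where "b k = 8 powr A * (B\<^sup>2 + L * C * (2 * B + L * C)) * (1 + real k) powr (- A)" for k
  have B0: "0 \<le> B" by (simp add: B_def)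
  have b0: "0 \<le> b k" for k
    unfolding b_def using L C_nonneg B0 by (intro mult_nonneg_nonneg add_nonneg_nonneg) auto
  have b_summable: "summable b"
    unfolding b_def by (intro summable_mult summable_one_plus_powr A_gt_1)
  have covar_b: "\<bar>covar M (\<lambda>\<omega>. f (X s \<omega>)) (\<lambda>\<omega>. f (X t \<omega>))\<bar> \<le> b (nat \<bar>s - t\<bar>)"
    if "L-lipschitz_on UNIV f" "l2norm M (\<lambda>\<omega>. f (X 0 \<omega>)) \<le> B" for f s t
    unfolding b_def using lipschitz_covar_le[OF that] .

  \<comment> \<open>Limit of the variances of the normalised sums\<close>
  define r where "r k = covar M (\<lambda>\<omega>. g (X 0 \<omega>)) (\<lambda>\<omega>. g (X (int k) \<omega>))" for k
  have r: "covar M (\<lambda>\<omega>. g (X s \<omega>)) (\<lambda>\<omega>. g (X t \<omega>)) = r (nat \<bar>s - t\<bar>)" for s t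
    unfolding r_def by (rule covar_X) measurable
  have "\<bar>r k\<bar> \<le> b k" for k
    using covar_b[OF g, of 0 "int k"] by (simp add: r_def B_def)
  then have r_summable: "summable (\<lambda>k. \<bar>r k\<bar>)"
    by (intro summable_comparison_test[OF _ b_summable]) auto
  define R where "R = r 0 + 2 * (\<Sum>k. r (Suc k))"
  define cen where "cen Y G \<omega> = (\<Sum>t\<in>G. (Y t \<omega> - expectation (Y t)))"
    for Y :: "int \<Rightarrow> 'a \<Rightarrow> real" and G \<omega>
  have cen_L2: "L2 M (cen Y G)" if "\<And>t. t \<in> G \<Longrightarrow> L2 M (Y t)" for Y G
    unfolding cen_def using that by (intro L2_sum L2_centered)
  have cen_diff: "cen (\<lambda>t \<omega>. Y t \<omega> - Z t \<omega>) G \<omega> = cen Y G \<omega> - cen Z G \<omega>"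
    if "\<And>t. t \<in> G \<Longrightarrow> L2 M (Y t)" "\<And>t. t \<in> G \<Longrightarrow> L2 M (Z t)" for Y Z G \<omega>
    unfolding cen_def sum_subtractf[symmetric] using that by (intro sum.cong) (auto simp: L2_integrable)

  define S where "S n = cen (\<lambda>t \<omega>. g (X t \<omega>)) {1..int n}" for n
  have S_L2: "L2 M (S n)" for n unfolding S_def by (intro cen_L2 gL2)
  have "(l2norm M (S n))\<^sup>2 = (\<Sum>s\<in>{1..int n}. \<Sum>t\<in>{1..int n}. r (nat \<bar>s - t\<bar>))" for n
    unfolding S_def cen_def using gL2 by (subst covar_sum) (auto simp: r)
  then have S_var: "(\<lambda>n. (l2norm M (S n))\<^sup>2 / real n) \<longlonglongrightarrow> R"
    using tendsto_double_sum_stationary[of r] r_summable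
    by (simp add: R_def summable_rabs_cancel)
  have R0: "0 \<le> R" by (rule LIMSEQ_le_const[OF S_var]) (auto intro!: exI[of _ 0])

  obtain m l :: "nat \<Rightarrow> nat" and K :: "nat \<Rightarrow> real"
    where m: "\<And>n. 0 < m n" and l: "\<And>n. 0 < l n" and K: "\<And>n. 0 \<le> K n" "filterlim K at_top sequentially"
    and lim_m: "(\<lambda>n. sqrt (real n) * real (m n) powr (- A)) \<longlonglongrightarrow> 0"
    and lim_ml: "(\<lambda>n. (real (m n) + 1) / real (l n)) \<longlonglongrightarrow> 0"
    and lim_mn: "(\<lambda>n. (real (m n) + 1) / real n) \<longlonglongrightarrow> 0"
    and lim_Kl: "(\<lambda>n. K n * real (l n) / sqrt (real n)) \<longlonglongrightarrow> 0"
    by (rule block_lengths[OF A_gt_1], rule that)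
  \<comment> \<open>Clipping at \<open>K n\<close>, which grows slowly, makes every block sum uniformly of smaller order than
    \<open>sqrt n\<close>, so no moment inequality for sums is needed. The clipped function and the rest \<open>Q\<close> are
    again \<open>L\<close>-Lipschitz, hence obey the same covariance bound \<open>b\<close>.\<close>
  define T where "T n x = clip (K n) (g x)" for n x
  define Q where "Q n x = g x - T n x" for n x
  have T: "L-lipschitz_on UNIV (T n)" for n unfolding T_def by (intro lipschitz_clip g)
  have Q: "L-lipschitz_on UNIV (Q n)" for n
    using lipschitz_minus_clip[OF K(1) g, of n] by (simp add: Q_def T_def)
  have [measurable]: "T n \<in> borel_measurable borel" "Q n \<in> borel_measurable borel" for n
    using T Q by (auto intro: borel_measurable_lipschitz)
  have TL2: "L2 M (\<lambda>\<omega>. T n (X t \<omega>))" "0 < m' \<Longrightarrow> L2 M (\<lambda>\<omega>. T n (\<Psi> t m' \<omega>))" for n t m'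
    by (rule L2_lipschitz[OF T X_L2], rule L2_lipschitz[OF T \<Psi>_L2])
  have QL2: "L2 M (\<lambda>\<omega>. Q n (X t \<omega>))" for n t by (rule L2_lipschitz[OF Q X_L2])
  have T_le: "l2norm M (\<lambda>\<omega>. T n (X 0 \<omega>)) \<le> B" for n
    unfolding B_def by (rule l2norm_mono(2)[OF gL2], measurable) (simp add: T_def abs_clip_le_abs K(1))
  have Q_le: "l2norm M (\<lambda>\<omega>. Q n (X 0 \<omega>)) \<le> B" for n
    unfolding B_def by (rule l2norm_mono(2)[OF gL2], measurable) (simp add: Q_def T_def abs_minus_clip_le_abs K(1))

  \<comment> \<open>Negligibility of the part beyond the clipping level\<close>
  define BK where "BK n = l2norm M (\<lambda>\<omega>. Q n (X 0 \<omega>))" for n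
  have BK: "(\<lambda>n. (BK n)\<^sup>2) \<longlonglongrightarrow> 0"
  proof -
    have "(\<lambda>n. expectation (\<lambda>\<omega>. (Q n (X 0 \<omega>))\<^sup>2)) \<longlonglongrightarrow> expectation (\<lambda>\<omega>. 0)"
    proof (rule integral_dominated_convergence[where w = "\<lambda>\<omega>. (g (X 0 \<omega>))\<^sup>2"])
      show "integrable M (\<lambda>\<omega>. (g (X 0 \<omega>))\<^sup>2)" using gL2 by (rule L2_square_integrable)
      \<comment> \<open>For fixed \<open>\<omega>\<close> the level \<open>K n\<close> eventually
        exceeds \<open>\<bar>g (X 0 \<omega>)\<bar>\<close>, and then nothing is clipped
        off.\<close>
      show "AE \<omega> in M. (\<lambda>n. (Q n (X 0 \<omega>))\<^sup>2) \<longlonglongrightarrow> 0"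
      proof (intro AE_I2 tendsto_eventually)
        fix \<omega>
        have "eventually (\<lambda>n. \<bar>g (X 0 \<omega>)\<bar> \<le> K n) sequentially"
          using K(2) by (simp add: filterlim_at_top)
        then show "eventually (\<lambda>n. (Q n (X 0 \<omega>))\<^sup>2 = 0) sequentially"
          by eventually_elim (simp add: Q_def T_def clip_eq)
      qed
      show "AE \<omega> in M. norm ((Q n (X 0 \<omega>))\<^sup>2) \<le> (g (X 0 \<omega>))\<^sup>2" for n
        using abs_minus_clip_le_abs[OF K(1)] by (auto simp: Q_def T_def abs_le_square_iff)
    qed measurable
    then show ?thesis by (simp add: BK_def l2norm_power2)
  qed
  \<comment> \<open>Cauchy-Schwarz bounds the covariance at every lag by a quantity vanishing with
    \<open>n\<close>, mixing bounds it by one summable over the lags. The minimum of the two is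
    dominated by \<open>b\<close>, so by Tannery's theorem its sum vanishes, and the variance of the
    sum of the \<open>Q n (X t)\<close> is \<open>o(n)\<close>.\<close>
  define bK where "bK n k = min ((BK n)\<^sup>2) (b k)" for n k
  have bK0: "0 \<le> bK n k" "bK n k \<le> b k" for n k using b0 by (auto simp: bK_def)
  have bK_summable: "summable (bK n)" for n
    by (rule summable_comparison_test[OF _ b_summable]) (use bK0 in auto)
  have bK_lim: "(\<lambda>n. suminf (bK n)) \<longlonglongrightarrow> 0"
  proof -
    have "(\<lambda>n. \<Sum>k. bK n k) \<longlonglongrightarrow> (\<Sum>k. 0)"
    proof (rule conjunct2[OF conjunct2[OF tannerys_theorem]])
      show "(\<lambda>n. bK n k) \<longlonglongrightarrow> 0" for k
        using tendsto_min[OF BK tendsto_const[of "b k"]] b0[of k] by (simp add: bK_def)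
      show "\<forall>\<^sub>F (k, n) in sequentially \<times>\<^sub>F sequentially. norm (bK n k) \<le> b k"
        using bK0 by (intro always_eventually) auto
    qed (use b_summable in auto)
    then show ?thesis by simp
  qed
  have Q_cov: "\<bar>covar M (\<lambda>\<omega>. Q n (X s \<omega>)) (\<lambda>\<omega>. Q n (X t \<omega>))\<bar> \<le> bK n (nat \<bar>s - t\<bar>)" for n s t
  proof -
    have "\<bar>covar M (\<lambda>\<omega>. Q n (X s \<omega>)) (\<lambda>\<omega>. Q n (X t \<omega>))\<bar> \<le> b (nat \<bar>s - t\<bar>)"
      by (rule covar_b[OF Q Q_le])
    moreover have "\<bar>covar M (\<lambda>\<omega>. Q n (X s \<omega>)) (\<lambda>\<omega>. Q n (X t \<omega>))\<bar>
        \<le> l2norm M (\<lambda>\<omega>. Q n (X s \<omega>)) * l2norm M (\<lambda>\<omega>. Q n (X t \<omega>))"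
      by (rule abs_covar_le[OF QL2 QL2])
    moreover have "l2norm M (\<lambda>\<omega>. Q n (X t \<omega>)) = BK n" for t
      unfolding BK_def by (rule l2norm_X) measurable
    ultimately show ?thesis by (simp add: bK_def power2_eq_square)
  qed

  \<comment> \<open>Kept positions, gaps and the error of the block approximation\<close>
  define G where "G n = {t\<in>{1..int n}. int (m n) < t mod int (l n)}" for n
  define G' where "G' n = {t\<in>{1..int n}. t mod int (l n) \<le> int (m n)}" for n
  have G_fin: "finite (G n)" "finite (G' n)" for n
    unfolding G_def G'_def by (rule finite_subset[of _ "{1..int n}"]; auto)+
  have G_split: "{1..int n} = G n \<union> G' n" "G n \<inter> G' n = {}" for n by (auto simp: G_def G'_def)
  have G_card: "real (card (G n)) \<le> real n" for n
  proof -
    have "card (G n) \<le> card {1..int n}" by (rule card_mono) (auto simp: G_def)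
    then show ?thesis by simp
  qed
  define W where "W n = cen (\<lambda>t \<omega>. T n (\<Psi> t (m n) \<omega>)) (G n)" for n
  have W_L2: "L2 M (W n)" for n unfolding W_def by (intro cen_L2 TL2 m)

  \<comment> \<open>Three replacements: \<open>g\<close> is clipped, the gaps are dropped, and
    \<open>X\<close> is replaced by its approximation.\<close>
  have decomp: "S n \<omega> - W n \<omega> = cen (\<lambda>t \<omega>. Q n (X t \<omega>)) {1..int n} \<omega>
      + (cen (\<lambda>t \<omega>. T n (X t \<omega>)) (G' n) \<omega>
        + cen (\<lambda>t \<omega>. T n (X t \<omega>) - T n (\<Psi> t (m n) \<omega>)) (G n) \<omega>)" for n \<omega>
  proof -
    have "cen (\<lambda>t \<omega>. T n (X t \<omega>)) {1..int n} \<omega>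
        = cen (\<lambda>t \<omega>. T n (X t \<omega>)) (G n) \<omega> + cen (\<lambda>t \<omega>. T n (X t \<omega>)) (G' n) \<omega>"
      unfolding cen_def G_split(1) using G_split(2) G_fin by (intro sum.union_disjoint) auto
    then show ?thesis
      unfolding S_def W_def Q_def by (simp add: cen_diff gL2 TL2 m)
  qed
  \<comment> \<open>In this order: the clipped-off part, the gaps and the approximation error, each
    divided by \<open>sqrt n\<close>. The bracket under the second root bounds the fraction of times
    that lie in gaps.\<close>
  define E where "E n = sqrt (2 * suminf (bK n))
      + (sqrt (((real (m n) + 1) / real (l n) + (real (m n) + 1) / real n) * (2 * suminf b))
        + 2 * (L * C) * (sqrt (real n) * real (m n) powr (- A)))" for n
  have SW_le: "l2norm M (\<lambda>\<omega>. S n \<omega> - W n \<omega>) \<le> sqrt (real n) * E n" if n: "0 < n" for n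
  proof -
    have 1: "l2norm M (cen (\<lambda>t \<omega>. Q n (X t \<omega>)) {1..int n}) \<le> sqrt (real n) * sqrt (2 * suminf (bK n))"
      unfolding real_sqrt_mult[symmetric] cen_def
      using l2norm_sum_le_covar_bound[OF bK_summable Q_cov QL2, of "{1..int n}"]
      by (intro real_le_rsqrt) simp
    have "real (card (G' n)) \<le> (real n / real (l n) + 1) * (real (m n) + 1)"
      using card_gap_le[of "int (l n)" n "m n"] l[of n] by (simp add: G'_def)
    also have "\<dots> = real n * ((real (m n) + 1) / real (l n) + (real (m n) + 1) / real n)"
      using n l[of n] by (simp add: field_simps)
    finally have "real (card (G' n)) * (2 * suminf b)
        \<le> real n * ((real (m n) + 1) / real (l n) + (real (m n) + 1) / real n) * (2 * suminf b)"
      using suminf_nonneg[OF b_summable b0] by (intro mult_right_mono) auto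
    then have "(l2norm M (cen (\<lambda>t \<omega>. T n (X t \<omega>)) (G' n)))\<^sup>2
        \<le> real n * ((real (m n) + 1) / real (l n) + (real (m n) + 1) / real n) * (2 * suminf b)"
      unfolding cen_def
      using l2norm_sum_le_covar_bound[OF b_summable covar_b[OF T[of n] T_le[of n]] TL2(1) G_fin(2), of n] by linarith
    then have 2: "l2norm M (cen (\<lambda>t \<omega>. T n (X t \<omega>)) (G' n))
        \<le> sqrt (real n) * sqrt (((real (m n) + 1) / real (l n) + (real (m n) + 1) / real n) * (2 * suminf b))"
      unfolding real_sqrt_mult[symmetric] by (intro real_le_rsqrt) (simp add: mult.assoc)
    have "l2norm M (cen (\<lambda>t \<omega>. T n (X t \<omega>) - T n (\<Psi> t (m n) \<omega>)) (G n))
        \<le> (\<Sum>t\<in>G n. L * C * real (m n) powr (- A))"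
      unfolding cen_def
      by (intro order_trans[OF l2norm_sum_le] sum_mono order_trans[OF l2norm_centered_le]
          lipschitz_approx_le T L2_centered L2_diff TL2 m)
    also have "\<dots> \<le> real n * (2 * (L * C) * real (m n) powr (- A))"
      using G_card[of n] L C_nonneg by (simp add: mult_mono)
    also have "\<dots> = sqrt (real n) * (2 * (L * C) * (sqrt (real n) * real (m n) powr (- A)))"
      by simp
    finally have 3: "l2norm M (cen (\<lambda>t \<omega>. T n (X t \<omega>) - T n (\<Psi> t (m n) \<omega>)) (G n))
      \<le> sqrt (real n) * (2 * (L * C) * (sqrt (real n) * real (m n) powr (- A)))" .
    have "l2norm M (\<lambda>\<omega>. S n \<omega> - W n \<omega>) \<le> l2norm M (cen (\<lambda>t \<omega>. Q n (X t \<omega>)) {1..int n})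
      + (l2norm M (cen (\<lambda>t \<omega>. T n (X t \<omega>)) (G' n))
        + l2norm M (cen (\<lambda>t \<omega>. T n (X t \<omega>) - T n (\<Psi> t (m n) \<omega>)) (G n)))"
      unfolding decomp
      by (intro order_trans[OF l2norm_triangle] add_mono order_refl cen_L2 L2_add L2_diff TL2 QL2 m)
    then show ?thesis using 1 2 3 unfolding E_def distrib_left by linarith
  qed
  have E_lim: "E \<longlonglongrightarrow> 0"
  proof -
    have "E \<longlonglongrightarrow> sqrt (2 * 0) + (sqrt ((0 + 0) * (2 * suminf b)) + 2 * (L * C) * 0)"
      unfolding E_def by (intro tendsto_intros bK_lim lim_ml lim_mn lim_m)
    then show ?thesis by simp
  qed
  have E0: "0 \<le> E n" for n
    unfolding E_def using L C_nonneg suminf_nonneg[OF b_summable b0] suminf_nonneg[OF bK_summable bK0(1)]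
    by (intro add_nonneg_nonneg mult_nonneg_nonneg real_sqrt_ge_zero) auto
  \<comment> \<open>At \<open>n = 0\<close> this is \<open>0\<close>, in agreement with the factor
    \<open>sqrt (real n)\<close>, so \<open>S_eq\<close> below holds for every
    \<open>n\<close>.\<close>
  define a where "a n = 1 / sqrt (real n)" for n
  have a0: "0 \<le> a n" for n by (simp add: a_def)
  have SW_lim: "(\<lambda>n. l2norm M (\<lambda>\<omega>. a n * W n \<omega> - a n * S n \<omega>)) \<longlonglongrightarrow> 0"
  proof (rule tendsto_sandwich[OF _ _ tendsto_const E_lim])
    show "\<forall>\<^sub>F n in sequentially. l2norm M (\<lambda>\<omega>. a n * W n \<omega> - a n * S n \<omega>) \<le> E n"
    proof (rule eventually_sequentiallyI[of 1])
      fix n :: nat assume n: "1 \<le> n"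
      have "l2norm M (\<lambda>\<omega>. a n * W n \<omega> - a n * S n \<omega>) = a n * l2norm M (\<lambda>\<omega>. S n \<omega> - W n \<omega>)"
        unfolding right_diff_distrib[symmetric] l2norm_cmult l2norm_minus_commute[of M "S n"] using a0 by simp
      also have "\<dots> \<le> a n * (sqrt (real n) * E n)" using n by (intro mult_left_mono SW_le a0) auto
      also have "\<dots> = E n" using n by (simp add: a_def)
      finally show "l2norm M (\<lambda>\<omega>. a n * W n \<omega> - a n * S n \<omega>) \<le> E n" .
    qed
  qed simp
  have aS_L2: "L2 M (\<lambda>\<omega>. a n * S n \<omega>)" and aW_L2: "L2 M (\<lambda>\<omega>. a n * W n \<omega>)" for n
    by (intro L2_cmult S_L2 W_L2)+
  have aS: "(\<lambda>n. l2norm M (\<lambda>\<omega>. a n * S n \<omega>)) \<longlonglongrightarrow> sqrt R"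
  proof -
    have "l2norm M (\<lambda>\<omega>. a n * S n \<omega>) = sqrt ((l2norm M (S n))\<^sup>2 / real n)" for n
      unfolding l2norm_cmult by (simp add: a_def real_sqrt_divide)
    then show ?thesis using tendsto_real_sqrt[OF S_var] by simp
  qed
  \<comment> \<open>Norms differ by at most the norm of the difference, so the variance of the block
    sum inherits its limit from the full sum.\<close>
  have aW: "(\<lambda>n. (l2norm M (\<lambda>\<omega>. a n * W n \<omega>))\<^sup>2) \<longlonglongrightarrow> R"
  proof -
    have "(\<lambda>n. l2norm M (\<lambda>\<omega>. a n * W n \<omega>) - l2norm M (\<lambda>\<omega>. a n * S n \<omega>)) \<longlonglongrightarrow> 0"
    proof (rule Lim_null_comparison[OF _ SW_lim], intro always_eventually allI)
      fix n
      show "norm (l2norm M (\<lambda>\<omega>. a n * W n \<omega>) - l2norm M (\<lambda>\<omega>. a n * S n \<omega>))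
          \<le> l2norm M (\<lambda>\<omega>. a n * W n \<omega> - a n * S n \<omega>)"
        using l2norm_triangle_diff[OF aW_L2[of n] aS_L2[of n]] l2norm_triangle_diff[OF aS_L2[of n] aW_L2[of n]]
        by (simp add: l2norm_minus_commute[of M "\<lambda>\<omega>. a n * S n \<omega>"])
    qed
    from tendsto_power[OF tendsto_add[OF this aS], of 2] show ?thesis using R0 by simp
  qed

  \<comment> \<open>Independent block sums\<close>
  define f where "f n t y = a n * (T n y - expectation (\<lambda>\<omega>. T n (\<Psi> t (m n) \<omega>)))" for n t y
  have [measurable]: "f n t \<in> borel_measurable borel" for n t unfolding f_def by measurable
  \<comment> \<open>Each term of \<open>f\<close> is centred at its own mean, depending on
    \<open>t\<close>, since nothing makes the approximations stationary.\<close>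
  define \<xi> where "\<xi> n i \<omega> = (\<Sum>t\<in>{t\<in>G n. t div int (l n) = int i - 1}. f n t (\<Psi> t (m n) \<omega>))" for n i \<omega>
  define I where "I n = {1..nat (int n div int (l n)) + 1}" for n
  have \<xi>_indep: "indep_vars (\<lambda>_. borel) (\<xi> n) (I n)" for n
    unfolding \<xi>_def I_def using m[of n] l[of n]
    by (intro separated_blocks_indep_sums[OF \<Psi>_indep]) (simp_all add: G_fin, simp add: G_def)
  have f_int: "integrable M (\<lambda>\<omega>. f n t (\<Psi> t (m n) \<omega>))"
    and f_mean: "expectation (\<lambda>\<omega>. f n t (\<Psi> t (m n) \<omega>)) = 0" for n t
    using L2_integrable[OF TL2(2)[OF m]] by (simp_all add: f_def prob_space)
  have \<xi>_mean: "expectation (\<xi> n i) = 0" for n i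
    unfolding \<xi>_def by (subst Bochner_Integration.integral_sum) (auto simp: f_int f_mean)
  \<comment> \<open>A block has at most \<open>l n\<close> terms, each at most
    \<open>2 * K n / sqrt n\<close>; the factor \<open>2\<close> pays for the centring.\<close>
  have \<xi>_bound: "\<bar>\<xi> n i \<omega>\<bar> \<le> 2 * (K n * real (l n) / sqrt (real n))" for n i \<omega>
  proof -
    have T_bd: "\<bar>T n x\<bar> \<le> K n" for x by (simp add: T_def abs_clip_le K)
    have "\<bar>f n t y\<bar> \<le> a n * (2 * K n)" for t y
    proof -
      have "\<bar>expectation (\<lambda>\<omega>. T n (\<Psi> t (m n) \<omega>))\<bar> \<le> expectation (\<lambda>\<omega>. \<bar>T n (\<Psi> t (m n) \<omega>)\<bar>)"
        by (rule integral_abs_bound)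
      also have "\<dots> \<le> expectation (\<lambda>_. K n)"
        using L2_integrable[OF TL2(2)[OF m]] T_bd by (intro integral_mono) auto
      finally have "\<bar>T n y - expectation (\<lambda>\<omega>. T n (\<Psi> t (m n) \<omega>))\<bar> \<le> 2 * K n"
        using T_bd[of y] by (simp add: prob_space)
      then show ?thesis unfolding f_def abs_mult using a0[of n] by (simp add: mult_left_mono)
    qed
    then have "\<bar>\<xi> n i \<omega>\<bar> \<le> (\<Sum>t\<in>{t\<in>G n. t div int (l n) = int i - 1}. a n * (2 * K n))"
      unfolding \<xi>_def by (intro order_trans[OF sum_abs] sum_mono)
    also have "\<dots> = real (card {t\<in>G n. t div int (l n) = int i - 1}) * (a n * (2 * K n))" by simp
    also have "\<dots> \<le> real (l n) * (a n * (2 * K n))"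
    proof (rule mult_right_mono)
      have l': "0 < int (l n)" using l[of n] by simp
      have "card {t\<in>G n. t div int (l n) = int i - 1} \<le> card {t. t div int (l n) = int i - 1}"
        using card_block_le(1)[OF l'] by (intro card_mono) auto
      then show "real (card {t\<in>G n. t div int (l n) = int i - 1}) \<le> real (l n)"
        using card_block_le(2)[OF l', of "int i - 1"] by simp
    qed (use a0 K in auto)
    finally show ?thesis by (simp add: a_def ac_simps)
  qed
  have \<xi>_meas: "\<xi> n i \<in> borel_measurable M" for n i
    unfolding \<xi>_def using \<Psi>_measurable[OF m] by measurable
  have \<xi>_L2: "L2 M (\<xi> n i)" for n i
    using \<xi>_meas \<xi>_bound by (rule L2_bounded(1))
  have W_\<xi>: "a n * W n \<omega> = (\<Sum>i\<in>I n. \<xi> n i \<omega>)" for n \<omega>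
  proof -
    have l': "0 < int (l n)" using l[of n] by simp
    have pos: "0 \<le> t div int (l n)" "t div int (l n) \<le> int n div int (l n)" if "t \<in> G n" for t
      using that l' by (auto simp: G_def pos_imp_zdiv_nonneg_iff intro: zdiv_mono1)
    have "(\<Sum>i\<in>I n. \<xi> n i \<omega>)
        = (\<Sum>i\<in>I n. \<Sum>t\<in>{t\<in>G n. nat (t div int (l n)) + 1 = i}. f n t (\<Psi> t (m n) \<omega>))"
      unfolding \<xi>_def by (intro sum.cong refl) (use pos in \<open>force simp: I_def\<close>)
    also have "\<dots> = (\<Sum>t\<in>G n. f n t (\<Psi> t (m n) \<omega>))"
      using G_fin by (intro sum.group) (auto simp: I_def dest: pos intro: nat_mono)
    also have "\<dots> = a n * W n \<omega>" by (simp add: W_def cen_def f_def sum_distrib_left)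
    finally show ?thesis ..
  qed
  \<comment> \<open>Independent blocks are uncorrelated, so the sum of their variances is the
    variance of the whole, whose limit \<open>R\<close> is known.\<close>
  have W_var: "(l2norm M (\<lambda>\<omega>. a n * W n \<omega>))\<^sup>2 = (\<Sum>i\<in>I n. expectation (\<lambda>\<omega>. (\<xi> n i \<omega>)\<^sup>2))" for n
  proof -
    have "(l2norm M (\<lambda>\<omega>. a n * W n \<omega>))\<^sup>2 = (\<Sum>i\<in>I n. \<Sum>j\<in>I n. covar M (\<xi> n i) (\<xi> n j))"
      using covar_sum[of "I n" "\<xi> n", OF \<xi>_L2] by (simp add: W_\<xi> \<xi>_mean)
    also have "\<dots> = (\<Sum>i\<in>I n. \<Sum>j\<in>I n. if j = i then expectation (\<lambda>\<omega>. (\<xi> n i \<omega>)\<^sup>2) else 0)"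
    proof (intro sum.cong refl)
      fix i j assume ij: "i \<in> I n" "j \<in> I n"
      show "covar M (\<xi> n i) (\<xi> n j) = (if j = i then expectation (\<lambda>\<omega>. (\<xi> n i \<omega>)\<^sup>2) else 0)"
      proof (cases "j = i")
        case True
        then show ?thesis by (simp add: covar_def \<xi>_mean power2_eq_square)
      next
        case False
        then show ?thesis
          using covar_indep_eq_0[OF \<xi>_L2 \<xi>_L2 indep_vars_imp_indep_var[OF \<xi>_indep ij]] by simp
      qed
    qed
    also have "\<dots> = (\<Sum>i\<in>I n. expectation (\<lambda>\<omega>. (\<xi> n i \<omega>)\<^sup>2))" by (simp add: I_def)
    finally show ?thesis .
  qed

  \<comment> \<open>Passage from the block sums to the full sum\<close>
  have char_W: "(\<lambda>n. char (distr M borel (\<lambda>\<omega>. a n * W n \<omega>)) s) \<longlonglongrightarrow> exp (- (s\<^sup>2 * R / 2))" for s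
    unfolding W_\<xi>
  proof (rule char_bounded_indep_array[OF \<xi>_indep _ \<xi>_bound _ \<xi>_mean])
    show "(\<lambda>n. 2 * (K n * real (l n) / sqrt (real n))) \<longlonglongrightarrow> 0"
      using tendsto_mult[OF tendsto_const lim_Kl, of 2] by simp
    show "(\<lambda>n. \<Sum>i\<in>I n. expectation (\<lambda>\<omega>. (\<xi> n i \<omega>)\<^sup>2)) \<longlonglongrightarrow> R"
      using aW by (simp add: W_var)
  qed (simp add: I_def)
  have char_S: "(\<lambda>n. char (distr M borel (\<lambda>\<omega>. a n * S n \<omega>)) s) \<longlonglongrightarrow> exp (- (s\<^sup>2 * R / 2))" for s
    by (rule char_tendsto_approx_L2[OF _ _ char_W _ SW_lim])
      (auto intro: L2_measurable aW_L2 aS_L2 L2_diff)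
  have S_eq: "sqrt (real n) * ((\<Sum>i=1..n. g (X (int i) \<omega>)) / real n - expectation (\<lambda>\<omega>. g (X 0 \<omega>)))
      = a n * S n \<omega>" for n \<omega>
  proof (cases "n = 0")
    case False
    have "S n \<omega> = (\<Sum>t\<in>{1..int n}. g (X t \<omega>)) - real n * expectation (\<lambda>\<omega>. g (X 0 \<omega>))"
    proof -
      have "(\<Sum>t\<in>{1..int n}. expectation (\<lambda>\<omega>. g (X t \<omega>))) = (\<Sum>t\<in>{1..int n}. expectation (\<lambda>\<omega>. g (X 0 \<omega>)))"
        by (intro sum.cong refl expectation_X) measurable
      then show ?thesis unfolding S_def cen_def by (simp add: sum_subtractf)
    qed
    also have "(\<Sum>t\<in>{1..int n}. g (X t \<omega>)) = (\<Sum>i=1..n. g (X (int i) \<omega>))"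
      by (rule sum.reindex_bij_witness[of _ int nat]) auto
    finally have "S n \<omega> = (\<Sum>i=1..n. g (X (int i) \<omega>)) - real n * expectation (\<lambda>\<omega>. g (X 0 \<omega>))" .
    moreover have "s * (q / (s * s) - e) = 1 / s * (q - s * s * e)" if "s \<noteq> 0" for s q e :: real
      using that by (simp add: field_simps)
    from this[of "sqrt (real n)"] have "sqrt (real n) * (q / real n - e) = a n * (q - real n * e)" for q e
      using False by (simp add: a_def)
    ultimately show ?thesis by simp
  qed (simp add: a_def)
  show thesis
  proof (rule that[of "sqrt R"])
    show "((\<lambda>k::int. covar M (\<lambda>\<omega>. g (X 0 \<omega>)) (\<lambda>\<omega>. g (X k \<omega>))) has_sum (sqrt R)\<^sup>2) UNIV"
      using has_sum_int_nat_abs[OF r_summable] R0 by (simp add: r R_def)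
    show "(\<lambda>n. char (distr M borel (\<lambda>\<omega>. sqrt (real n) *
        ((\<Sum>i=1..n. g (X (int i) \<omega>)) / real n - expectation (\<lambda>\<omega>. g (X 0 \<omega>))))) s)
      \<longlonglongrightarrow> exp (- (s\<^sup>2 * (sqrt R)\<^sup>2 / 2))" for s
      unfolding S_eq using char_S[of s] R0 by simp
  qed (use R0 in simp)
qed

end

section \<open>Integrated quantile functions\<close>

lemma borel_measurable_pos_part[measurable]: "pos_part \<in> borel_measurable borel"
  unfolding pos_part_def[abs_def] by measurable

context cdf_distribution
begin

text \<open>For \<open>0 < u < 1\<close> the set is nonempty and bounded below, so the extended-real
  infimum is the real infimum \<open>I u\<close> of the Skorohod construction.\<close>

lemma quantile_eq_I:
  assumes "0 < u" "u < 1"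
  shows "quantile (cdf M) u = ereal (I u)"
proof -
  have "bdd_below {x. u \<le> cdf M x}"
    by (rule bdd_belowI[of _ "I u"]) (use pseudoinverse[OF assms] in blast)
  moreover have "{x. u \<le> cdf M x} \<noteq> {}"
    using pseudoinverse[OF assms, of "I u"] by blast
  ultimately show ?thesis using assms by (simp add: quantile_def ereal_Inf')
qed

lemma rquantile_eq_I: "0 < u \<Longrightarrow> u < 1 \<Longrightarrow> rquantile (cdf M) u = I u"
  by (simp add: rquantile_def quantile_eq_I)

text \<open>The Galois connection between cdf and quantile, on which both the consistency and the
  measurability of sample quantiles rest.\<close>

lemma rquantile_le_iff:
  assumes "0 < u" "u < 1"
  shows "rquantile (cdf M) u \<le> x \<longleftrightarrow> u \<le> cdf M x"
  unfolding rquantile_eq_I[OF assms] by (rule pseudoinverse[OF assms, symmetric])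

lemma rquantile_mono:
  assumes "0 < u" "u \<le> v" "v < 1"
  shows "rquantile (cdf M) u \<le> rquantile (cdf M) v"
  using mono_onD[OF mono_I, of u v] assms by (simp add: rquantile_eq_I)

text \<open>The quantile function pushes the uniform law on the open unit interval forward to
  \<open>M\<close>.\<close>

lemma set_integral_rquantile_unit:
  fixes \<phi> :: "real \<Rightarrow> real"
  assumes \<phi>[measurable]: "\<phi> \<in> borel_measurable borel"
  shows "(LINT u:{0<..<1}|lborel. \<phi> (rquantile (cdf M) u)) = integral\<^sup>L M \<phi>"
    and "set_integrable lborel {0<..<1} (\<lambda>u. \<phi> (rquantile (cdf M) u)) \<longleftrightarrow> integrable M \<phi>"
proof -
  let ?\<Omega> = "restrict_space lborel {0<..<1::real}"
  have I[measurable]: "I \<in> measurable ?\<Omega> borel"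
    using measurable_CI by (subst measurable_cong_sets[OF sets_restrict_space_cong[OF sets_lborel] refl])
  have "(LINT u:{0<..<1}|lborel. \<phi> (rquantile (cdf M) u)) = (LINT u:{0<..<1}|lborel. \<phi> (I u))"
    by (intro set_lebesgue_integral_cong) (auto simp: rquantile_eq_I)
  also have "\<dots> = (LINT u|?\<Omega>. \<phi> (I u))"
    by (simp add: integral_restrict_space set_lebesgue_integral_def)
  also have "\<dots> = integral\<^sup>L (distr ?\<Omega> borel I) \<phi>" by (rule integral_distr[OF I \<phi>, symmetric])
  finally show "(LINT u:{0<..<1}|lborel. \<phi> (rquantile (cdf M) u)) = integral\<^sup>L M \<phi>"
    by (simp add: distr_I_eq_M)
  have "set_integrable lborel {0<..<1} (\<lambda>u. \<phi> (rquantile (cdf M) u)) \<longleftrightarrow>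
      set_integrable lborel {0<..<1} (\<lambda>u. \<phi> (I u))"
    by (intro set_integrable_cong) (auto simp: rquantile_eq_I)
  also have "\<dots> \<longleftrightarrow> integrable ?\<Omega> (\<lambda>u. \<phi> (I u))"
    by (simp add: integrable_restrict_space set_integrable_def)
  also have "\<dots> \<longleftrightarrow> integrable (distr ?\<Omega> borel I) \<phi>" by (rule integrable_distr_eq[OF I \<phi>, symmetric])
  finally show "set_integrable lborel {0<..<1} (\<lambda>u. \<phi> (rquantile (cdf M) u)) \<longleftrightarrow> integrable M \<phi>"
    by (simp add: distr_I_eq_M)
qed

context
  assumes integrable_id: "integrable M (\<lambda>x. x)"
begin

lemma integrable_pos_part: "integrable M (\<lambda>x. pos_part (b - x))"
  unfolding pos_part_def using integrable_id by auto

lemma set_integrable_rquantile: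
  assumes "S \<subseteq> {0..1}" "S \<in> sets borel"
  shows "set_integrable lborel S (rquantile (cdf M))"
proof -
  have "(\<lambda>x::real. x) \<in> borel_measurable borel" by simp
  from set_integral_rquantile_unit(2)[OF this] integrable_id
  have "set_integrable lborel {0<..<1} (rquantile (cdf M))" by (rule iffD2)
  then have "set_integrable lborel (S \<inter> {0<..<1}) (rquantile (cdf M))"
    by (rule set_integrable_subset) (use assms in auto)
  \<comment> \<open>At \<open>0\<close> and \<open>1\<close> the quantile may be infinite, and
    \<open>rquantile\<close> then has the default value \<open>0\<close>; the two points form a null
    set.\<close>
  then show ?thesis
    unfolding set_integrable_def
    by (subst integrable_discrete_difference[where X = "{0, 1}" and g = "\<lambda>x. indicator (S \<inter> {0<..<1}) x *\<^sub>R rquantile (cdf M) x"])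
      (use assms in \<open>auto split: split_indicator\<close>)
qed

lemma set_integral_rquantile_combine:
  assumes "0 \<le> s" "s \<le> t" "t \<le> v" "v \<le> 1"
  shows "(LINT u:{s..v}|lborel. rquantile (cdf M) u)
    = (LINT u:{s..t}|lborel. rquantile (cdf M) u) + (LINT u:{t..v}|lborel. rquantile (cdf M) u)"
proof -
  have "(LINT u:{s..v}|lborel. rquantile (cdf M) u) = (LINT u:{s..t} \<union> {t<..v}|lborel. rquantile (cdf M) u)"
    using assms by (simp add: ivl_disj_un)
  also have "\<dots> = (LINT u:{s..t}|lborel. rquantile (cdf M) u) + (LINT u:{t<..v}|lborel. rquantile (cdf M) u)"
    using assms by (intro set_integral_Un set_integrable_rquantile) auto
  also have "(LINT u:{t<..v}|lborel. rquantile (cdf M) u) = (LINT u:{t..v}|lborel. rquantile (cdf M) u)"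
    by (rule set_integral_discrete_difference[where X = "{t}"]) auto
  finally show ?thesis .
qed

lemma set_integral_rquantile_total: "(LINT u:{0..1}|lborel. rquantile (cdf M) u) = integral\<^sup>L M (\<lambda>x. x)"
proof -
  have "(LINT u:{0..1}|lborel. rquantile (cdf M) u) = (LINT u:{0<..<1}|lborel. rquantile (cdf M) u)"
    by (rule set_integral_discrete_difference[where X = "{0, 1}"]) auto
  then show ?thesis using set_integral_rquantile_unit(1)[of "\<lambda>x. x"] by simp
qed

text \<open>This is the Rockafellar--Uryasev variational formula.\<close>

lemma
  assumes p: "0 < p" "p < 1"
  shows lower_quantile_integral_ge:
      "b * p - integral\<^sup>L M (\<lambda>x. pos_part (b - x)) \<le> (LINT u:{0..p}|lborel. rquantile (cdf M) u)"
    and lower_quantile_integral_eq: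
      "(LINT u:{0..p}|lborel. rquantile (cdf M) u)
        = rquantile (cdf M) p * p - integral\<^sup>L M (\<lambda>x. pos_part (rquantile (cdf M) p - x))"
proof -
  let ?rq = "rquantile (cdf M)"
  have lin: "(LINT u:{0<..p}|lborel. b - ?rq u) = b * p - (LINT u:{0..p}|lborel. ?rq u)" for b
  proof -
    have "(LINT u:{0<..p}|lborel. b - ?rq u) = (LINT u:{0<..p}|lborel. b) - (LINT u:{0<..p}|lborel. ?rq u)"
      using p by (intro set_integral_diff set_integrable_rquantile) (auto simp: set_integrable_def)
    also have "(LINT u:{0<..p}|lborel. ?rq u) = (LINT u:{0..p}|lborel. ?rq u)"
      by (rule set_integral_discrete_difference[where X = "{0}"]) auto
    also have "(LINT u:{0<..p}|lborel. b) = b * p"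
      using p by (simp add: set_lebesgue_integral_def)
    finally show ?thesis .
  qed
  have int: "set_integrable lborel {0<..p} (\<lambda>u. b - ?rq u)" for b
    using p by (intro set_integral_diff set_integrable_rquantile) (auto simp: set_integrable_def)
  have J: "integral\<^sup>L M (\<lambda>x. pos_part (b - x)) = (LINT u:{0<..<1}|lborel. pos_part (b - ?rq u))"
    and J_int: "set_integrable lborel {0<..<1} (\<lambda>u. pos_part (b - ?rq u))" for b
    using set_integral_rquantile_unit[of "\<lambda>x. pos_part (b - x)"] integrable_pos_part by simp_all
  show "b * p - integral\<^sup>L M (\<lambda>x. pos_part (b - x)) \<le> (LINT u:{0..p}|lborel. ?rq u)"
  proof -
    \<comment> \<open>Pointwise \<open>y \<le> pos_part y\<close>, and the positive part is
      nonnegative on the rest of the unit interval.\<close>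
    have "(LINT u:{0<..p}|lborel. b - ?rq u) \<le> (LINT u:{0<..<1}|lborel. pos_part (b - ?rq u))"
      unfolding set_lebesgue_integral_def
      using int[of b] J_int[of b] p unfolding set_integrable_def
      by (intro integral_mono) (auto simp: pos_part_def split: split_indicator)
    then show ?thesis unfolding lin J by simp
  qed
  show "(LINT u:{0..p}|lborel. ?rq u) = ?rq p * p - integral\<^sup>L M (\<lambda>x. pos_part (?rq p - x))"
  proof -
    \<comment> \<open>By monotonicity the difference is nonnegative up to \<open>p\<close> and
      nonpositive after it, so nothing is lost in the inequality above at
      \<open>b = ?rq p\<close>.\<close>
    have "pos_part (?rq p - ?rq u) = (if u \<le> p then ?rq p - ?rq u else 0)" if "0 < u" "u < 1" for u
      using rquantile_mono[of u p] rquantile_mono[of p u] that p by (auto simp: pos_part_def)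
    then have "(LINT u:{0<..<1}|lborel. pos_part (?rq p - ?rq u)) = (LINT u:{0<..p}|lborel. ?rq p - ?rq u)"
      unfolding set_lebesgue_integral_def
      by (intro Bochner_Integration.integral_cong) (use p in \<open>auto split: split_indicator\<close>)
    then show ?thesis unfolding lin J by simp
  qed
qed

text \<open>Fubini: \<open>pos_part (b - y) - pos_part (a - y)\<close> is the length of the set of
  \<open>x\<close> in \<open>{a<..b}\<close> with \<open>y \<le> x\<close>, and for fixed
  \<open>x\<close> the points \<open>y\<close> with \<open>y \<le> x\<close> have mass
  \<open>cdf M x\<close>.\<close>

lemma integral_pos_part_diff:
  assumes ab: "a \<le> b"
  shows "integral\<^sup>L M (\<lambda>x. pos_part (b - x)) - integral\<^sup>L M (\<lambda>x. pos_part (a - x))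
    = (LINT x:{a<..b}|lborel. cdf M x)"
proof -
  interpret P: pair_sigma_finite M lborel ..
  define E where "E = {z \<in> space (M \<Otimes>\<^sub>M lborel). a < snd z \<and> snd z \<le> b \<and> fst z \<le> snd z}"
  have E_sets[measurable]: "E \<in> sets (M \<Otimes>\<^sub>M lborel)" unfolding E_def by measurable
  have E_iff: "(y, x) \<in> E \<longleftrightarrow> a < x \<and> x \<le> b \<and> y \<le> x" for y x
    by (auto simp: E_def space_pair_measure)
  have "emeasure (M \<Otimes>\<^sub>M lborel) E \<le> emeasure (M \<Otimes>\<^sub>M lborel) (space M \<times> {a<..b})"
    by (intro emeasure_mono) (auto simp: E_def space_pair_measure)
  also have "\<dots> < \<infinity>"
    using ab by (subst lborel.emeasure_pair_measure_Times) (auto simp: emeasure_space_1[unfolded space_eq_univ])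
  finally have "integrable (M \<Otimes>\<^sub>M lborel) (indicator E :: _ \<Rightarrow> real)"
    by (intro integrable_real_indicator E_sets)
  then have int: "integrable (M \<Otimes>\<^sub>M lborel) (\<lambda>(y, x). indicator E (y, x) :: real)" by simp
  have "(LINT y|M. LINT x|lborel. indicator E (y, x) :: real) = (LINT x|lborel. LINT y|M. indicator E (y, x))"
    by (rule P.Fubini_integral[OF int, symmetric])
  moreover have "(LINT x|lborel. indicator E (y, x) :: real) = pos_part (b - y) - pos_part (a - y)" for y
  proof -
    \<comment> \<open>For \<open>a < y\<close> the slice is \<open>{y..b}\<close>, which is empty
      once \<open>y > b\<close>.\<close>
    have "(\<lambda>x. indicator E (y, x) :: real) = indicator (if a < y then {y..b} else {a<..b})"
      by (auto simp: fun_eq_iff E_iff split: split_indicator)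
    then show ?thesis using ab by (auto simp: pos_part_def)
  qed
  moreover have "(LINT y|M. indicator E (y, x) :: real) = indicator {a<..b} x *\<^sub>R cdf M x" for x
  proof -
    have "(\<lambda>y. indicator E (y, x) :: real) = (\<lambda>y. indicator {a<..b} x * indicator {..x} y)"
      by (auto simp: fun_eq_iff E_iff split: split_indicator)
    then show ?thesis by (simp add: cdf_def)
  qed
  ultimately show ?thesis
    by (simp add: set_lebesgue_integral_def integrable_pos_part)
qed

end

end

lemma set_integrable_cdf:
  assumes "real_distribution M"
  shows "set_integrable lborel {a<..b} (cdf M)"
proof -
  interpret cdf_distribution M using assms by (simp add: cdf_distribution_def)
  have "emeasure lborel {a<..b} < \<infinity>" by (cases "a \<le> b") auto
  then show ?thesis
    unfolding set_integrable_def
    by (intro integrableI_bounded_set_indicator[where B = 1])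
      (auto simp: cdf_nonneg cdf_bounded_prob)
qed

text \<open>The increments are integrals of the cdfs between \<open>a\<close> and \<open>b\<close>.
  The window about \<open>a\<close> serves either order of the two points and does not move with
  \<open>b\<close>, which will be random; a nonnegative integral can then be exchanged with the
  expectation by Tonelli.\<close>

lemma pos_part_increment_diff_le:
  assumes M: "real_distribution M" "integrable M (\<lambda>x. x)"
    and N: "real_distribution N" "integrable N (\<lambda>x. x)"
    and ab: "\<bar>b - a\<bar> \<le> \<epsilon>"
  shows "ennreal \<bar>(integral\<^sup>L M (\<lambda>x. pos_part (b - x)) - integral\<^sup>L M (\<lambda>x. pos_part (a - x)))
      - (integral\<^sup>L N (\<lambda>x. pos_part (b - x)) - integral\<^sup>L N (\<lambda>x. pos_part (a - x)))\<bar>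
    \<le> (\<integral>\<^sup>+x\<in>{a - \<epsilon>..a + \<epsilon>}. ennreal \<bar>cdf M x - cdf N x\<bar> \<partial>lborel)"
proof -
  interpret M: cdf_distribution M using M by (simp add: cdf_distribution_def)
  interpret N: cdf_distribution N using N by (simp add: cdf_distribution_def)
  let ?J = "\<lambda>M b. integral\<^sup>L M (\<lambda>x. pos_part (b - x))"
  have main: "ennreal \<bar>(?J M d - ?J M c) - (?J N d - ?J N c)\<bar>
      \<le> (\<integral>\<^sup>+x\<in>{a - \<epsilon>..a + \<epsilon>}. ennreal \<bar>cdf M x - cdf N x\<bar> \<partial>lborel)"
    if cd: "c \<le> d" "{c<..d} \<subseteq> {a - \<epsilon>..a + \<epsilon>}" for c d
  proof -
    have int: "set_integrable lborel {c<..d} (\<lambda>x. cdf M x - cdf N x)"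
      using M N by (intro set_integral_diff set_integrable_cdf)
    have "(?J M d - ?J M c) - (?J N d - ?J N c) = (LINT x:{c<..d}|lborel. cdf M x - cdf N x)"
      unfolding M.integral_pos_part_diff[OF M(2) cd(1)] N.integral_pos_part_diff[OF N(2) cd(1)]
      using M N by (intro set_integral_diff(2)[symmetric] set_integrable_cdf)
    then have "ennreal \<bar>(?J M d - ?J M c) - (?J N d - ?J N c)\<bar>
        = ennreal (norm (LINT x|lborel. indicator {c<..d} x *\<^sub>R (cdf M x - cdf N x)))"
      by (simp add: set_lebesgue_integral_def)
    also have "\<dots> \<le> (\<integral>\<^sup>+x. norm (indicator {c<..d} x *\<^sub>R (cdf M x - cdf N x)) \<partial>lborel)"
      using int unfolding set_integrable_def by (rule integral_norm_bound_ennreal)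
    also have "\<dots> \<le> (\<integral>\<^sup>+x\<in>{a - \<epsilon>..a + \<epsilon>}. ennreal \<bar>cdf M x - cdf N x\<bar> \<partial>lborel)"
      by (intro nn_integral_mono) (use cd in \<open>auto split: split_indicator\<close>)
    finally show ?thesis .
  qed
  show ?thesis
  proof (cases "a \<le> b")
    case True
    then show ?thesis using ab by (intro main) auto
  next
    case False
    have "\<bar>(?J M b - ?J M a) - (?J N b - ?J N a)\<bar> = \<bar>(?J M a - ?J M b) - (?J N a - ?J N b)\<bar>"
      by linarith
    moreover have "{b<..a} \<subseteq> {a - \<epsilon>..a + \<epsilon>}"
      by (rule subsetI) (use False ab in auto)
    ultimately show ?thesis using main[of b a] False by simp
  qed
qed

section \<open>Empirical distributions\<close>

text \<open>The law of a uniformly chosen entry: as a measure, it makes every result on quantiles of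
  a distribution apply to sample and population alike. For \<open>n = 0\<close> the index set is
  empty, hence the conditions \<open>0 < n\<close> below.\<close>

definition empirical :: "(nat \<Rightarrow> real) \<Rightarrow> nat \<Rightarrow> real measure" where
  "empirical v n = distr (measure_pmf (pmf_of_set {1..n})) borel v"

lemma real_distribution_empirical: "real_distribution (empirical v n)"
  unfolding empirical_def by (intro prob_space.real_distribution_distr prob_space_measure_pmf) simp

lemma integrable_empirical:
  fixes \<phi> :: "real \<Rightarrow> real"
  assumes "0 < n" "\<phi> \<in> borel_measurable borel"
  shows "integrable (empirical v n) \<phi>"
  unfolding empirical_def using assms
  by (subst integrable_distr_eq) (auto intro!: integrable_measure_pmf_finite simp: set_pmf_of_set)

lemma integral_empirical:
  fixes \<phi> :: "real \<Rightarrow> real"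
  assumes "0 < n" "\<phi> \<in> borel_measurable borel"
  shows "integral\<^sup>L (empirical v n) \<phi> = (\<Sum>i=1..n. \<phi> (v i)) / real n"
  unfolding empirical_def using assms
  by (subst integral_distr) (auto simp: integral_pmf_of_set)

lemma cdf_empirical:
  assumes "0 < n"
  shows "cdf (empirical (\<lambda>i. X (int i) \<omega>) n) = ecdf X n \<omega>"
proof
  fix x
  interpret real_distribution "empirical (\<lambda>i. X (int i) \<omega>) n" by (rule real_distribution_empirical)
  have "cdf (empirical (\<lambda>i. X (int i) \<omega>) n) x = integral\<^sup>L (empirical (\<lambda>i. X (int i) \<omega>) n) (indicator {..x})"
    by (simp add: cdf_def)
  also have "\<dots> = ecdf X n \<omega> x"
    using assms by (subst integral_empirical) (auto simp: ecdf_def)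
  finally show "cdf (empirical (\<lambda>i. X (int i) \<omega>) n) x = ecdf X n \<omega> x" .
qed

section \<open>The empirical process\<close>

text \<open>One constant \<open>D\<close> has to work for all \<open>x\<close>, since the deviation
  will be integrated over a window of values of \<open>x\<close>.\<close>

locale empirical_process = stationary_series M X for M :: "'a measure" and X +
  fixes F :: "real \<Rightarrow> real" and D :: real
  assumes F_eq: "F = cdf (distr M borel (X 0))"
    and X_integrable: "integrable M (X 0)"
    and ecdf_deviation: "\<And>n x. 0 < n \<Longrightarrow> l2norm M (\<lambda>\<omega>. ecdf X n \<omega> x - F x) \<le> D / sqrt (real n)"
begin

abbreviation marginal :: "real measure" where
  "marginal \<equiv> distr M borel (X 0)"

abbreviation sample :: "nat \<Rightarrow> 'a \<Rightarrow> real measure" where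
  "sample n \<omega> \<equiv> empirical (\<lambda>i. X (int i) \<omega>) n"

lemma real_distribution_marginal: "real_distribution marginal"
  by (rule real_distribution_distr) simp

sublocale F: cdf_distribution marginal
  unfolding cdf_distribution_def by (rule real_distribution_marginal)

lemma integrable_marginal: "integrable marginal (\<lambda>x. x)"
  using X_integrable by (subst integrable_distr_eq) auto

lemma integral_marginal: "\<phi> \<in> borel_measurable borel \<Longrightarrow> integral\<^sup>L marginal \<phi> = expectation (\<lambda>\<omega>. \<phi> (X 0 \<omega>))"
  for \<phi> :: "real \<Rightarrow> real"
  by (rule integral_distr) simp_all

lemma cdf_distribution_sample: "cdf_distribution (sample n \<omega>)"
  unfolding cdf_distribution_def by (rule real_distribution_empirical)

lemma integrable_sample: "0 < n \<Longrightarrow> integrable (sample n \<omega>) (\<lambda>x. x)"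
  by (rule integrable_empirical) simp_all

text \<open>The joint version is what exchanging the integrals in
  \<open>expected_deviation_le\<close> asks for.\<close>

lemma ecdf_measurable[measurable]:
  "(\<lambda>\<omega>. ecdf X n \<omega> x) \<in> borel_measurable M"
  "(\<lambda>(\<omega>, x). ecdf X n \<omega> x) \<in> borel_measurable (M \<Otimes>\<^sub>M borel)"
  unfolding ecdf_def indicator_def atMost_iff by measurable

lemma F_measurable[measurable]: "F \<in> borel_measurable borel"
  unfolding F_eq by measurable

lemma ecdf_deviation_L2: "L2 M (\<lambda>\<omega>. ecdf X n \<omega> x - F x)"
proof (rule L2_diff[OF _ L2_const])
  show "L2 M (\<lambda>\<omega>. ecdf X n \<omega> x)"
  \<comment> \<open>This bound is \<open>1\<close> for \<open>n > 0\<close> and \<open>0\<close> for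
    \<open>n = 0\<close>, where the empirical cdf is \<open>0\<close> as well.\<close>
  proof (rule L2_bounded(1)[of _ "real n / real n"])
    fix \<omega>
    have "(\<Sum>i=1..n. indicator {..x} (X (int i) \<omega>)) \<le> (\<Sum>i=1..n. 1 :: real)"
      by (intro sum_mono) (simp split: split_indicator)
    moreover have "0 \<le> (\<Sum>i=1..n. indicator {..x} (X (int i) \<omega>) :: real)" by (intro sum_nonneg) simp
    ultimately show "\<bar>ecdf X n \<omega> x\<bar> \<le> real n / real n"
      unfolding ecdf_def by (simp add: divide_right_mono)
  qed measurable
qed

lemma D_nonneg: "0 \<le> D"
  using order_trans[OF l2norm_nonneg ecdf_deviation[of 1 0]] by simp

lemma ecdf_consistent:
  assumes "0 < \<kappa>"
  shows "(\<lambda>n. prob {\<omega>\<in>space M. \<kappa> < \<bar>ecdf X n \<omega> x - F x\<bar>}) \<longlonglongrightarrow> 0"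
proof (rule tendsto_sandwich[OF _ _ tendsto_const])
  show "\<forall>\<^sub>F n in sequentially. prob {\<omega>\<in>space M. \<kappa> < \<bar>ecdf X n \<omega> x - F x\<bar>} \<le> (D / sqrt (real n) / \<kappa>)\<^sup>2"
  proof (rule eventually_sequentiallyI[of 1])
    fix n :: nat assume n: "1 \<le> n"
    have "prob {\<omega>\<in>space M. \<kappa> < \<bar>ecdf X n \<omega> x - F x\<bar>} \<le> (l2norm M (\<lambda>\<omega>. ecdf X n \<omega> x - F x) / \<kappa>)\<^sup>2"
      by (intro prob_gt_le_l2norm ecdf_deviation_L2 assms)
    also have "\<dots> \<le> (D / sqrt (real n) / \<kappa>)\<^sup>2"
      using n assms by (intro power_mono divide_right_mono ecdf_deviation) auto
    finally show "prob {\<omega>\<in>space M. \<kappa> < \<bar>ecdf X n \<omega> x - F x\<bar>} \<le> (D / sqrt (real n) / \<kappa>)\<^sup>2" .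
  qed
  have "(\<lambda>n. (D / sqrt (real n) / \<kappa>)\<^sup>2) \<longlonglongrightarrow> (0 / \<kappa>)\<^sup>2"
    using assms
    by (intro tendsto_intros tendsto_divide_0[OF tendsto_const] filterlim_at_top_imp_at_infinity
        filterlim_compose[OF sqrt_at_top filterlim_real_sequentially]) auto
  then show "(\<lambda>n. (D / sqrt (real n) / \<kappa>)\<^sup>2) \<longlonglongrightarrow> 0" by simp
qed simp

text \<open>Tonelli, and for each \<open>x\<close> the first absolute moment is at most the
  \<open>L2\<close> norm. The window length \<open>2 * \<epsilon>\<close> is the factor that can be
  made small later.\<close>

lemma expected_deviation_le:
  assumes n: "0 < n" and \<epsilon>: "0 < \<epsilon>"
  shows "(\<integral>\<^sup>+\<omega>. (\<integral>\<^sup>+x\<in>{a - \<epsilon>..a + \<epsilon>}. ennreal \<bar>ecdf X n \<omega> x - F x\<bar> \<partial>lborel) \<partial>M)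
    \<le> ennreal (2 * \<epsilon> * (D / sqrt (real n)))"
proof -
  interpret P: pair_sigma_finite M lborel ..
  have "(\<integral>\<^sup>+\<omega>. (\<integral>\<^sup>+x\<in>{a - \<epsilon>..a + \<epsilon>}. ennreal \<bar>ecdf X n \<omega> x - F x\<bar> \<partial>lborel) \<partial>M)
    = (\<integral>\<^sup>+x. (\<integral>\<^sup>+\<omega>. ennreal \<bar>ecdf X n \<omega> x - F x\<bar> * indicator {a - \<epsilon>..a + \<epsilon>} x \<partial>M) \<partial>lborel)"
    by (rule P.Fubini'[symmetric]) measurable
  also have "\<dots> \<le> (\<integral>\<^sup>+x. ennreal (D / sqrt (real n)) * indicator {a - \<epsilon>..a + \<epsilon>} x \<partial>lborel)"
  proof (rule nn_integral_mono)
    fix x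
    have L: "L2 M (\<lambda>\<omega>. ecdf X n \<omega> x - F x)" by (rule ecdf_deviation_L2)
    have "(\<integral>\<^sup>+\<omega>. ennreal \<bar>ecdf X n \<omega> x - F x\<bar> \<partial>M) = ennreal (expectation (\<lambda>\<omega>. \<bar>ecdf X n \<omega> x - F x\<bar>))"
      using L2_integrable[OF L] by (intro nn_integral_eq_integral) auto
    also have "\<dots> \<le> ennreal (D / sqrt (real n))"
      using abs_expectation_le_l2norm[OF L] ecdf_deviation[OF n, of x] by (intro ennreal_leI) linarith
    finally show "(\<integral>\<^sup>+\<omega>. ennreal \<bar>ecdf X n \<omega> x - F x\<bar> * indicator {a - \<epsilon>..a + \<epsilon>} x \<partial>M)
        \<le> ennreal (D / sqrt (real n)) * indicator {a - \<epsilon>..a + \<epsilon>} x"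
      by (simp split: split_indicator)
  qed
  also have "\<dots> = ennreal (D / sqrt (real n)) * ennreal (2 * \<epsilon>)"
    using \<epsilon> by (simp add: nn_integral_cmult_indicator)
  also have "\<dots> = ennreal (2 * \<epsilon> * (D / sqrt (real n)))"
    using D_nonneg \<epsilon> by (simp add: ennreal_mult[symmetric] mult.commute)
  finally show ?thesis .
qed

lemma sample_quantile_le_iff:
  "0 < n \<Longrightarrow> 0 < p \<Longrightarrow> p < 1 \<Longrightarrow> rquantile (ecdf X n \<omega>) p \<le> x \<longleftrightarrow> p \<le> ecdf X n \<omega> x"
  using cdf_distribution.rquantile_le_iff[OF cdf_distribution_sample[of \<omega> n], of p x]
  by (simp add: cdf_empirical)

lemma sample_quantile_measurable[measurable]:
  assumes "0 < n" "0 < p" "p < 1"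
  shows "(\<lambda>\<omega>. rquantile (ecdf X n \<omega>) p) \<in> borel_measurable M"
  unfolding borel_measurable_iff_le sample_quantile_le_iff[OF assms] by measurable

text \<open>The amount by which the population quantile misses the maximum in the variational
  formula of the sample. The subtracted bracket is an average over the sample, to which the central
  limit theorem applies.\<close>

definition remainder :: "real \<Rightarrow> nat \<Rightarrow> 'a \<Rightarrow> real" where
  "remainder p n \<omega> = (LINT u:{0..p}|lborel. rquantile (ecdf X n \<omega>) u)
    - (rquantile F p * p - (\<Sum>i=1..n. pos_part (rquantile F p - X (int i) \<omega>)) / real n)"

context
  fixes p :: real
  assumes p: "0 < p" "p < 1"
begin

lemma lower_integral_F:
  "(LINT u:{0..p}|lborel. rquantile F u)
    = rquantile F p * p - expectation (\<lambda>\<omega>. pos_part (rquantile F p - X 0 \<omega>))"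
  using F.lower_quantile_integral_eq[OF integrable_marginal p] by (simp add: F_eq integral_marginal)

lemma lower_integral_sample:
  "0 < n \<Longrightarrow> (LINT u:{0..p}|lborel. rquantile (ecdf X n \<omega>) u) = rquantile (ecdf X n \<omega>) p * p
    - (\<Sum>i=1..n. pos_part (rquantile (ecdf X n \<omega>) p - X (int i) \<omega>)) / real n"
  using cdf_distribution.lower_quantile_integral_eq[OF cdf_distribution_sample[of \<omega> n] integrable_sample p]
  by (simp add: cdf_empirical integral_empirical)

text \<open>The variational formula replaces the integral over \<open>u\<close> by an expression in
  the sample quantile, whose measurability is known.\<close>

lemma lower_integral_sample_measurable:
  assumes n: "0 < n"
  shows "(\<lambda>\<omega>. LINT u:{0..p}|lborel. rquantile (ecdf X n \<omega>) u) \<in> borel_measurable M"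
proof -
  note [measurable] = sample_quantile_measurable[OF n p]
  show ?thesis unfolding lower_integral_sample[OF n] pos_part_def by measurable
qed

lemma remainder_measurable:
  assumes n: "0 < n"
  shows "remainder p n \<in> borel_measurable M"
proof -
  note [measurable] = lower_integral_sample_measurable[OF n]
  show ?thesis unfolding remainder_def[abs_def] pos_part_def by measurable
qed

text \<open>The variational inequality of the sample, tested at the population quantile.\<close>

lemma remainder_nonneg:
  assumes n: "0 < n"
  shows "0 \<le> remainder p n \<omega>"
  using cdf_distribution.lower_quantile_integral_ge[OF cdf_distribution_sample[of \<omega> n] integrable_sample[OF n] p, of "rquantile F p"] n
  by (simp add: remainder_def cdf_empirical integral_empirical)

text \<open>Since the population quantile maximises the population functional, the remainder is at most
  the difference between the sample and population increments of \<open>b \<mapsto> E (b - X)\<^sup>+\<close> from the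
  population to the sample quantile.\<close>

lemma remainder_le:
  assumes n: "0 < n" and close: "\<bar>rquantile (ecdf X n \<omega>) p - rquantile F p\<bar> \<le> \<epsilon>"
  shows "ennreal (remainder p n \<omega>)
    \<le> (\<integral>\<^sup>+x\<in>{rquantile F p - \<epsilon>..rquantile F p + \<epsilon>}. ennreal \<bar>ecdf X n \<omega> x - F x\<bar> \<partial>lborel)"
proof -
  define a where "a = rquantile F p"
  define b where "b = rquantile (ecdf X n \<omega>) p"
  let ?J = "\<lambda>M b. integral\<^sup>L M (\<lambda>x. pos_part (b - x))"
  have "b * p - ?J marginal b \<le> a * p - ?J marginal a"
    using F.lower_quantile_integral_ge[OF integrable_marginal p, of b]
      F.lower_quantile_integral_eq[OF integrable_marginal p] by (simp add: a_def F_eq)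
  moreover have "remainder p n \<omega> = (b * p - ?J (sample n \<omega>) b) - (a * p - ?J (sample n \<omega>) a)"
    using n by (simp add: remainder_def lower_integral_sample integral_empirical a_def b_def)
  ultimately have "remainder p n \<omega> \<le>
      \<bar>(?J (sample n \<omega>) b - ?J (sample n \<omega>) a) - (?J marginal b - ?J marginal a)\<bar>"
    by linarith
  then have "ennreal (remainder p n \<omega>) \<le>
      ennreal \<bar>(?J (sample n \<omega>) b - ?J (sample n \<omega>) a) - (?J marginal b - ?J marginal a)\<bar>"
    by (rule ennreal_leI)
  also have "\<dots> \<le> (\<integral>\<^sup>+x\<in>{a - \<epsilon>..a + \<epsilon>}. ennreal \<bar>cdf (sample n \<omega>) x - cdf marginal x\<bar> \<partial>lborel)"
    using close by (intro pos_part_increment_diff_le real_distribution_empirical integrable_sample n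
        real_distribution_marginal integrable_marginal) (simp add: a_def b_def)
  finally show ?thesis using n by (simp add: cdf_empirical F_eq a_def)
qed

lemma cdf_less_quantile:
  assumes "x < rquantile F p"
  shows "F x < p"
  using F.rquantile_le_iff[OF p, of x] assms by (simp add: F_eq)

text \<open>If \<open>F x \<le> p\<close> held to the right of the quantile, every
  \<open>u > p\<close> would have its quantile beyond \<open>x\<close>, and the quantile function
  would jump at \<open>p\<close>.\<close>

lemma cdf_greater_quantile:
  assumes cont: "isCont (quantile F) p" and x: "rquantile F p < x"
  shows "p < F x"
proof (rule ccontr)
  assume "\<not> p < F x"
  then have Fx: "F x \<le> p" by simp
  have "(quantile F \<longlongrightarrow> quantile F p) (at_right p)"
    using cont by (auto simp: isCont_def intro: tendsto_within_subset)
  moreover have "\<forall>\<^sub>F u in at_right p. ereal x \<le> quantile F u"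
    unfolding eventually_at_right_field
  proof (intro exI[of _ 1] conjI allI impI)
    fix u assume u: "p < u" "u < 1"
    then have "\<not> u \<le> F x" using Fx by simp
    then have "x < rquantile F u" using F.rquantile_le_iff[of u x] u p by (simp add: F_eq)
    also have "ereal (rquantile F u) = quantile F u"
      using F.quantile_eq_I[of u] F.rquantile_eq_I[of u] u p by (simp add: F_eq)
    finally show "ereal x \<le> quantile F u" by simp
  qed (use p in simp)
  ultimately have "ereal x \<le> quantile F p"
    by (rule tendsto_lowerbound) simp
  then have "x \<le> rquantile F p"
    using F.quantile_eq_I[OF p] F.rquantile_eq_I[OF p] by (simp add: F_eq)
  then show False using x by simp
qed

lemma sample_quantile_consistent:
  assumes cont: "isCont (quantile F) p" and \<epsilon>: "0 < \<epsilon>"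
  shows "(\<lambda>n. prob {\<omega>\<in>space M. \<epsilon> < \<bar>rquantile (ecdf X n \<omega>) p - rquantile F p\<bar>}) \<longlonglongrightarrow> 0"
proof -
  define a where "a = rquantile F p"
  \<comment> \<open>Half the smaller margin in
    \<open>F (a - \<epsilon>) < p < F (a + \<epsilon>)\<close>. If neither empirical value errs by
    more than \<open>\<kappa>\<close>, the sample quantile lies within \<open>\<epsilon>\<close> of
    \<open>a\<close>.\<close>
  define \<kappa> where "\<kappa> = min (p - F (a - \<epsilon>)) (F (a + \<epsilon>) - p) / 2"
  have \<kappa>: "0 < \<kappa>" "F (a - \<epsilon>) + \<kappa> < p" "p < F (a + \<epsilon>) - \<kappa>"
    using cdf_less_quantile[of "a - \<epsilon>"] cdf_greater_quantile[OF cont, of "a + \<epsilon>"] \<epsilon>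
    by (auto simp: \<kappa>_def a_def min_def field_simps)
  let ?P = "\<lambda>x n. {\<omega>\<in>space M. \<kappa> < \<bar>ecdf X n \<omega> x - F x\<bar>}"
  show ?thesis
  proof (rule tendsto_sandwich[OF _ _ tendsto_const])
    show "\<forall>\<^sub>F n in sequentially. prob {\<omega>\<in>space M. \<epsilon> < \<bar>rquantile (ecdf X n \<omega>) p - rquantile F p\<bar>}
        \<le> prob (?P (a - \<epsilon>) n) + prob (?P (a + \<epsilon>) n)"
    proof (rule eventually_sequentiallyI[of 1])
      fix n :: nat assume n: "1 \<le> n"
      then have n0: "0 < n" by simp
      have "{\<omega>\<in>space M. \<epsilon> < \<bar>rquantile (ecdf X n \<omega>) p - rquantile F p\<bar>} \<subseteq> ?P (a - \<epsilon>) n \<union> ?P (a + \<epsilon>) n"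
      proof
        fix \<omega> assume \<omega>: "\<omega> \<in> {\<omega>\<in>space M. \<epsilon> < \<bar>rquantile (ecdf X n \<omega>) p - rquantile F p\<bar>}"
        then consider "rquantile (ecdf X n \<omega>) p \<le> a - \<epsilon>" | "\<not> rquantile (ecdf X n \<omega>) p \<le> a + \<epsilon>"
          by (fastforce simp: a_def)
        then show "\<omega> \<in> ?P (a - \<epsilon>) n \<union> ?P (a + \<epsilon>) n"
          using \<omega> \<kappa> unfolding sample_quantile_le_iff[OF n0 p] by cases auto
      qed
      then have "prob {\<omega>\<in>space M. \<epsilon> < \<bar>rquantile (ecdf X n \<omega>) p - rquantile F p\<bar>}
          \<le> prob (?P (a - \<epsilon>) n \<union> ?P (a + \<epsilon>) n)"
        by (intro finite_measure_mono) measurable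
      also have "\<dots> \<le> prob (?P (a - \<epsilon>) n) + prob (?P (a + \<epsilon>) n)"
        by (intro measure_Un_le) measurable
      finally show "prob {\<omega>\<in>space M. \<epsilon> < \<bar>rquantile (ecdf X n \<omega>) p - rquantile F p\<bar>}
        \<le> prob (?P (a - \<epsilon>) n) + prob (?P (a + \<epsilon>) n)" .
    qed
    show "(\<lambda>n. prob (?P (a - \<epsilon>) n) + prob (?P (a + \<epsilon>) n)) \<longlonglongrightarrow> 0"
      using tendsto_add[OF ecdf_consistent[OF \<kappa>(1)] ecdf_consistent[OF \<kappa>(1)]] by simp
  qed simp
qed

text \<open>A sample quantile far from \<open>a\<close> is unlikely by consistency. Otherwise the
  remainder is at most the deviation integral over a fixed window, of expectation
  \<open>O(\<epsilon> / sqrt n)\<close>, and Markov's inequality gives a probability of order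
  \<open>\<epsilon>\<close>, uniformly in \<open>n\<close>.\<close>

lemma remainder_negligible:
  assumes cont: "isCont (quantile F) p" and \<delta>: "0 < \<delta>"
  shows "(\<lambda>n. prob {\<omega>\<in>space M. \<delta> < \<bar>sqrt (real n) * remainder p n \<omega>\<bar>}) \<longlonglongrightarrow> 0"
proof (rule LIMSEQ_I)
  fix \<eta> :: real assume \<eta>: "0 < \<eta>"
  define a where "a = rquantile F p"
  \<comment> \<open>The \<open>+ 1\<close> permits the division below when
    \<open>D = 0\<close>.\<close>
  define d where "d = D + 1"
  have d: "0 < d" "D \<le> d" using D_nonneg by (simp_all add: d_def)
  \<comment> \<open>Chosen to make Markov's bound \<open>2 * \<epsilon> * D / \<delta>\<close> at
    most \<open>\<eta> / 2\<close>.\<close>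
  define \<epsilon> where "\<epsilon> = \<eta> * \<delta> / (4 * d)"
  have \<epsilon>: "0 < \<epsilon>" using \<eta> \<delta> d by (simp add: \<epsilon>_def)
  have "2 * \<epsilon> * D / \<delta> = \<eta> / 2 * (D / d)"
    using \<delta> d by (simp add: \<epsilon>_def field_simps)
  also have "\<dots> \<le> \<eta> / 2 * 1"
    using \<eta> d by (intro mult_left_mono) auto
  finally have \<epsilon>_le: "2 * \<epsilon> * D / \<delta> \<le> \<eta> / 2" by simp
  let ?far = "\<lambda>n. {\<omega>\<in>space M. \<epsilon> < \<bar>rquantile (ecdf X n \<omega>) p - a\<bar>}"
  obtain N where N: "\<And>n. n \<ge> N \<Longrightarrow> prob (?far n) < \<eta> / 2"
    using LIMSEQ_D[OF sample_quantile_consistent[OF cont \<epsilon>], of "\<eta> / 2"] \<eta> by (auto simp: a_def)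
  have bound: "prob {\<omega>\<in>space M. \<delta> < \<bar>sqrt (real n) * remainder p n \<omega>\<bar>} \<le> prob (?far n) + \<eta> / 2"
    if n: "0 < n" for n
  proof -
    note [measurable] = remainder_measurable[OF n] sample_quantile_measurable[OF n p]
    define H where "H \<omega> = (\<integral>\<^sup>+x\<in>{a - \<epsilon>..a + \<epsilon>}. ennreal \<bar>ecdf X n \<omega> x - F x\<bar> \<partial>lborel)" for \<omega>
    have [measurable]: "H \<in> borel_measurable M"
      unfolding H_def by measurable
    define k where "k = ennreal (sqrt (real n) / \<delta>)"
    define big where "big = {\<omega>\<in>space M. 1 \<le> k * H \<omega>}"
    have [measurable]: "big \<in> events" unfolding big_def by measurable
    have "emeasure M big \<le> k * (\<integral>\<^sup>+\<omega>. H \<omega> \<partial>M)"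
      using nn_integral_Markov_inequality[of H "space M" M k] by (simp add: big_def)
    also have "\<dots> \<le> k * ennreal (2 * \<epsilon> * (D / sqrt (real n)))"
      unfolding H_def by (intro mult_left_mono expected_deviation_le n \<epsilon>) simp
    also have "\<dots> = ennreal (2 * \<epsilon> * D / \<delta>)"
      unfolding k_def using n \<epsilon> \<delta> D_nonneg by (subst ennreal_mult[symmetric]) auto
    also have "\<dots> \<le> ennreal (\<eta> / 2)" by (intro ennreal_leI \<epsilon>_le)
    finally have big: "prob big \<le> \<eta> / 2"
      using \<eta> by (simp add: emeasure_eq_measure)
    have "{\<omega>\<in>space M. \<delta> < \<bar>sqrt (real n) * remainder p n \<omega>\<bar>} \<subseteq> ?far n \<union> big"
    proof
      fix \<omega> assume \<omega>: "\<omega> \<in> {\<omega>\<in>space M. \<delta> < \<bar>sqrt (real n) * remainder p n \<omega>\<bar>}"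
      show "\<omega> \<in> ?far n \<union> big"
      proof (cases "\<omega> \<in> ?far n")
        case False
        then have "ennreal (remainder p n \<omega>) \<le> H \<omega>"
          unfolding H_def a_def using \<omega> by (intro remainder_le[OF n]) (simp add: a_def)
        then have kH: "k * ennreal (remainder p n \<omega>) \<le> k * H \<omega>" by (rule mult_left_mono) simp
        have "1 \<le> sqrt (real n) / \<delta> * remainder p n \<omega>"
          using \<omega> \<delta> remainder_nonneg[OF n, of \<omega>] by (simp add: field_simps)
        then have "ennreal 1 \<le> ennreal (sqrt (real n) / \<delta> * remainder p n \<omega>)" by (rule ennreal_leI)
        also have "ennreal (sqrt (real n) / \<delta> * remainder p n \<omega>) = k * ennreal (remainder p n \<omega>)"
          unfolding k_def using \<delta> remainder_nonneg[OF n, of \<omega>] by (intro ennreal_mult) auto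
        finally have "1 \<le> k * ennreal (remainder p n \<omega>)" by simp
        then show ?thesis using \<omega> order_trans[OF _ kH] unfolding big_def by auto
      qed simp
    qed
    then have "prob {\<omega>\<in>space M. \<delta> < \<bar>sqrt (real n) * remainder p n \<omega>\<bar>} \<le> prob (?far n \<union> big)"
      by (intro finite_measure_mono) measurable
    also have "\<dots> \<le> prob (?far n) + prob big"
      by (intro measure_Un_le) measurable
    finally show ?thesis using big by simp
  qed
  show "\<exists>N. \<forall>n\<ge>N. norm (prob {\<omega>\<in>space M. \<delta> < \<bar>sqrt (real n) * remainder p n \<omega>\<bar>} - 0) < \<eta>"
  proof (intro exI[of _ "max N 1"] allI impI)
    fix n assume "max N 1 \<le> n"
    then show "norm (prob {\<omega>\<in>space M. \<delta> < \<bar>sqrt (real n) * remainder p n \<omega>\<bar>} - 0) < \<eta>"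
      using bound[of n] N[of n] by simp
  qed
qed

lemma lower_integral_diff:
  "(LINT u:{0..p}|lborel. rquantile (ecdf X n \<omega>) u) - (LINT u:{0..p}|lborel. rquantile F u)
    = remainder p n \<omega> - ((\<Sum>i=1..n. pos_part (rquantile F p - X (int i) \<omega>)) / real n
        - expectation (\<lambda>\<omega>. pos_part (rquantile F p - X 0 \<omega>)))"
  by (simp add: remainder_def lower_integral_F)

text \<open>The whole integral is the mean, and
  \<open>pos_part (x - a) = x - a + pos_part (a - x)\<close>. The means therefore cancel, and the
  remainder of the lower integral reappears with the opposite sign.\<close>

lemma upper_integral_diff:
  assumes n: "0 < n"
  shows "(LINT u:{p..1}|lborel. rquantile (ecdf X n \<omega>) u) - (LINT u:{p..1}|lborel. rquantile F u)
    = ((\<Sum>i=1..n. pos_part (X (int i) \<omega> - rquantile F p)) / real n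
        - expectation (\<lambda>\<omega>. pos_part (X 0 \<omega> - rquantile F p))) - remainder p n \<omega>"
proof -
  interpret E: cdf_distribution "sample n \<omega>" by (rule cdf_distribution_sample)
  define a where "a = rquantile F p"
  have pp: "pos_part (x - a) = x - a + pos_part (a - x)" for x by (simp add: pos_part_def)
  have "(LINT u:{p..1}|lborel. rquantile (ecdf X n \<omega>) u)
      = (\<Sum>i=1..n. X (int i) \<omega>) / real n - (LINT u:{0..p}|lborel. rquantile (ecdf X n \<omega>) u)"
    using E.set_integral_rquantile_combine[OF integrable_sample[OF n], of 0 p 1]
      E.set_integral_rquantile_total[OF integrable_sample[OF n]] p n
    by (simp add: cdf_empirical integral_empirical)
  moreover have "(LINT u:{p..1}|lborel. rquantile F u)
      = expectation (X 0) - (LINT u:{0..p}|lborel. rquantile F u)"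
    using F.set_integral_rquantile_combine[OF integrable_marginal, of 0 p 1]
      F.set_integral_rquantile_total[OF integrable_marginal] p
    by (simp add: F_eq integral_marginal)
  moreover have "(\<Sum>i=1..n. pos_part (X (int i) \<omega> - a)) / real n
      = (\<Sum>i=1..n. X (int i) \<omega>) / real n - a + (\<Sum>i=1..n. pos_part (a - X (int i) \<omega>)) / real n"
    using n by (simp add: pp sum.distrib sum_subtractf add_divide_distrib diff_divide_distrib)
  moreover have "expectation (\<lambda>\<omega>. pos_part (X 0 \<omega> - a))
      = expectation (X 0) - a + expectation (\<lambda>\<omega>. pos_part (a - X 0 \<omega>))"
  proof -
    have "integrable M (\<lambda>\<omega>. pos_part (a - X 0 \<omega>))"
      unfolding pos_part_def using X_integrable by auto
    then show ?thesis unfolding pp using X_integrable by (simp add: prob_space)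
  qed
  ultimately show ?thesis
    using lower_integral_diff[of n \<omega>] unfolding a_def by linarith
qed

lemma upper_integral_sample_measurable:
  assumes n: "0 < n"
  shows "(\<lambda>\<omega>. LINT u:{p..1}|lborel. rquantile (ecdf X n \<omega>) u) \<in> borel_measurable M"
proof -
  note [measurable] = remainder_measurable[OF n]
  have "(LINT u:{p..1}|lborel. rquantile (ecdf X n \<omega>) u) = (LINT u:{p..1}|lborel. rquantile F u)
    + (((\<Sum>i=1..n. pos_part (X (int i) \<omega> - rquantile F p)) / real n
        - expectation (\<lambda>\<omega>. pos_part (X 0 \<omega> - rquantile F p))) - remainder p n \<omega>)" for \<omega>
    using upper_integral_diff[OF n, of \<omega>] by linarith
  then show ?thesis unfolding pos_part_def by simp
qed

end

lemma middle_integral_eq: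
  assumes "0 < p1" "p1 < p2" "p2 < 1"
  shows "0 < n \<Longrightarrow> (LINT u:{p1..p2}|lborel. rquantile (ecdf X n \<omega>) u)
      = (LINT u:{0..p2}|lborel. rquantile (ecdf X n \<omega>) u) - (LINT u:{0..p1}|lborel. rquantile (ecdf X n \<omega>) u)"
    and "(LINT u:{p1..p2}|lborel. rquantile F u)
      = (LINT u:{0..p2}|lborel. rquantile F u) - (LINT u:{0..p1}|lborel. rquantile F u)"
  using cdf_distribution.set_integral_rquantile_combine[OF cdf_distribution_sample[of \<omega> n] integrable_sample, of 0 p1 p2]
    F.set_integral_rquantile_combine[OF integrable_marginal, of 0 p1 p2] assms
  by (simp_all add: cdf_empirical F_eq)

end

section \<open>Consequences of the mixing conditions\<close>

text \<open>The finitely many indices before the asymptotic bound sets in are absorbed into the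
  constant. \<open>C\<close> is strictly positive because it will scale the radius \<open>r\<close>
  of \<open>L2_of_Lq\<close>.\<close>

lemma bigo_powr_bound:
  fixes f :: "nat \<Rightarrow> real"
  assumes "f \<in> O(\<lambda>m. real m powr (- A))"
  obtains C where "0 < C" "\<And>m. 0 < m \<Longrightarrow> \<bar>f m\<bar> \<le> C * real m powr (- A)"
proof -
  obtain c where c: "c > 0" "eventually (\<lambda>m. norm (f m) \<le> c * norm (real m powr (- A))) sequentially"
    using landau_o.bigE[OF assms] .
  then obtain N where N: "\<And>m. m \<ge> N \<Longrightarrow> \<bar>f m\<bar> \<le> c * real m powr (- A)"
    by (auto simp: eventually_sequentially)
  define S where "S = (\<Sum>m<N. \<bar>f m\<bar> * real m powr A)"
  have S: "0 \<le> S" unfolding S_def by (intro sum_nonneg) auto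
  show thesis
  proof (rule that[of "c + S"])
    show "0 < c + S" using c S by simp
    fix m :: nat assume m: "0 < m"
    show "\<bar>f m\<bar> \<le> (c + S) * real m powr (- A)"
    proof (cases "m < N")
      case True
      have "\<bar>f m\<bar> * real m powr A \<le> S"
        unfolding S_def using True by (intro member_le_sum) auto
      then have "\<bar>f m\<bar> * real m powr A * real m powr (- A) \<le> (c + S) * real m powr (- A)"
        using c by (intro mult_right_mono) auto
      then show ?thesis using m by (simp add: mult.assoc powr_add[symmetric])
    next
      case False
      then have "\<bar>f m\<bar> \<le> c * real m powr (- A)" by (intro N) simp
      also have "\<dots> \<le> (c + S) * real m powr (- A)" using S by (intro mult_right_mono) auto
      finally show ?thesis .
    qed
  qed
qed

text \<open>A pointwise substitute for Lyapunov's inequality: \<open>y\<^sup>2 \<le> r\<^sup>2 * (1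
  + \<bar>y\<bar> powr q / r powr q)\<close>, clear if \<open>\<bar>y\<bar> \<le> r\<close> and a
  comparison of powers of \<open>\<bar>y\<bar> / r\<close> otherwise. The price is the factor
  \<open>sqrt 2\<close>.\<close>

lemma (in prob_space) L2_of_Lq:
  assumes [measurable]: "Y \<in> borel_measurable M" and int: "integrable M (\<lambda>\<omega>. \<bar>Y \<omega>\<bar> powr q)"
    and q: "2 \<le> q" and r: "0 < r" "expectation (\<lambda>\<omega>. \<bar>Y \<omega>\<bar> powr q) \<le> r powr q"
  shows "L2 M Y" "l2norm M Y \<le> sqrt 2 * r"
proof -
  have le: "(Y \<omega>)\<^sup>2 \<le> r\<^sup>2 * (1 + \<bar>Y \<omega>\<bar> powr q / r powr q)" for \<omega>
  proof (cases "\<bar>Y \<omega>\<bar> \<le> r")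
    case True
    then have "(Y \<omega>)\<^sup>2 \<le> r\<^sup>2 * 1" using power_mono[OF True, of 2] by simp
    also have "\<dots> \<le> r\<^sup>2 * (1 + \<bar>Y \<omega>\<bar> powr q / r powr q)" by (intro mult_left_mono) auto
    finally show ?thesis .
  next
    case False
    then have gt: "1 \<le> \<bar>Y \<omega>\<bar> / r" using r by simp
    have "(Y \<omega>)\<^sup>2 = r\<^sup>2 * (\<bar>Y \<omega>\<bar> / r)\<^sup>2" using r by (simp add: power_divide)
    also have "(\<bar>Y \<omega>\<bar> / r)\<^sup>2 = (\<bar>Y \<omega>\<bar> / r) powr 2" using gt by (simp add: powr_numeral)
    also have "\<dots> \<le> (\<bar>Y \<omega>\<bar> / r) powr q" using gt q by (intro powr_mono) auto
    also have "\<dots> = \<bar>Y \<omega>\<bar> powr q / r powr q" using r by (simp add: powr_divide)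
    also have "\<dots> \<le> 1 + \<bar>Y \<omega>\<bar> powr q / r powr q" by simp
    finally show ?thesis by (simp add: mult_left_mono)
  qed
  have int': "integrable M (\<lambda>\<omega>. r\<^sup>2 * (1 + \<bar>Y \<omega>\<bar> powr q / r powr q))"
    using int by simp
  then show L: "L2 M Y"
    unfolding L2_def using le by (auto intro: Bochner_Integration.integrable_bound[OF int'] order_trans[OF le abs_ge_self])
  have "(l2norm M Y)\<^sup>2 \<le> expectation (\<lambda>\<omega>. r\<^sup>2 * (1 + \<bar>Y \<omega>\<bar> powr q / r powr q))"
    unfolding l2norm_power2 using L2_square_integrable[OF L] int' le by (rule integral_mono)
  also have "\<dots> = r\<^sup>2 * (1 + expectation (\<lambda>\<omega>. \<bar>Y \<omega>\<bar> powr q) / r powr q)"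
    using int by (simp add: prob_space)
  also have "\<dots> \<le> r\<^sup>2 * (1 + 1)"
    using r by (intro mult_left_mono add_left_mono) (auto simp: divide_le_eq_1)
  also have "\<dots> = (sqrt 2 * r)\<^sup>2" by (simp add: power_mult_distrib)
  finally show "l2norm M Y \<le> sqrt 2 * r" by (rule power2_le_imp_le) (use r in simp)
qed

lemma (in stationary_series) approximable_series_if_M_mixing:
  assumes q: "q > 2" and X0: "integrable M (\<lambda>\<omega>. \<bar>X 0 \<omega>\<bar> powr q)"
    and mix: "M_mixing M q X \<rho>" and \<rho>: "\<rho> \<in> O(\<lambda>m. real m powr (- A))" and A: "1 < A"
  obtains \<Psi> C where "approximable_series M X \<Psi> C A"
proof -
  obtain \<Psi> where \<Psi>: "\<And>t m. 0 < m \<Longrightarrow> \<Psi> t m \<in> borel_measurable M"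
      "\<And>t m. 0 < m \<Longrightarrow> integrable M (\<lambda>\<omega>. \<bar>X t \<omega> - \<Psi> t m \<omega>\<bar> powr q)"
      "\<And>t m. 0 < m \<Longrightarrow> expectation (\<lambda>\<omega>. \<bar>X t \<omega> - \<Psi> t m \<omega>\<bar> powr q) powr (1 / q) \<le> \<rho> m"
    and sep: "separated_blocks_indep M \<Psi> max"
    using mix unfolding M_mixing_def by blast
  obtain C where C: "0 < C" "\<And>m. 0 < m \<Longrightarrow> \<bar>\<rho> m\<bar> \<le> C * real m powr (- A)"
    by (rule bigo_powr_bound[OF \<rho>], rule that)
  have mom: "expectation (\<lambda>\<omega>. \<bar>X t \<omega> - \<Psi> t m \<omega>\<bar> powr q) \<le> (C * real m powr (- A)) powr q"
    if m: "0 < m" for t m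
  proof -
    let ?e = "expectation (\<lambda>\<omega>. \<bar>X t \<omega> - \<Psi> t m \<omega>\<bar> powr q)"
    have "?e powr (1 / q) \<le> C * real m powr (- A)"
      using \<Psi>(3)[OF m, of t] C(2)[OF m] by linarith
    then have "(?e powr (1 / q)) powr q \<le> (C * real m powr (- A)) powr q"
      using q by (intro powr_mono2) auto
    then show ?thesis using q by (simp add: powr_powr)
  qed
  have pos: "0 < C * real m powr (- A)" if "0 < m" for m using C that by simp
  show thesis
  proof (rule that[of \<Psi> "sqrt 2 * C"], unfold_locales)
    fix t and m :: nat assume m: "0 < m"
    note [measurable] = \<Psi>(1)[OF m]
    show "\<Psi> t m \<in> borel_measurable M" by measurable
    have D: "(\<lambda>\<omega>. X t \<omega> - \<Psi> t m \<omega>) \<in> borel_measurable M" by measurable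
    show "L2 M (\<lambda>\<omega>. X t \<omega> - \<Psi> t m \<omega>)"
      using q by (intro L2_of_Lq(1)[OF D \<Psi>(2)[OF m] _ pos[OF m] mom[OF m]]) simp
    show "l2norm M (\<lambda>\<omega>. X t \<omega> - \<Psi> t m \<omega>) \<le> sqrt 2 * C * real m powr (- A)"
      using L2_of_Lq(2)[OF D \<Psi>(2)[OF m] _ pos[OF m] mom[OF m]] q by (simp add: mult.assoc)
  next
    fix t
    define e where "e = expectation (\<lambda>\<omega>. \<bar>X 0 \<omega>\<bar> powr q)"
    have e: "0 \<le> e" unfolding e_def by (intro integral_nonneg_AE) auto
    \<comment> \<open>The radius \<open>1 + e\<close> is positive and its \<open>q\<close>-th power
      dominates the moment \<open>e\<close>, as \<open>q > 1\<close>.\<close>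
    have "e powr 1 \<le> (1 + e) powr q"
      using q e order_trans[OF powr_mono2[of 1 e "1 + e"] powr_mono[of 1 q "1 + e"]] by simp
    then have "L2 M (X 0)"
      using q e by (intro L2_of_Lq(1)[OF X_measurable X0, of "1 + e"]) (simp_all flip: e_def)
    then show "L2 M (X t)" using L2_X[of "\<lambda>x. x" t] by simp
  qed (use A sep in auto)
qed

text \<open>The indicators differ only if \<open>X t\<close> and \<open>Z\<close> lie on two sides
  of \<open>x\<close>. Then either they are at least \<open>\<gamma>\<close> apart or
  \<open>X t\<close> is within \<open>\<gamma>\<close> of \<open>x\<close>.\<close>

lemma (in stationary_series) indicator_approx_le:
  assumes F: "F = cdf (distr M borel (X 0))" and Z[measurable]: "Z \<in> borel_measurable M"
  shows "(l2norm M (\<lambda>\<omega>. indicator {..x} (X t \<omega>) - indicator {..x} (Z \<omega>)))\<^sup>2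
    \<le> prob {\<omega>\<in>space M. \<gamma> \<le> \<bar>X t \<omega> - Z \<omega>\<bar>} + \<bar>F (x + \<gamma>) - F (x - \<gamma>)\<bar>"
proof -
  interpret F: real_distribution "distr M borel (X 0)" by (rule real_distribution_distr) simp
  let ?E = "{\<omega>\<in>space M. \<gamma> \<le> \<bar>X t \<omega> - Z \<omega>\<bar>}"
  let ?G = "{\<omega>\<in>space M. X t \<omega> \<in> {x - \<gamma><..x + \<gamma>}}"
  have [measurable]: "?E \<in> events" "?G \<in> events" by measurable
  have "prob ?G = measure (distr M borel (X t)) {x - \<gamma><..x + \<gamma>}"
    by (subst measure_distr) (auto intro!: arg_cong[of _ _ prob])
  also have "\<dots> = measure (distr M borel (X 0)) {x - \<gamma><..x + \<gamma>}" by (simp add: distr_X[of t])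
  also have "\<dots> \<le> \<bar>F (x + \<gamma>) - F (x - \<gamma>)\<bar>"
    \<comment> \<open>For \<open>\<gamma> \<le> 0\<close> the open interval is empty.\<close>
    unfolding F using F.cdf_diff_eq[of "x - \<gamma>" "x + \<gamma>"] by (cases "0 < \<gamma>") auto
  finally have G: "prob ?G \<le> \<bar>F (x + \<gamma>) - F (x - \<gamma>)\<bar>" .
  have "(l2norm M (\<lambda>\<omega>. indicator {..x} (X t \<omega>) - indicator {..x} (Z \<omega>)))\<^sup>2
      = expectation (\<lambda>\<omega>. (indicator {..x} (X t \<omega>) - indicator {..x} (Z \<omega>))\<^sup>2)"
    by (rule l2norm_power2)
  also have "\<dots> \<le> expectation (\<lambda>\<omega>. indicator ?E \<omega> + indicator ?G \<omega>)"
  proof (rule integral_mono)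
    show "integrable M (\<lambda>\<omega>. (indicator {..x} (X t \<omega>) - indicator {..x} (Z \<omega>) :: real)\<^sup>2)"
      by (rule integrable_const_bound[of _ 1]) (auto split: split_indicator)
    show "integrable M (\<lambda>\<omega>. indicator ?E \<omega> + indicator ?G \<omega> :: real)"
      by (intro Bochner_Integration.integrable_add integrable_real_indicator) (auto simp: emeasure_eq_measure)
    show "(indicator {..x} (X t \<omega>) - indicator {..x} (Z \<omega>))\<^sup>2 \<le> (indicator ?E \<omega> + indicator ?G \<omega> :: real)"
      if "\<omega> \<in> space M" for \<omega>
      using that by (auto split: split_indicator)
  qed
  also have "\<dots> = prob ?E + prob ?G"
    by (subst Bochner_Integration.integral_add) (auto simp: emeasure_eq_measure)
  finally show ?thesis using G by linarith
qed

text \<open>The radius \<open>m powr (- A / \<theta>)\<close> is matched to the Hoelder exponent: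
  both terms of \<open>indicator_approx_le\<close> become \<open>O(m powr (- A))\<close>. This
  bounds the squared norm, so covariances decay with exponent \<open>A / 2\<close>, which must
  exceed \<open>1\<close>. No constant depends on \<open>x\<close>.\<close>

lemma (in stationary_series) empirical_process_if_S_mixing:
  assumes F: "F = cdf (distr M borel (X 0))" and X0: "integrable M (X 0)"
    and \<theta>: "\<theta> > 0" and c: "c > 0" and Hoelder: "\<And>x y. \<bar>F x - F y\<bar> \<le> c * \<bar>x - y\<bar> powr \<theta>"
    and A: "A > 2"
    and mix: "S_mixing M X (\<lambda>m. real m powr (- A / \<theta>)) \<delta>" and \<delta>: "\<delta> \<in> O(\<lambda>m. real m powr (- A))"
  obtains D where "empirical_process M X F D"
proof -
  obtain \<Upsilon> where \<Upsilon>: "\<And>t m. 0 < m \<Longrightarrow> \<Upsilon> t m \<in> borel_measurable M"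
      "\<And>t m. 0 < m \<Longrightarrow> prob {\<omega>\<in>space M. real m powr (- A / \<theta>) \<le> \<bar>X t \<omega> - \<Upsilon> t m \<omega>\<bar>} \<le> \<delta> m"
    and sep: "separated_blocks_indep M \<Upsilon> (\<lambda>m m'. m + m')"
    using mix unfolding S_mixing_def by blast
  obtain C where C: "0 < C" "\<And>m. 0 < m \<Longrightarrow> \<bar>\<delta> m\<bar> \<le> C * real m powr (- A)"
    by (rule bigo_powr_bound[OF \<delta>], rule that)
  \<comment> \<open>\<open>C\<close> accounts for a failed approximation,
    \<open>c * 2 powr \<theta>\<close> for the mass of \<open>F\<close> between
    \<open>x - ?g\<close> and \<open>x + ?g\<close>.\<close>
  define E where "E = sqrt (C + c * 2 powr \<theta>)"
  define b where "b k = 8 powr (A / 2) * (1\<^sup>2 + E * (2 * 1 + E)) * (1 + real k) powr (- (A / 2))" for k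
  have E: "E\<^sup>2 = C + c * 2 powr \<theta>" "0 \<le> E" using C c by (simp_all add: E_def)
  have b: "summable b"
    unfolding b_def using A by (intro summable_mult summable_one_plus_powr) simp
  let ?I = "\<lambda>x y :: real. indicator {..x} y :: real"
  have I_L2: "L2 M (\<lambda>\<omega>. ?I x (Y \<omega>))" "l2norm M (\<lambda>\<omega>. ?I x (Y \<omega>)) \<le> 1"
    if Y: "Y \<in> borel_measurable M" for x Y
  proof -
    have meas: "(\<lambda>\<omega>. ?I x (Y \<omega>)) \<in> borel_measurable M"
      by (rule measurable_compose[OF Y]) simp
    have bound: "\<bar>?I x (Y \<omega>)\<bar> \<le> 1" for \<omega> by (simp split: split_indicator)
    show "L2 M (\<lambda>\<omega>. ?I x (Y \<omega>))" "l2norm M (\<lambda>\<omega>. ?I x (Y \<omega>)) \<le> 1"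
      by (rule L2_bounded[OF meas bound])+
  qed
  have covar: "\<bar>covar M (\<lambda>\<omega>. ?I x (X s \<omega>)) (\<lambda>\<omega>. ?I x (X t \<omega>))\<bar> \<le> b (nat \<bar>s - t\<bar>)" for x s t
    unfolding b_def
  proof (rule covar_decay[where Y = "\<lambda>t \<omega>. ?I x (X t \<omega>)" and Z = "\<lambda>t m \<omega>. ?I x (\<Upsilon> t m \<omega>)"])
    show "L2 M (\<lambda>\<omega>. ?I x (X t \<omega>))" "l2norm M (\<lambda>\<omega>. ?I x (X t \<omega>)) \<le> 1" for t
      by (intro I_L2 X_measurable)+
    fix t m assume m: "0 < (m :: nat)"
    show "L2 M (\<lambda>\<omega>. ?I x (\<Upsilon> t m \<omega>))" by (intro I_L2 \<Upsilon> m)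
    let ?g = "real m powr (- A / \<theta>)"
    have "\<bar>F (x + ?g) - F (x - ?g)\<bar> \<le> c * \<bar>(x + ?g) - (x - ?g)\<bar> powr \<theta>" by (rule Hoelder)
    also have "\<bar>(x + ?g) - (x - ?g)\<bar> = 2 * ?g" by simp
    also have "(2 * ?g) powr \<theta> = 2 powr \<theta> * real m powr (- A)"
      using \<theta> by (simp add: powr_mult powr_powr)
    finally have 1: "\<bar>F (x + ?g) - F (x - ?g)\<bar> \<le> c * 2 powr \<theta> * real m powr (- A)" by simp
    have "(l2norm M (\<lambda>\<omega>. ?I x (X t \<omega>) - ?I x (\<Upsilon> t m \<omega>)))\<^sup>2
        \<le> C * real m powr (- A) + c * 2 powr \<theta> * real m powr (- A)"
      using indicator_approx_le[OF F \<Upsilon>(1)[OF m], of x t t ?g] 1 \<Upsilon>(2)[OF m, of t] C(2)[OF m] by linarith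
    also have "\<dots> = E\<^sup>2 * real m powr (- A)" unfolding E by (simp add: algebra_simps)
    also have "real m powr (- A) = (real m powr (- (A / 2)))\<^sup>2"
      by (simp add: power2_eq_square powr_add[symmetric])
    finally have "(l2norm M (\<lambda>\<omega>. ?I x (X t \<omega>) - ?I x (\<Upsilon> t m \<omega>)))\<^sup>2 \<le> (E * real m powr (- (A / 2)))\<^sup>2"
      by (simp add: power_mult_distrib)
    then show "l2norm M (\<lambda>\<omega>. ?I x (X t \<omega>) - ?I x (\<Upsilon> t m \<omega>)) \<le> E * real m powr (- (A / 2))"
      by (rule power2_le_imp_le) (use E in simp)
  next
    fix s t and m :: nat assume m: "0 < m" "2 * int m < \<bar>s - t\<bar>"
    have "indep_var borel (\<Upsilon> s m) borel (\<Upsilon> t m)"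
      by (rule separated_blocks_indep_pair[OF sep]) (use m in auto)
    from indep_var_compose[OF this, of "?I x" borel "?I x" borel]
    show "indep_var borel (\<lambda>\<omega>. ?I x (\<Upsilon> s m \<omega>)) borel (\<lambda>\<omega>. ?I x (\<Upsilon> t m \<omega>))"
      by (simp add: comp_def)
  qed (use A in simp)
  show thesis
  proof (rule that[of "sqrt (2 * suminf b)"], unfold_locales)
    fix n :: nat and x assume n: "0 < n"
    have mean: "expectation (\<lambda>\<omega>. ?I x (X t \<omega>)) = F x" for t
    proof -
      have "expectation (\<lambda>\<omega>. ?I x (X t \<omega>)) = expectation (\<lambda>\<omega>. ?I x (X 0 \<omega>))"
        by (rule expectation_X) measurable
      also have "\<dots> = integral\<^sup>L (distr M borel (X 0)) (?I x)"
        by (rule integral_distr[symmetric]) measurable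
      finally show ?thesis by (simp add: F cdf_def)
    qed
    have "ecdf X n \<omega> x - F x = 1 / real n * (\<Sum>t\<in>{1..int n}. (?I x (X t \<omega>) - expectation (\<lambda>\<omega>. ?I x (X t \<omega>))))" for \<omega>
    proof -
      have "(\<Sum>i=1..n. ?I x (X (int i) \<omega>)) = (\<Sum>t\<in>{1..int n}. ?I x (X t \<omega>))"
        by (rule sum.reindex_bij_witness[of _ nat int]) auto
      then show ?thesis
        using n unfolding ecdf_def mean by (simp add: sum_subtractf diff_divide_distrib)
    qed
    then have "l2norm M (\<lambda>\<omega>. ecdf X n \<omega> x - F x)
        = 1 / real n * l2norm M (\<lambda>\<omega>. \<Sum>t\<in>{1..int n}. (?I x (X t \<omega>) - expectation (\<lambda>\<omega>. ?I x (X t \<omega>))))"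
      using l2norm_cmult[of M "1 / real n"] by simp
    also have "\<dots> \<le> 1 / real n * sqrt (real n * (2 * suminf b))"
      using l2norm_sum_le_covar_bound[OF b covar I_L2(1)[OF X_measurable], of "{1..int n}" x]
      by (intro mult_left_mono real_le_rsqrt) auto
    also have "\<dots> = sqrt (real n) / real n * sqrt (2 * suminf b)" by (simp add: real_sqrt_mult)
    also have "sqrt (real n) / real n = 1 / sqrt (real n)"
      using n by (simp add: field_simps)
    finally show "l2norm M (\<lambda>\<omega>. ecdf X n \<omega> x - F x) \<le> sqrt (2 * suminf b) / sqrt (real n)" by simp
  qed (use F X0 in auto)
qed

lemma weak_conv_m_centered_normal:
  assumes "prob_space M" "0 \<le> \<nu>" and [measurable]: "\<And>n. A n \<in> borel_measurable M"
    and "\<And>s. (\<lambda>n. char (distr M borel (A n)) s) \<longlonglongrightarrow> exp (- (s\<^sup>2 * \<nu>\<^sup>2 / 2))"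
  shows "weak_conv_m (\<lambda>n. distr M borel (A n)) (centered_normal \<nu>)"
  by (rule levy_continuity)
    (use assms in \<open>auto simp: char_centered_normal
      intro: real_distribution_centered_normal prob_space.real_distribution_distr\<close>)

lemma (in prob_space) prob_diff_tendsto_0:
  fixes A B :: "nat \<Rightarrow> 'a \<Rightarrow> real"
  assumes meas: "\<And>n. 0 < n \<Longrightarrow> A n \<in> borel_measurable M" "\<And>n. 0 < n \<Longrightarrow> B n \<in> borel_measurable M"
    and A: "\<And>\<epsilon>. 0 < \<epsilon> \<Longrightarrow> (\<lambda>n. prob {\<omega>\<in>space M. \<epsilon> < \<bar>A n \<omega>\<bar>}) \<longlonglongrightarrow> 0"
    and B: "\<And>\<epsilon>. 0 < \<epsilon> \<Longrightarrow> (\<lambda>n. prob {\<omega>\<in>space M. \<epsilon> < \<bar>B n \<omega>\<bar>}) \<longlonglongrightarrow> 0"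
    and \<epsilon>: "0 < \<epsilon>"
  shows "(\<lambda>n. prob {\<omega>\<in>space M. \<epsilon> < \<bar>A n \<omega> - B n \<omega>\<bar>}) \<longlonglongrightarrow> 0"
proof (rule tendsto_sandwich[OF _ _ tendsto_const])
  let ?P = "\<lambda>A n. {\<omega>\<in>space M. \<epsilon> / 2 < \<bar>A n \<omega>\<bar>}"
  show "\<forall>\<^sub>F n in sequentially. prob {\<omega>\<in>space M. \<epsilon> < \<bar>A n \<omega> - B n \<omega>\<bar>} \<le> prob (?P A n) + prob (?P B n)"
  proof (rule eventually_sequentiallyI[of 1])
    fix n :: nat assume "1 \<le> n"
    then have n: "0 < n" by simp
    note [measurable] = meas[OF n]
    have "\<epsilon> / 2 < \<bar>A n \<omega>\<bar> \<or> \<epsilon> / 2 < \<bar>B n \<omega>\<bar>" if "\<epsilon> < \<bar>A n \<omega> - B n \<omega>\<bar>" for \<omega>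
      using that by linarith
    then have "{\<omega>\<in>space M. \<epsilon> < \<bar>A n \<omega> - B n \<omega>\<bar>} \<subseteq> ?P A n \<union> ?P B n" by blast
    then have "prob {\<omega>\<in>space M. \<epsilon> < \<bar>A n \<omega> - B n \<omega>\<bar>} \<le> prob (?P A n \<union> ?P B n)"
      by (intro finite_measure_mono) measurable
    also have "\<dots> \<le> prob (?P A n) + prob (?P B n)"
      by (intro measure_Un_le) measurable
    finally show "prob {\<omega>\<in>space M. \<epsilon> < \<bar>A n \<omega> - B n \<omega>\<bar>} \<le> prob (?P A n) + prob (?P B n)" .
  qed
  show "(\<lambda>n. prob (?P A n) + prob (?P B n)) \<longlonglongrightarrow> 0"
    using tendsto_add[OF A B, of "\<epsilon> / 2" "\<epsilon> / 2"] \<epsilon> by simp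
qed simp

text \<open>The sign \<open>\<sigma>\<close> with which the sample average enters does not change
  the limit, since the characteristic function of a centred normal law is even.\<close>

lemma (in approximable_series) lipschitz_CLT_remainder:
  fixes T E :: "nat \<Rightarrow> 'a \<Rightarrow> real"
  assumes g: "L-lipschitz_on UNIV g" and \<sigma>: "\<sigma>\<^sup>2 = 1"
    and T_measurable: "\<And>n. 0 < n \<Longrightarrow> T n \<in> borel_measurable M"
    and T_eq: "\<And>n \<omega>. 0 < n \<Longrightarrow>
      T n \<omega> = \<sigma> * ((\<Sum>i=1..n. g (X (int i) \<omega>)) / real n - expectation (\<lambda>\<omega>. g (X 0 \<omega>))) + E n \<omega>"
    and E: "\<And>\<epsilon>. 0 < \<epsilon> \<Longrightarrow> (\<lambda>n. prob {\<omega>\<in>space M. \<epsilon> < \<bar>sqrt (real n) * E n \<omega>\<bar>}) \<longlonglongrightarrow> 0"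
  shows "\<exists>\<nu>\<ge>0. ((\<lambda>k::int. covar M (\<lambda>\<omega>. g (X 0 \<omega>)) (\<lambda>\<omega>. g (X k \<omega>))) has_sum \<nu>\<^sup>2) UNIV \<and>
    weak_conv_m (\<lambda>n. distr M borel (\<lambda>\<omega>. sqrt (real n) *
      ((\<Sum>i=1..n. g (X (int i) \<omega>)) / real n - expectation (\<lambda>\<omega>. g (X 0 \<omega>))))) (centered_normal \<nu>) \<and>
    weak_conv_m (\<lambda>n. distr M borel (\<lambda>\<omega>. sqrt (real n) * T n \<omega>)) (centered_normal \<nu>)"
proof -
  have [measurable]: "g \<in> borel_measurable borel" using g by (rule borel_measurable_lipschitz)
  define S where "S n \<omega> = sqrt (real n) *
      ((\<Sum>i=1..n. g (X (int i) \<omega>)) / real n - expectation (\<lambda>\<omega>. g (X 0 \<omega>)))" for n \<omega>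
  have [measurable]: "S n \<in> borel_measurable M" for n unfolding S_def by measurable
  obtain \<nu> where \<nu>: "0 \<le> \<nu>"
      "((\<lambda>k::int. covar M (\<lambda>\<omega>. g (X 0 \<omega>)) (\<lambda>\<omega>. g (X k \<omega>))) has_sum \<nu>\<^sup>2) UNIV"
    and S': "\<And>s. (\<lambda>n. char (distr M borel (\<lambda>\<omega>. sqrt (real n) *
      ((\<Sum>i=1..n. g (X (int i) \<omega>)) / real n - expectation (\<lambda>\<omega>. g (X 0 \<omega>))))) s)
        \<longlonglongrightarrow> exp (- (s\<^sup>2 * \<nu>\<^sup>2 / 2))"
    by (rule lipschitz_CLT[OF g], rule that)
  have S: "(\<lambda>n. char (distr M borel (S n)) s) \<longlonglongrightarrow> exp (- (s\<^sup>2 * \<nu>\<^sup>2 / 2))" for s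
    using S'[of s] unfolding S_def[abs_def] .
  \<comment> \<open>At \<open>n = 0\<close>, where nothing is assumed of \<open>T\<close>, the
    factor \<open>sqrt 0\<close> makes the function constant.\<close>
  have T'_measurable: "(\<lambda>\<omega>. sqrt (real n) * T n \<omega>) \<in> borel_measurable M" for n
    using T_measurable[of n] by (cases "n = 0") auto
  have "(\<lambda>n. char (distr M borel (\<lambda>\<omega>. sqrt (real n) * T n \<omega>)) s) \<longlonglongrightarrow> exp (- (s\<^sup>2 * \<nu>\<^sup>2 / 2))" for s
  proof (rule char_tendsto_approx)
    have "char (distr M borel (\<lambda>\<omega>. \<sigma> * S n \<omega>)) s = char (distr M borel (S n)) (\<sigma> * s)" for n
      unfolding char_def by (simp add: integral_distr ac_simps)
    then show "(\<lambda>n. char (distr M borel (\<lambda>\<omega>. \<sigma> * S n \<omega>)) s) \<longlonglongrightarrow> exp (- (s\<^sup>2 * \<nu>\<^sup>2 / 2))"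
      using S[of "\<sigma> * s"] \<sigma> by (simp add: power_mult_distrib)
    show "(\<lambda>n. prob {\<omega>\<in>space M. \<epsilon> < \<bar>\<sigma> * S n \<omega> - sqrt (real n) * T n \<omega>\<bar>}) \<longlonglongrightarrow> 0" if \<epsilon>: "0 < \<epsilon>" for \<epsilon>
    proof (rule Lim_transform_eventually[OF E[OF \<epsilon>]])
      have "\<bar>\<sigma> * S n \<omega> - sqrt (real n) * T n \<omega>\<bar> = \<bar>sqrt (real n) * E n \<omega>\<bar>" if "0 < n" for n \<omega>
        unfolding T_eq[OF that] S_def by (simp add: algebra_simps)
      then show "\<forall>\<^sub>F n in sequentially. prob {\<omega>\<in>space M. \<epsilon> < \<bar>sqrt (real n) * E n \<omega>\<bar>}
          = prob {\<omega>\<in>space M. \<epsilon> < \<bar>\<sigma> * S n \<omega> - sqrt (real n) * T n \<omega>\<bar>}"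
        by (intro eventually_sequentiallyI[of 1]) simp
    qed
  qed (use T'_measurable in measurable)
  then have "weak_conv_m (\<lambda>n. distr M borel (\<lambda>\<omega>. sqrt (real n) * T n \<omega>)) (centered_normal \<nu>)"
    by (intro weak_conv_m_centered_normal prob_space_axioms \<nu>(1) T'_measurable)
  moreover have "weak_conv_m (\<lambda>n. distr M borel (S n)) (centered_normal \<nu>)"
    by (intro weak_conv_m_centered_normal prob_space_axioms \<nu>(1) S) measurable
  ultimately show ?thesis using \<nu> unfolding S_def by blast
qed

lemma lipschitz_pos_part: "1-lipschitz_on UNIV (\<lambda>x. pos_part (x - a))" "1-lipschitz_on UNIV (\<lambda>x. pos_part (a - x))"
  by (auto simp: lipschitz_on_def pos_part_def dist_real_def)

theorem corollary8p4:
  fixes M :: "'a measure" and X :: "int \<Rightarrow> 'a \<Rightarrow> real" and F :: "real \<Rightarrow> real"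
    and q \<theta> c A1 A2 \<eta> :: real and \<delta> \<rho> :: "nat \<Rightarrow> real"
  assumes "prob_space M"
    and "\<And>t. X t \<in> borel_measurable M"
    and "strictly_stationary M X"
    and "F = cdf (distr M borel (X 0))"
    and "q > 2" and "integrable M (\<lambda>\<omega>. \<bar>X 0 \<omega>\<bar> powr q)"
    and "\<theta> > 0" and "c > 0" and "\<And>x y. \<bar>F x - F y\<bar> \<le> c * \<bar>x - y\<bar> powr \<theta>"
    and "A1 > 4"
    and "S_mixing M X (\<lambda>m. real m powr (- A1 / \<theta>)) \<delta>"
    and "\<delta> \<in> O(\<lambda>m. real m powr (- A1))"
    and "M_mixing M q X \<rho>"
    and "\<rho> \<in> O(\<lambda>m. real m powr (- A2))"
    and "\<eta> > 0" and "(1 + \<eta>) / q < 1 / 2"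
    and "A2 > max 1 ((q - 2) / (2 * \<eta>) * (1 - (1 + \<eta>) / q))"
  shows "
    (\<forall>p. 0 < p \<and> p < 1 \<and> isCont (quantile F) p \<longrightarrow>
       (let h = (\<lambda>x. pos_part (x - rquantile F p)) in
        \<exists>\<nu>\<ge>0.
          ((\<lambda>k::int. covar M (\<lambda>\<omega>. h (X 0 \<omega>)) (\<lambda>\<omega>. h (X k \<omega>))) has_sum \<nu>\<^sup>2) UNIV \<and>
          weak_conv_m (\<lambda>n. distr M borel (\<lambda>\<omega>. sqrt (real n) *
              ((\<Sum>i=1..n. h (X (int i) \<omega>)) / real n - (LINT \<omega>'|M. h (X 0 \<omega>')))))
            (centered_normal \<nu>) \<and>
          weak_conv_m (\<lambda>n. distr M borel (\<lambda>\<omega>. sqrt (real n) *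
              ((LINT u:{p..1}|lborel. rquantile (ecdf X n \<omega>) u)
                - (LINT u:{p..1}|lborel. rquantile F u))))
            (centered_normal \<nu>))) \<and>
    (\<forall>p. 0 < p \<and> p < 1 \<and> isCont (quantile F) p \<longrightarrow>
       (let h = (\<lambda>x. pos_part (rquantile F p - x)) in
        \<exists>\<nu>\<ge>0.
          ((\<lambda>k::int. covar M (\<lambda>\<omega>. h (X 0 \<omega>)) (\<lambda>\<omega>. h (X k \<omega>))) has_sum \<nu>\<^sup>2) UNIV \<and>
          weak_conv_m (\<lambda>n. distr M borel (\<lambda>\<omega>. sqrt (real n) *
              ((\<Sum>i=1..n. h (X (int i) \<omega>)) / real n - (LINT \<omega>'|M. h (X 0 \<omega>')))))
            (centered_normal \<nu>) \<and>
          weak_conv_m (\<lambda>n. distr M borel (\<lambda>\<omega>. sqrt (real n) *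
              ((LINT u:{0..p}|lborel. rquantile (ecdf X n \<omega>) u)
                - (LINT u:{0..p}|lborel. rquantile F u))))
            (centered_normal \<nu>))) \<and>
    (\<forall>p1 p2. 0 < p1 \<and> p1 < p2 \<and> p2 < 1 \<and> isCont (quantile F) p1 \<and> isCont (quantile F) p2 \<longrightarrow>
       (let h = (\<lambda>x. pos_part (rquantile F p2 - x) - pos_part (rquantile F p1 - x)) in
        \<exists>\<nu>\<ge>0.
          ((\<lambda>k::int. covar M (\<lambda>\<omega>. h (X 0 \<omega>)) (\<lambda>\<omega>. h (X k \<omega>))) has_sum \<nu>\<^sup>2) UNIV \<and>
          weak_conv_m (\<lambda>n. distr M borel (\<lambda>\<omega>. sqrt (real n) *
              ((\<Sum>i=1..n. h (X (int i) \<omega>)) / real n - (LINT \<omega>'|M. h (X 0 \<omega>')))))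
            (centered_normal \<nu>) \<and>
          weak_conv_m (\<lambda>n. distr M borel (\<lambda>\<omega>. sqrt (real n) *
              ((LINT u:{p1..p2}|lborel. rquantile (ecdf X n \<omega>) u)
                - (LINT u:{p1..p2}|lborel. rquantile F u))))
            (centered_normal \<nu>)))"
proof -
  interpret prob_space M by fact
  interpret stationary_series M X by unfold_locales fact+
  obtain \<Psi> C where "approximable_series M X \<Psi> C A2"
    using approximable_series_if_M_mixing[of q \<rho> A2] assms by auto
  then interpret approximable_series M X \<Psi> C A2 .
  obtain D where "empirical_process M X F D"
    using empirical_process_if_S_mixing[of F \<theta> c A1 \<delta>] L2_integrable[OF X_L2[of 0]] assms by auto
  then interpret empirical_process M X F D .
  show ?thesis
    unfolding Let_def
  proof (intro conjI allI impI; elim conjE)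
    fix p :: real assume p: "0 < p" "p < 1" and cont: "isCont (quantile F) p"
    let ?a = "rquantile F p"
    show "\<exists>\<nu>\<ge>0. ((\<lambda>k::int. covar M (\<lambda>\<omega>. pos_part (X 0 \<omega> - ?a)) (\<lambda>\<omega>. pos_part (X k \<omega> - ?a))) has_sum \<nu>\<^sup>2) UNIV \<and>
        weak_conv_m (\<lambda>n. distr M borel (\<lambda>\<omega>. sqrt (real n) *
          ((\<Sum>i=1..n. pos_part (X (int i) \<omega> - ?a)) / real n - (LINT \<omega>'|M. pos_part (X 0 \<omega>' - ?a)))))
          (centered_normal \<nu>) \<and>
        weak_conv_m (\<lambda>n. distr M borel (\<lambda>\<omega>. sqrt (real n) *
          ((LINT u:{p..1}|lborel. rquantile (ecdf X n \<omega>) u) - (LINT u:{p..1}|lborel. rquantile F u))))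
          (centered_normal \<nu>)"
    proof (rule lipschitz_CLT_remainder[where \<sigma> = 1 and E = "\<lambda>n \<omega>. - remainder p n \<omega>"])
      show "1-lipschitz_on UNIV (\<lambda>x. pos_part (x - ?a))" by (rule lipschitz_pos_part)
      fix n :: nat and \<omega> assume n: "0 < n"
      show "(\<lambda>\<omega>. (LINT u:{p..1}|lborel. rquantile (ecdf X n \<omega>) u) - (LINT u:{p..1}|lborel. rquantile F u))
          \<in> borel_measurable M"
        using upper_integral_sample_measurable[OF p n] by simp
      show "(LINT u:{p..1}|lborel. rquantile (ecdf X n \<omega>) u) - (LINT u:{p..1}|lborel. rquantile F u)
          = 1 * ((\<Sum>i=1..n. pos_part (X (int i) \<omega> - ?a)) / real n - expectation (\<lambda>\<omega>. pos_part (X 0 \<omega> - ?a)))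
            + - remainder p n \<omega>"
        using upper_integral_diff[OF p n, of \<omega>] by simp
    qed (use remainder_negligible[OF p cont] in simp_all)
    show "\<exists>\<nu>\<ge>0. ((\<lambda>k::int. covar M (\<lambda>\<omega>. pos_part (?a - X 0 \<omega>)) (\<lambda>\<omega>. pos_part (?a - X k \<omega>))) has_sum \<nu>\<^sup>2) UNIV \<and>
        weak_conv_m (\<lambda>n. distr M borel (\<lambda>\<omega>. sqrt (real n) *
          ((\<Sum>i=1..n. pos_part (?a - X (int i) \<omega>)) / real n - (LINT \<omega>'|M. pos_part (?a - X 0 \<omega>')))))
          (centered_normal \<nu>) \<and>
        weak_conv_m (\<lambda>n. distr M borel (\<lambda>\<omega>. sqrt (real n) *
          ((LINT u:{0..p}|lborel. rquantile (ecdf X n \<omega>) u) - (LINT u:{0..p}|lborel. rquantile F u))))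
          (centered_normal \<nu>)"
    \<comment> \<open>The lower integral contains \<open>pos_part (b - X)\<close> with a minus sign,
      hence \<open>-1\<close>.\<close>
    proof (rule lipschitz_CLT_remainder[where \<sigma> = "-1" and E = "remainder p"])
      show "1-lipschitz_on UNIV (\<lambda>x. pos_part (?a - x))" by (rule lipschitz_pos_part)
      fix n :: nat and \<omega> assume n: "0 < n"
      show "(\<lambda>\<omega>. (LINT u:{0..p}|lborel. rquantile (ecdf X n \<omega>) u) - (LINT u:{0..p}|lborel. rquantile F u))
          \<in> borel_measurable M"
        using lower_integral_sample_measurable[OF p n] by simp
      show "(LINT u:{0..p}|lborel. rquantile (ecdf X n \<omega>) u) - (LINT u:{0..p}|lborel. rquantile F u)
          = -1 * ((\<Sum>i=1..n. pos_part (?a - X (int i) \<omega>)) / real n - expectation (\<lambda>\<omega>. pos_part (?a - X 0 \<omega>)))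
            + remainder p n \<omega>"
        using lower_integral_diff[OF p, of n \<omega>] by simp
    qed (use remainder_negligible[OF p cont] in simp_all)
  next
    fix p1 p2 :: real
    assume p: "0 < p1" "p1 < p2" "p2 < 1" and cont: "isCont (quantile F) p1" "isCont (quantile F) p2"
    let ?h = "\<lambda>x. pos_part (rquantile F p2 - x) - pos_part (rquantile F p1 - x)"
    have p1: "0 < p1" "p1 < 1" and p2: "0 < p2" "p2 < 1" using p by auto
    show "\<exists>\<nu>\<ge>0. ((\<lambda>k::int. covar M (\<lambda>\<omega>. ?h (X 0 \<omega>)) (\<lambda>\<omega>. ?h (X k \<omega>))) has_sum \<nu>\<^sup>2) UNIV \<and>
        weak_conv_m (\<lambda>n. distr M borel (\<lambda>\<omega>. sqrt (real n) *
          ((\<Sum>i=1..n. ?h (X (int i) \<omega>)) / real n - (LINT \<omega>'|M. ?h (X 0 \<omega>'))))) (centered_normal \<nu>) \<and>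
        weak_conv_m (\<lambda>n. distr M borel (\<lambda>\<omega>. sqrt (real n) *
          ((LINT u:{p1..p2}|lborel. rquantile (ecdf X n \<omega>) u) - (LINT u:{p1..p2}|lborel. rquantile F u))))
          (centered_normal \<nu>)"
    \<comment> \<open>A difference of two lower integrals: the linear parts combine to
      \<open>- ?h\<close>, and the remainders are negligible separately.\<close>
    proof (rule lipschitz_CLT_remainder[where g = ?h and \<sigma> = "-1" and E = "\<lambda>n \<omega>. remainder p2 n \<omega> - remainder p1 n \<omega>"])
      show "(1 + 1)-lipschitz_on UNIV ?h" by (intro lipschitz_on_diff lipschitz_pos_part)
      fix n :: nat and \<omega> assume n: "0 < n"
      show "(\<lambda>\<omega>. (LINT u:{p1..p2}|lborel. rquantile (ecdf X n \<omega>) u) - (LINT u:{p1..p2}|lborel. rquantile F u))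
          \<in> borel_measurable M"
        unfolding middle_integral_eq(1)[OF p n]
        using lower_integral_sample_measurable[OF p1 n] lower_integral_sample_measurable[OF p2 n] by simp
      have "integrable M (\<lambda>\<omega>. pos_part (a - X 0 \<omega>))" for a
        unfolding pos_part_def using X_integrable by auto
      then show "(LINT u:{p1..p2}|lborel. rquantile (ecdf X n \<omega>) u) - (LINT u:{p1..p2}|lborel. rquantile F u)
          = -1 * ((\<Sum>i=1..n. ?h (X (int i) \<omega>)) / real n - expectation (\<lambda>\<omega>. ?h (X 0 \<omega>)))
            + (remainder p2 n \<omega> - remainder p1 n \<omega>)"
        unfolding middle_integral_eq(1)[OF p n] middle_integral_eq(2)[OF p]
        using lower_integral_diff[OF p1, of n \<omega>] lower_integral_diff[OF p2, of n \<omega>]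
        by (simp add: sum_subtractf diff_divide_distrib)
    next
      fix \<epsilon> :: real assume \<epsilon>: "0 < \<epsilon>"
      have "(\<lambda>\<omega>. sqrt (real n) * remainder p n \<omega>) \<in> borel_measurable M" if "0 < n" "0 < p" "p < 1" for n p
        using remainder_measurable[OF that(2,3,1)] by simp
      from prob_diff_tendsto_0[OF this[OF _ p2] this[OF _ p1] remainder_negligible[OF p2 cont(2)]
          remainder_negligible[OF p1 cont(1)] \<epsilon>]
      show "(\<lambda>n. prob {\<omega>\<in>space M. \<epsilon> < \<bar>sqrt (real n) * (remainder p2 n \<omega> - remainder p1 n \<omega>)\<bar>}) \<longlonglongrightarrow> 0"
        by (simp add: right_diff_distrib)
    qed simp_all
  qed
qed

end
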